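(* Let $X$ be a symmetrically self-similar graph with bounded geometry and origin vertex $o$. Then there exist a $1$-periodic, holomorphic function $\omega$ on the strip $S(\tau)$ and a number $r>0$ such that the Green function $G$ has the local singular expansion $$G(z)=(1-z)^{\frac{d_s}{2}-1}\biggl(\omega\biggl(\frac{\log(1-z)}{\log(\tau)}\biggr)+\mathcal O_\delta(|z-1|)\biggr)$$ for $z\in U_\delta(1,r)$ and $0<\delta<\pi$ (the constant in $\mathcal O_\delta$ may depend on $\delta$).
   Context: Graphs $X=(VX,EX)$ are undirected, without loops or multiple edges. The boundary $\theta C$ of $C\subset VX$ is the set of vertices in $VX\setminus C$ which are adjacent to some vertex in $C$, and $\hat C$ denotes the subgraph of $X$ spanned by $C\cup\theta C$, with vertex set $V\hat C$. For $F\subset VX$ let $\mathcal C_X(F)$ be the set of connected components of $VX\setminus F$. The reduced graph $X_F$ has vertex set $VX_F=F$, and two vertices $x,y\in F$ are joined by an edge of $X_F$ if and only if there is a $C\in\mathcal C_X(F)$ with $x,y\in\theta C$. A connected infinite graph $X$ is self-similar with respect to $F\subset VX$ and $\psi:VX\to VX_F$ if (F1) no vertices in $F$ are adjacent in $X$; (F2) the intersection of the boundaries of two different components in $\mathcal C_X(F)$ contains not more than one vertex; (F3) $\psi$ is an isomorphism between $X$ and $X_F$. The components in $\mathcal C_X(F)$ are called cells (1-cells), and $\hat C$ is the cell graph of a cell $C$. The 2-cells are the connected components of $VX\setminus\psi(F)$. An origin vertex is a fixed point of $\psi$. A self-similar graph $X$ is symmetrically self-similar if it is locally finite and: (S1)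 all cells are finite and for any pair of cells $C,D$ there exists an isomorphism $\alpha$ of $\hat C$ and $\hat D$ such that $\alpha(\theta C)=\theta D$; (S2) the automorphism group $\mathrm{Aut}(\hat C)$ acts transitively on $\{(x,y)\mid x,y\in\theta C,\ x\ne y\}$. A graph has bounded geometry if its set of vertex degrees is bounded. The mass scaling factor $\mu$ is the number of 1-cells contained in a 2-cell (independent of the 2-cell). For a cell $C$ and nonempty $B\subset\theta C$, let $Q_B=(q_B(x,y))_{x,y\in V\hat C}$ with $q_B(x,y)=1/\deg_{\hat C}(x)$ if $x\in V\hat C\setminus B$ is adjacent to $y$ in $\hat C$, and $q_B(x,y)=0$ otherwise; let $Q_B^*(z)=(I-zQ_B)^{-1}$. For $v\in\theta C$ the transition function is the rational function $d(z)=\sum_{w\in\theta C\setminus\{v\}}(Q^*_{\theta C\setminus\{v\}}(z))_{v,w}$, independent of $v$ and $C$. The time scaling factor is $\tau=d'(1)$, and the spectral dimension is $d_s=2\log(\mu)/\log(\tau)$. $p^{(n)}(x,y)$ denotes the $n$-step transition probability of the simple random walk on $X$. The Green function is $G(z)=\sum_{n\ge0}p^{(n)}(o,o)z^n$ for $|z|<1$; it is understood with its holomorphic continuation, which exists at least on $(\mathbb C\setminus\mathbb R)\cup(-1,1)$. For $z_0\in\mathbb C$, $r>0$, $0<\delta\le\pi$: $U_\delta(z_0,r)$ is the set of all $z\in\mathbb C\setminus\{z_0\}$ with $|z-z_0|<r$ and $|\arg(z_0-z)|<\delta$ (principal argument). For $b>1$: $S(b)=\{z\in\mathbb C\mid|\mathrm{Im}(z)|<\pi/\log(b)\}$.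 Powers and logarithms are principal branches. *)

theory Defs
  imports "HOL-Complex_Analysis.Complex_Analysis"
begin

section \<open>Graphs\<close>

record 'a ugraph =
  verts :: "'a set"
  edges :: "'a set set"

definition simple_graph :: "'a ugraph \<Rightarrow> bool" where
  "simple_graph X \<longleftrightarrow> (\<forall>e\<in>edges X. e \<subseteq> verts X \<and> card e = 2)"

definition adj :: "'a ugraph \<Rightarrow> 'a \<Rightarrow> 'a \<Rightarrow> bool" where
  "adj X x y \<longleftrightarrow> {x, y} \<in> edges X"

definition neighbours :: "'a ugraph \<Rightarrow> 'a \<Rightarrow> 'a set" where
  "neighbours X x = {y. adj X x y}"

definition degree :: "'a ugraph \<Rightarrow> 'a \<Rightarrow> nat" where
  "degree X x = card (neighbours X x)"

definition locally_finite_graph :: "'a ugraph \<Rightarrow> bool" where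
  "locally_finite_graph X \<longleftrightarrow> (\<forall>x\<in>verts X. finite (neighbours X x))"

text \<open>Only meaningful for locally finite graphs, since \<^const>\<open>card\<close> is 0 on infinite sets.\<close>

definition bounded_geometry :: "'a ugraph \<Rightarrow> bool" where
  "bounded_geometry X \<longleftrightarrow> bdd_above (degree X ` verts X)"

definition induced_subgraph :: "'a ugraph \<Rightarrow> 'a set \<Rightarrow> 'a ugraph" where
  "induced_subgraph X A = \<lparr>verts = A, edges = {e \<in> edges X. e \<subseteq> A}\<rparr>"

definition linked :: "'a ugraph \<Rightarrow> ('a \<times> 'a) set" where
  "linked X = {(x, y). x \<in> verts X \<and> y \<in> verts X \<and> (adj X)\<^sup>*\<^sup>* x y}"

definition connected_graph :: "'a ugraph \<Rightarrow> bool" where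
  "connected_graph X \<longleftrightarrow> (\<forall>x\<in>verts X. \<forall>y\<in>verts X. (x, y) \<in> linked X)"

definition conn_components :: "'a ugraph \<Rightarrow> 'a set set" where
  "conn_components X = verts X // linked X"

definition graph_iso :: "'a ugraph \<Rightarrow> 'b ugraph \<Rightarrow> ('a \<Rightarrow> 'b) \<Rightarrow> bool" where
  "graph_iso X Y f \<longleftrightarrow> bij_betw f (verts X) (verts Y) \<and>
     (\<forall>x\<in>verts X. \<forall>y\<in>verts X. adj X x y \<longleftrightarrow> adj Y (f x) (f y))"

definition boundary :: "'a ugraph \<Rightarrow> 'a set \<Rightarrow> 'a set" where
  "boundary X C = {x \<in> verts X - C. \<exists>y\<in>C. adj X x y}"

definition hat_graph :: "'a ugraph \<Rightarrow> 'a set \<Rightarrow> 'a ugraph" where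
  "hat_graph X C = induced_subgraph X (C \<union> boundary X C)"

section \<open>Self-similar graphs\<close>

definition cells :: "'a ugraph \<Rightarrow> 'a set \<Rightarrow> 'a set set" where
  "cells X F = conn_components (induced_subgraph X (verts X - F))"

definition reduced_graph :: "'a ugraph \<Rightarrow> 'a set \<Rightarrow> 'a ugraph" where
  "reduced_graph X F = \<lparr>verts = F,
     edges = {{x, y} |x y. x \<in> F \<and> y \<in> F \<and> x \<noteq> y \<and>
                (\<exists>C\<in>cells X F. x \<in> boundary X C \<and> y \<in> boundary X C)}\<rparr>"

definition self_similar :: "'a ugraph \<Rightarrow> 'a set \<Rightarrow> ('a \<Rightarrow> 'a) \<Rightarrow> bool" where
  "self_similar X F \<psi> \<longleftrightarrow>
     simple_graph X \<and> connected_graph X \<and> infinite (verts X) \<and> F \<subseteq> verts X \<and>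
     (\<forall>x\<in>F. \<forall>y\<in>F. \<not> adj X x y) \<and>
     (\<forall>C\<in>cells X F. \<forall>D\<in>cells X F. C \<noteq> D \<longrightarrow>
        (\<forall>x\<in>boundary X C \<inter> boundary X D. \<forall>y\<in>boundary X C \<inter> boundary X D. x = y)) \<and>
     graph_iso X (reduced_graph X F) \<psi>"

definition symmetrically_self_similar :: "'a ugraph \<Rightarrow> 'a set \<Rightarrow> ('a \<Rightarrow> 'a) \<Rightarrow> bool" where
  "symmetrically_self_similar X F \<psi> \<longleftrightarrow>
     self_similar X F \<psi> \<and> locally_finite_graph X \<and>
     (\<forall>C\<in>cells X F. finite C) \<and>
     (\<forall>C\<in>cells X F. \<forall>D\<in>cells X F. \<exists>\<alpha>.
        graph_iso (hat_graph X C) (hat_graph X D) \<alpha> \<and> \<alpha> ` boundary X C = boundary X D) \<and>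
     (\<forall>C\<in>cells X F.
        \<forall>x\<in>boundary X C. \<forall>y\<in>boundary X C. \<forall>x'\<in>boundary X C. \<forall>y'\<in>boundary X C.
          x \<noteq> y \<longrightarrow> x' \<noteq> y' \<longrightarrow>
          (\<exists>g. graph_iso (hat_graph X C) (hat_graph X C) g \<and> g x = x' \<and> g y = y'))"

definition origin_vertex :: "'a ugraph \<Rightarrow> ('a \<Rightarrow> 'a) \<Rightarrow> 'a \<Rightarrow> bool" where
  "origin_vertex X \<psi> v \<longleftrightarrow> v \<in> verts X \<and> \<psi> v = v"

section \<open>Scaling factors\<close>

definition mass_scaling :: "'a ugraph \<Rightarrow> 'a set \<Rightarrow> ('a \<Rightarrow> 'a) \<Rightarrow> nat" where
  "mass_scaling X F \<psi> =
     (THE m. \<forall>D\<in>cells X (\<psi> ` F). card {C \<in> cells X F. C \<subseteq> D} = m)"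

text \<open>
  Matrices with rows and columns indexed by a finite set \<open>V\<close> are functions that matter on
  \<open>V \<times> V\<close> only. The inverse is normalised to vanish off \<open>V \<times> V\<close>, which makes it unique; the
  value is unspecified if the matrix is singular.
\<close>

definition inverse_matrix_on :: "'a set \<Rightarrow> ('a \<Rightarrow> 'a \<Rightarrow> complex) \<Rightarrow> 'a \<Rightarrow> 'a \<Rightarrow> complex" where
  "inverse_matrix_on V A = (THE M.
     (\<forall>x y. x \<notin> V \<or> y \<notin> V \<longrightarrow> M x y = 0) \<and>
     (\<forall>x\<in>V. \<forall>y\<in>V. (\<Sum>k\<in>V. A x k * M k y) = of_bool (x = y)) \<and>
     (\<forall>x\<in>V. \<forall>y\<in>V. (\<Sum>k\<in>V. M x k * A k y) = of_bool (x = y)))"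

definition Q_matrix :: "'a ugraph \<Rightarrow> 'a set \<Rightarrow> 'a set \<Rightarrow> 'a \<Rightarrow> 'a \<Rightarrow> complex" where
  "Q_matrix X C B x y =
     (if x \<in> verts (hat_graph X C) - B \<and> adj (hat_graph X C) x y
      then 1 / of_nat (degree (hat_graph X C) x) else 0)"

definition Q_star :: "'a ugraph \<Rightarrow> 'a set \<Rightarrow> 'a set \<Rightarrow> complex \<Rightarrow> 'a \<Rightarrow> 'a \<Rightarrow> complex" where
  "Q_star X C B z =
     inverse_matrix_on (verts (hat_graph X C)) (\<lambda>x y. of_bool (x = y) - z * Q_matrix X C B x y)"

text \<open>
  The rational function \<open>d\<close> computed at the cell \<open>C\<close> and \<open>v \<in> boundary X C\<close>, as a function on the
  (cofinite) set of \<open>z\<close> at which the matrix is invertible. This set is a neighbourhood of 1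
  for the cells of a symmetrically self-similar graph.
\<close>

definition transition_function :: "'a ugraph \<Rightarrow> 'a set \<Rightarrow> 'a \<Rightarrow> complex \<Rightarrow> complex" where
  "transition_function X C v z = (\<Sum>w\<in>boundary X C - {v}. Q_star X C (boundary X C - {v}) z v w)"

definition time_scaling :: "'a ugraph \<Rightarrow> 'a set \<Rightarrow> real" where
  "time_scaling X F = (THE t. \<forall>C\<in>cells X F. \<forall>v\<in>boundary X C.
     (transition_function X C v has_field_derivative of_real t) (at 1))"

definition spectral_dim :: "'a ugraph \<Rightarrow> 'a set \<Rightarrow> ('a \<Rightarrow> 'a) \<Rightarrow> real" where
  "spectral_dim X F \<psi> = 2 * ln (real (mass_scaling X F \<psi>)) / ln (time_scaling X F)"

section \<open>Simple random walk and Green function\<close>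

fun srw_prob :: "'a ugraph \<Rightarrow> nat \<Rightarrow> 'a \<Rightarrow> 'a \<Rightarrow> real" where
  "srw_prob X 0 x y = of_bool (x = y)"
| "srw_prob X (Suc n) x y = (\<Sum>w\<in>neighbours X x. 1 / real (degree X x) * srw_prob X n w y)"

definition green_domain :: "complex set" where
  "green_domain = (- \<real>) \<union> complex_of_real ` {-1<..<1}"

text \<open>
  The power series together with its holomorphic continuation. The continuation is unique on
  \<open>green_domain\<close>, which is connected; the values elsewhere are unspecified.
\<close>

definition green_function :: "'a ugraph \<Rightarrow> 'a \<Rightarrow> complex \<Rightarrow> complex" where
  "green_function X v = (SOME G. G holomorphic_on green_domain \<and>
     (\<forall>z. norm z < 1 \<longrightarrow> (\<lambda>n. of_real (srw_prob X n v v) * z ^ n) sums G z))"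

section \<open>Regions in the complex plane\<close>

definition U_region :: "real \<Rightarrow> complex \<Rightarrow> real \<Rightarrow> complex set" where
  "U_region \<delta> z0 r = {z. z \<noteq> z0 \<and> norm (z - z0) < r \<and> \<bar>Arg (z0 - z)\<bar> < \<delta>}"

definition strip :: "real \<Rightarrow> complex set" where
  "strip b = {z. \<bar>Im z\<bar> < pi / ln b}"

end

theory Submission
  imports Defs
begin

text \<open>
  Let \<open>P\<close> be the transition operator. The walk observed on \<open>F\<close> is again a simple random walk, which yields
  \<open>G(z) = f(z) G(d(z))\<close> on the unit disc, where \<open>f\<close> generates the returns to a boundary vertex of a cell
  before another boundary vertex is hit. At the repelling fixed point 1 of \<open>d\<close> one has
  \<open>f(1) = \<tau> / \<mu>\<close>, by balancing the expected time spent in a cell.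

  Let \<open>D\<close> be the inverse of \<open>d\<close> near 1. Summing logarithms of \<open>\<tau> (1 - D z) / (1 - z)\<close> and of
  \<open>(\<mu> / \<tau>) f(D z)\<close> along the orbits of \<open>D\<close> gives holomorphic \<open>A\<close>, \<open>B\<close> vanishing at 1 such that
  \<open>t = (1 - z) e\<^sup>A\<close> turns \<open>D\<close> into \<open>t \<mapsto> t / \<tau>\<close> and
  \<open>e\<^sup>B t\<^sup>-\<^sup>\<alpha> G\<close> is invariant under it, \<open>\<alpha> = ln \<mu> / ln \<tau> - 1\<close>. In the coordinate \<open>ln t / ln \<tau>\<close> the
  invariant function is \<open>\<omega>\<close>, and replacing \<open>t\<close> by \<open>1 - z\<close> costs \<open>O(\<bar>z - 1\<bar>)\<close> inside each sector.

  The continuation of \<open>G\<close> to the doubly slit plane comes from the substitution \<open>z = 2 \<zeta> / (1 + \<zeta>\<^sup>2)\<close>,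
  which turns the coefficients into matrix entries of Chebyshev polynomials of \<open>P\<close>. These grow at most
  linearly because \<open>P\<close> is a self-adjoint contraction.
\<close>

section \<open>Logarithmic coordinates at a repelling fixed point\<close>

text \<open>The automorphisms in (S2) may move the boundary of a cell, so symmetry of the walk
  absorbed on part of it cannot be read off; it is deduced from the walk without absorption, whose
  Green kernel takes only two values on the boundary. For \<open>f(1)\<close>: vertex degrees are a
  stationary measure, which gives \<open>\<theta> \<delta>0 \<tau> = f(1) vol\<close> for a cell
  graph with \<open>\<theta>\<close> boundary points of degree \<open>\<delta>0\<close> and degree
  sum \<open>vol\<close>. The fixed point of \<open>\<psi>\<close> forces
  \<open>\<delta>0 = \<theta> - 1\<close>, and \<open>\<psi>\<close> carries the ordered edges of a
  cell graph to the ordered pairs of boundary points of the 1-cells in a 2-cell, so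
  \<open>vol = \<mu> \<theta> (\<theta> - 1)\<close>. The renewal equation is known only inside the
  unit disc, but orbits of \<open>D\<close> also start outside; uniqueness of continuation extends
  it to a disc at 1 slit along the real axis to the right of 1. This needs \<open>D\<close> to
  respect the slit, hence the attention to real values. The radius \<open>r\<close> does not depend
  on \<open>\<delta>\<close>: only the part of the sector treated as close to 1 shrinks with
  \<open>\<delta>\<close>, and the rest is compact.\<close>

lemma holomorphic_local_inverse:
  fixes f :: "complex \<Rightarrow> complex"
  assumes "f holomorphic_on S" "open S" "\<xi> \<in> S" "deriv f \<xi> \<noteq> 0"
  obtains r e g where "r > 0" "ball \<xi> r \<subseteq> S" "inj_on f (ball \<xi> r)" "e > 0"
    "ball (f \<xi>) e \<subseteq> f ` ball \<xi> r" "g holomorphic_on ball (f \<xi>) e"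
    "\<forall>w \<in> ball (f \<xi>) e. g w \<in> ball \<xi> r" "\<forall>w \<in> ball (f \<xi>) e. f (g w) = w"
    "\<forall>z \<in> ball \<xi> r. g (f z) = z"
    "deriv f \<xi> * deriv g (f \<xi>) = 1"
proof -
  obtain r where r: "r > 0" "ball \<xi> r \<subseteq> S" "open (f ` ball \<xi> r)" "inj_on f (ball \<xi> r)"
    using has_complex_derivative_locally_invertible[OF assms(1,3,2,4)] by blast
  obtain g where g: "g holomorphic_on (f ` ball \<xi> r)"
    "\<And>z. z \<in> ball \<xi> r \<Longrightarrow> deriv f z * deriv g (f z) = 1" "\<And>z. z \<in> ball \<xi> r \<Longrightarrow> g (f z) = z"
    using holomorphic_has_inverse[OF holomorphic_on_subset[OF assms(1) r(2)] open_ball r(4)] by blast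
  have "f \<xi> \<in> f ` ball \<xi> r" using r by auto
  then obtain e where e: "e > 0" "ball (f \<xi>) e \<subseteq> f ` ball \<xi> r"
    using r(3) open_contains_ball by blast
  show ?thesis
  proof (rule that[of r e g])
    show "g holomorphic_on ball (f \<xi>) e" using g(1) e(2) holomorphic_on_subset by blast
    have "g w \<in> ball \<xi> r \<and> f (g w) = w" if w: "w \<in> ball (f \<xi>) e" for w
    proof -
      obtain z where "z \<in> ball \<xi> r" "w = f z" using w e(2) by (auto simp del: mem_ball)
      then show ?thesis using g(3) by simp
    qed
    then show "\<forall>w \<in> ball (f \<xi>) e. g w \<in> ball \<xi> r" "\<forall>w \<in> ball (f \<xi>) e. f (g w) = w"
      by blast+
  qed (use r e g in auto)
qed

lemma holomorphic_lipschitz_at: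
  fixes f :: "complex \<Rightarrow> complex"
  assumes "f holomorphic_on ball a e" "e > 0"
  obtains e' c where "0 < e'" "e' \<le> e" "c \<ge> 0" "\<And>z. z \<in> ball a e' \<Longrightarrow> norm (f z - f a) \<le> c * norm (z - a)"
proof -
  have "f field_differentiable at a" using assms by (simp add: holomorphic_on_imp_differentiable_at)
  then obtain D where D: "(f has_field_derivative D) (at a)" by (auto simp: field_differentiable_def)
  then have "((\<lambda>z. norm ((f z - f a) / (z - a))) \<longlongrightarrow> norm D) (at a)"
    unfolding has_field_derivative_iff by (rule tendsto_norm)
  then have "eventually (\<lambda>z. norm ((f z - f a) / (z - a)) < norm D + 1) (at a)"
    by (rule order_tendstoD) simp
  then obtain d where d: "d > 0" "\<And>z. z \<noteq> a \<Longrightarrow> dist z a < d \<Longrightarrow> norm ((f z - f a) / (z - a)) < norm D + 1"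
    unfolding eventually_at by blast
  have "norm (f z - f a) \<le> (norm D + 1) * norm (z - a)" if "z \<in> ball a (min d e)" for z
  proof (cases "z = a")
    case False
    then have "norm ((f z - f a) / (z - a)) < norm D + 1" using that d by (auto simp: dist_commute)
    then show ?thesis using False by (simp add: norm_divide field_simps)
  qed auto
  then show ?thesis using that[of "min d e" "norm D + 1"] assms d by auto
qed

lemma attracting_fixpoint_contraction:
  fixes D :: "complex \<Rightarrow> complex"
  assumes "D holomorphic_on ball a e" "e > 0" "D a = a" "norm (deriv D a) < 1"
  obtains e' q where "0 < e'" "e' \<le> e" "0 \<le> q" "q < 1" "\<And>z. z \<in> ball a e' \<Longrightarrow> norm (D z - a) \<le> q * norm (z - a)"
proof -
  have "D field_differentiable at a" using assms by (simp add: holomorphic_on_imp_differentiable_at)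
  then have D: "(D has_field_derivative deriv D a) (at a)"
    by (simp add: field_differentiable_derivI)
  then have "((\<lambda>z. norm ((D z - D a) / (z - a))) \<longlongrightarrow> norm (deriv D a)) (at a)"
    unfolding has_field_derivative_iff by (rule tendsto_norm)
  moreover obtain q where q: "norm (deriv D a) < q" "q < 1" using assms(4) dense by blast
  ultimately have "eventually (\<lambda>z. norm ((D z - D a) / (z - a)) < q) (at a)"
    using order_tendstoD(2) by blast
  then obtain d where d: "d > 0" "\<And>z. z \<noteq> a \<Longrightarrow> dist z a < d \<Longrightarrow> norm ((D z - D a) / (z - a)) < q"
    unfolding eventually_at by blast
  have q0: "0 \<le> q" using q by (meson less_eq_real_def norm_ge_zero order_trans)
  have "norm (D z - a) \<le> q * norm (z - a)" if "z \<in> ball a (min d e)" for z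
  proof (cases "z = a")
    case False
    then have "norm ((D z - D a) / (z - a)) < q" using that d by (auto simp: dist_commute)
    then show ?thesis using False assms by (simp add: norm_divide field_simps)
  qed (use assms in auto)
  then show ?thesis using that[of "min d e" q] assms d q q0 by auto
qed

text \<open>Unrolling the equation gives the solution
  \<open>A z = L z + L (D z) + L (D (D z)) + ...\<close>. The iterates of \<open>D\<close> approach
  1 like \<open>q ^ n\<close> and \<open>L\<close> vanishes there to first order, so the series
  converges geometrically, uniformly on the ball. The reality clause is needed later to keep track
  of the slit along the real axis.\<close>

lemma cohomological_equation:
  fixes D L :: "complex \<Rightarrow> complex"
  assumes D: "D holomorphic_on ball 1 e"
    and q: "0 \<le> q" "q < 1" "\<And>z. z \<in> ball 1 e \<Longrightarrow> norm (D z - 1) \<le> q * norm (z - 1)"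
    and L: "L holomorphic_on ball 1 e" "c \<ge> 0" "\<And>z. z \<in> ball 1 e \<Longrightarrow> norm (L z) \<le> c * norm (z - 1)"
  obtains A where "A holomorphic_on ball 1 e" "\<And>z. z \<in> ball 1 e \<Longrightarrow> A z = L z + A (D z)"
    "\<And>z. z \<in> ball 1 e \<Longrightarrow> norm (A z) \<le> c / (1 - q) * norm (z - 1)"
    "(\<forall>z \<in> ball 1 e. z \<in> \<real> \<longrightarrow> D z \<in> \<real> \<and> L z \<in> \<real>) \<longrightarrow> (\<forall>z \<in> ball 1 e. z \<in> \<real> \<longrightarrow> A z \<in> \<real>)"
proof -
  let ?B = "ball (1::complex) e"
  have inB: "D z \<in> ?B" if "z \<in> ?B" for z
  proof -
    have "norm (D z - 1) \<le> norm (z - 1)"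
      using q(3)[OF that] q by (smt (verit) mult_left_le_one_le norm_ge_zero)
    then show ?thesis using that by (auto simp: dist_norm norm_minus_commute)
  qed
  have itB: "(D ^^ n) z \<in> ?B" if "z \<in> ?B" for z n
    by (induction n) (use that inB in auto)
  have itn: "norm ((D ^^ n) z - 1) \<le> q ^ n * norm (z - 1)" if "z \<in> ?B" for z n
  proof (induction n)
    case (Suc n)
    have "norm ((D ^^ Suc n) z - 1) \<le> q * norm ((D ^^ n) z - 1)" using q(3)[OF itB[OF that]] by simp
    also have "\<dots> \<le> q * (q ^ n * norm (z - 1))" using Suc q by (simp add: mult_left_mono)
    finally show ?case by simp
  qed simp
  have ith: "(D ^^ n) holomorphic_on ?B" for n
  proof (induction n)
    case (Suc n)
    have "D \<circ> (D ^^ n) holomorphic_on ?B"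
      by (rule holomorphic_on_compose_gen[OF Suc D]) (use itB in auto)
    then show ?case by (simp add: o_def)
  qed (simp add: id_def)
  have Lb: "norm (L ((D ^^ n) z)) \<le> c * norm (z - 1) * q ^ n" if "z \<in> ?B" for z n
  proof -
    have "norm (L ((D ^^ n) z)) \<le> c * norm ((D ^^ n) z - 1)" using L(3) itB that by blast
    also have "\<dots> \<le> c * (q ^ n * norm (z - 1))" using itn that L(2) by (simp add: mult_left_mono)
    finally show ?thesis by (simp add: mult_ac)
  qed
  define A where "A = (\<lambda>z. \<Sum>n. L ((D ^^ n) z))"
  have geo: "summable (\<lambda>n. c * norm (z - 1) * q ^ n)" for z :: complex
    using q by (intro summable_mult summable_geometric) auto
  have sm: "summable (\<lambda>n. L ((D ^^ n) z))" if "z \<in> ?B" for z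
    by (rule summable_comparison_test'[OF geo[of z], of 0]) (use Lb that in auto)
  have ul: "uniform_limit ?B (\<lambda>n z. \<Sum>i<n. L ((D ^^ i) z)) A sequentially"
    unfolding A_def
  proof (rule Weierstrass_m_test)
    show "norm (L ((D ^^ n) z)) \<le> c * e * q ^ n" if "z \<in> ?B" for z n
    proof -
      have "c * norm (z - 1) * q ^ n \<le> c * e * q ^ n"
        using that L(2) q by (intro mult_right_mono mult_left_mono) (auto simp: dist_norm norm_minus_commute)
      then show ?thesis using Lb[OF that, of n] by linarith
    qed
    show "summable (\<lambda>n. c * e * q ^ n)" using q by (intro summable_mult summable_geometric) auto
  qed
  have hA: "A holomorphic_on ?B"
  proof (rule holomorphic_uniform_sequence[where f = "\<lambda>n z. \<Sum>i<n. L ((D ^^ i) z)"])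
    show "(\<lambda>z. \<Sum>i<n. L ((D ^^ i) z)) holomorphic_on ?B" for n
    proof (intro holomorphic_intros)
      fix i
      show "(\<lambda>z. L ((D ^^ i) z)) holomorphic_on ?B"
        using holomorphic_on_compose_gen[OF ith L(1), of i] itB by (simp add: o_def image_subset_iff)
    qed
    show "\<exists>d>0. cball x d \<subseteq> ?B \<and> uniform_limit (cball x d) (\<lambda>n z. \<Sum>i<n. L ((D ^^ i) z)) A sequentially"
      if "x \<in> ?B" for x
      using that open_contains_cball[of ?B] uniform_limit_on_subset[OF ul] by blast
  qed auto
  show ?thesis
  proof (rule that[of A])
    show "A z = L z + A (D z)" if "z \<in> ?B" for z
      using suminf_split_head[OF sm[OF that]] by (simp add: A_def funpow_swap1)
    show "norm (A z) \<le> c / (1 - q) * norm (z - 1)" if "z \<in> ?B" for z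
    proof -
      have "norm (A z) \<le> (\<Sum>n. c * norm (z - 1) * q ^ n)"
        unfolding A_def by (rule norm_suminf_le[OF Lb[OF that] geo])
      also have "\<dots> = c * norm (z - 1) * (1 / (1 - q))"
        using q by (subst suminf_mult) (auto simp: suminf_geometric summable_geometric)
      finally show ?thesis by simp
    qed
    show "(\<forall>z\<in>?B. z \<in> \<real> \<longrightarrow> D z \<in> \<real> \<and> L z \<in> \<real>) \<longrightarrow> (\<forall>z\<in>?B. z \<in> \<real> \<longrightarrow> A z \<in> \<real>)"
    proof (intro impI ballI)
      fix z assume real: "\<forall>z\<in>?B. z \<in> \<real> \<longrightarrow> D z \<in> \<real> \<and> L z \<in> \<real>" and z: "z \<in> ?B" "z \<in> \<real>"
      have *: "(D ^^ n) z \<in> \<real>" for n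
        using real itB[OF z(1)] by (induction n) (simp_all add: z(2))
      have "(\<lambda>n. \<Sum>i<n. L ((D ^^ i) z)) \<longlonglongrightarrow> A z"
        unfolding A_def using summable_LIMSEQ[OF sm[OF z(1)]] .
      moreover have "(\<Sum>i<n. L ((D ^^ i) z)) \<in> \<real>" for n
        using real itB[OF z(1)] * by (intro sum_in_Reals) blast
      ultimately show "A z \<in> \<real>"
        by (meson closed_complex_Reals closed_sequentially)
    qed
  qed (rule hA)
qed

text \<open>A small ball is mapped into the right half-plane, where the principal logarithm is
  holomorphic; a real value there is positive and has a real logarithm.\<close>

lemma holomorphic_log_at_1:
  fixes u :: "complex \<Rightarrow> complex"
  assumes "u holomorphic_on ball 1 e" "e > 0" "u 1 = 1"
  obtains e' c L where "0 < e'" "e' \<le> e" "c \<ge> 0" "L holomorphic_on ball 1 e'"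
    "\<And>z. z \<in> ball 1 e' \<Longrightarrow> exp (L z) = u z" "\<And>z. z \<in> ball 1 e' \<Longrightarrow> norm (L z) \<le> c * norm (z - 1)"
    "\<And>z. z \<in> ball 1 e' \<Longrightarrow> u z \<in> \<real> \<Longrightarrow> L z \<in> \<real>"
proof -
  obtain e1 c where e1: "0 < e1" "e1 \<le> e" "c \<ge> 0" "\<And>z. z \<in> ball 1 e1 \<Longrightarrow> norm (u z - u 1) \<le> c * norm (z - 1)"
    using holomorphic_lipschitz_at[OF assms(1,2)] by blast
  \<comment> \<open>At this radius the Lipschitz bound gives
    \<open>norm (u z - 1) \<le> c / (c + 1) < 1\<close>.\<close>
  define e2 where "e2 = min e1 (1 / (c + 1))"
  have e2: "0 < e2" "e2 \<le> e" using e1 by (auto simp: e2_def)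
  have u1: "norm (u z - 1) < 1" if "z \<in> ball 1 e2" for z
  proof -
    have "norm (u z - 1) \<le> c * norm (z - 1)" using e1(4)[of z] assms(3) that by (simp add: e2_def)
    also have "\<dots> \<le> c * (1 / (c + 1))" using that e1(3)
      by (intro mult_left_mono) (auto simp: e2_def dist_norm norm_minus_commute)
    also have "\<dots> < 1" using e1(3) by (simp add: field_simps)
    finally show ?thesis .
  qed
  have Re: "Re (u z) > 0" if "z \<in> ball 1 e2" for z
    using abs_Re_le_cmod[of "u z - 1"] u1[OF that] by auto
  have hL: "(\<lambda>z. Ln (u z)) holomorphic_on ball 1 e2"
  proof (intro holomorphic_on_Ln')
    show "u holomorphic_on ball 1 e2" by (rule holomorphic_on_subset[OF assms(1)]) (use e2 in auto)
    show "u z \<notin> \<real>\<^sub>\<le>\<^sub>0" if "z \<in> ball 1 e2" for z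
      using Re[OF that] by (auto simp: complex_nonpos_Reals_iff)
  qed
  obtain e3 c' where e3: "0 < e3" "e3 \<le> e2" "c' \<ge> 0" "\<And>z. z \<in> ball 1 e3 \<Longrightarrow> norm (Ln (u z) - Ln (u 1)) \<le> c' * norm (z - 1)"
    using holomorphic_lipschitz_at[OF hL e2(1)] by blast
  show ?thesis
  proof (rule that[of e3 c' "\<lambda>z. Ln (u z)"])
    show "exp (Ln (u z)) = u z" if "z \<in> ball 1 e3" for z
      using Re[of z] that e3 by (auto intro!: exp_Ln)
    show "Ln (u z) \<in> \<real>" if "z \<in> ball 1 e3" "u z \<in> \<real>" for z
      using Re[of z] that e3 by (auto elim!: Reals_cases simp: Ln_of_real)
    show "(\<lambda>z. Ln (u z)) holomorphic_on ball 1 e3"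
      by (rule holomorphic_on_subset[OF hL]) (use e3 in auto)
  qed (use e3 e2 assms(3) in auto)
qed

text \<open>\<open>(1 - z) * exp (A z)\<close> is the Koenigs linearisation of the inverse branch
  \<open>D\<close> at its attracting fixed point 1, and \<open>exp B\<close> trivialises the
  multiplier \<open>f \<circ> D\<close> up to its value at 1. Both come from taking the logarithm of
  a function with value 1 at 1 and solving a cohomological equation along the orbits of
  \<open>D\<close>.\<close>

lemma koenigs_coordinates:
  fixes d f :: "complex \<Rightarrow> complex" and \<tau> \<mu> :: real
  assumes d: "d holomorphic_on ball 1 e0" "e0 > 0" "d 1 = 1" "(d has_field_derivative of_real \<tau>) (at 1)" "\<tau> > 1"
    and dcnj: "\<And>z. z \<in> ball 1 e0 \<Longrightarrow> d (cnj z) = cnj (d z)"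
    and f: "f holomorphic_on ball 1 e0" "f 1 = of_real (\<tau> / \<mu>)" "\<mu> > 0"
  obtains e D A B c where "0 < e" "e \<le> e0" "e \<le> 1" "c \<ge> 0" "D holomorphic_on ball 1 e"
    "D 1 = 1" "\<And>z. z \<in> ball 1 e \<Longrightarrow> D z \<in> ball 1 e"
    "\<And>z. z \<in> ball 1 e \<Longrightarrow> d (D z) = z" "\<And>z. z \<in> ball 1 e \<Longrightarrow> z \<in> \<real> \<Longrightarrow> D z \<in> \<real>"
    "\<And>s. s > 0 \<Longrightarrow> s \<le> e \<Longrightarrow> D ` ball 1 s \<subseteq> ball 1 s"
    "A holomorphic_on ball 1 e" "B holomorphic_on ball 1 e"
    "\<And>z. z \<in> ball 1 e \<Longrightarrow> norm (A z) \<le> c * norm (z - 1)" "\<And>z. z \<in> ball 1 e \<Longrightarrow> norm (B z) \<le> c * norm (z - 1)"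
    "\<And>z. z \<in> ball 1 e \<Longrightarrow> 1 - D z = (1 - z) * exp (A z - A (D z)) / of_real \<tau>"
    "\<And>z. z \<in> ball 1 e \<Longrightarrow> f (D z) = of_real (\<tau> / \<mu>) * exp (B z - B (D z))"
    "\<And>z. z \<in> ball 1 e \<Longrightarrow> z \<in> \<real> \<Longrightarrow> A z \<in> \<real>"
proof -
  have dd: "deriv d 1 = of_real \<tau>" using d(4) by (rule DERIV_imp_deriv)
  have cen: "1 \<in> ball (1::complex) e0" and der: "deriv d 1 \<noteq> 0" using d dd by auto
  obtain r e1 D where r: "r > 0" "ball (1::complex) r \<subseteq> ball 1 e0" "inj_on d (ball 1 r)" "e1 > 0"
    "ball (d 1) e1 \<subseteq> d ` ball 1 r" "D holomorphic_on ball (d 1) e1"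
    "\<forall>w\<in>ball (d 1) e1. D w \<in> ball 1 r" "\<forall>w\<in>ball (d 1) e1. d (D w) = w"
    "\<forall>z\<in>ball 1 r. D (d z) = z" "deriv d 1 * deriv D (d 1) = 1"
  proof (rule holomorphic_local_inverse[OF d(1) open_ball cen der], goal_cases)
    case (1 r e g)
    show ?case by (rule 1(1)[OF 1(2-)])
  qed 
  note r = r(1-4,6-10)[unfolded d(3), rule_format]
  have D1: "D 1 = 1" using r(8)[of 1] r(1) d(3) by auto
  have dD: "deriv D 1 = 1 / of_real \<tau>" using r(9) dd d(5) by (simp add: field_simps)
  have "norm (deriv D 1) < 1" using d(5) by (simp add: dD norm_divide)
  then obtain e2 q where e2: "0 < e2" "e2 \<le> e1" "0 \<le> q" "q < 1"
      "\<And>z. z \<in> ball 1 e2 \<Longrightarrow> norm (D z - 1) \<le> q * norm (z - 1)"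
    using attracting_fixpoint_contraction[OF r(5) r(4) D1] by blast
  \<comment> \<open>For real \<open>z\<close>, both \<open>D z\<close> and its conjugate solve
    \<open>d w = z\<close> in a ball on which \<open>d\<close> is injective.\<close>
  have Dreal: "D z \<in> \<real>" if "z \<in> ball 1 e1" "z \<in> \<real>" for z
  proof -
    have *: "D z \<in> ball 1 r" using that r(6) by blast
    then have **: "cnj (D z) \<in> ball 1 r"
      using complex_mod_cnj[of "1 - D z"] by (simp add: dist_norm)
    have "d (cnj (D z)) = cnj z" using dcnj[OF subsetD[OF r(2) *]] r(7)[OF that(1)] by simp
    also have "\<dots> = d (D z)" using that r(7)[OF that(1)] by (simp add: Reals_cnj_iff)
    finally have "cnj (D z) = D z" using inj_onD[OF r(3)] * ** by blast
    then show ?thesis by (simp add: Reals_cnj_iff)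
  qed
  \<comment> \<open>The quotient \<open>\<tau> (1 - D z) / (1 - z)\<close> with its removable
    singularity filled in; it equals 1 at 1 because \<open>D\<close> has derivative
    \<open>1 / \<tau>\<close> there.\<close>
  define u where "u = (\<lambda>z. of_real \<tau> * (if z = 1 then deriv D 1 else (D z - D 1) / (z - 1)))"
  have "u holomorphic_on ball 1 e1" unfolding u_def
    using pole_lemma[OF r(5), of 1] r(4) by (intro holomorphic_intros) auto
  moreover have u1: "u 1 = 1" using dD d(5) by (simp add: u_def)
  ultimately have "u holomorphic_on ball 1 e1" "0 < e1" "u 1 = 1" using r(4) by auto
  then obtain e3 c3 L where e3: "0 < e3" "e3 \<le> e1" "c3 \<ge> 0" "L holomorphic_on ball 1 e3"
    "\<And>z. z \<in> ball 1 e3 \<Longrightarrow> exp (L z) = u z" "\<And>z. z \<in> ball 1 e3 \<Longrightarrow> norm (L z) \<le> c3 * norm (z - 1)"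
    "\<And>z. z \<in> ball 1 e3 \<Longrightarrow> u z \<in> \<real> \<Longrightarrow> L z \<in> \<real>"
  proof (rule holomorphic_log_at_1, goal_cases)
    case (1 e3 c3 L)
    show ?case by (rule 1(1)[OF 1(2-)])
  qed
  \<comment> \<open>Normalised by \<open>f 1 = \<tau> / \<mu>\<close> to have value 1 at 1.\<close>
  define v where "v = (\<lambda>z. of_real (\<mu> / \<tau>) * f (D z))"
  have "D ` ball 1 e1 \<subseteq> ball 1 e0" using r(6) r(2) by blast
  then have "(\<lambda>z. f (D z)) holomorphic_on ball 1 e1"
    using holomorphic_on_compose_gen[OF r(5) f(1)] by (simp add: o_def)
  then have "v holomorphic_on ball 1 e1" unfolding v_def by (intro holomorphic_intros)
  moreover have "v 1 = 1" using f d(5) by (simp add: v_def D1 field_simps)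
  ultimately have "v holomorphic_on ball 1 e1" "0 < e1" "v 1 = 1" using r(4) by auto
  then obtain e4 c4 M where e4: "0 < e4" "e4 \<le> e1" "c4 \<ge> 0" "M holomorphic_on ball 1 e4"
    "\<And>z. z \<in> ball 1 e4 \<Longrightarrow> exp (M z) = v z" "\<And>z. z \<in> ball 1 e4 \<Longrightarrow> norm (M z) \<le> c4 * norm (z - 1)"
  proof (rule holomorphic_log_at_1, goal_cases)
    case (1 e4 c4 M)
    show ?case by (rule 1(1)[OF 1(2-7)])
  qed
  define e where "e = min (min e2 (min e3 e4)) (min e0 1)"
  have e: "0 < e" "e \<le> e0" "e \<le> e1" "e \<le> e2" "e \<le> e3" "e \<le> e4" "e \<le> 1"
    using e2 e3 e4 d by (auto simp: e_def)
  have sub: "ball (1::complex) e \<subseteq> ball 1 e1" "ball (1::complex) e \<subseteq> ball 1 e3" "ball (1::complex) e \<subseteq> ball 1 e4"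
    using e by auto
  have De: "D holomorphic_on ball 1 e" using holomorphic_on_subset[OF r(5) sub(1)] .
  have Dq: "norm (D z - 1) \<le> q * norm (z - 1)" if "z \<in> ball 1 e" for z
    using e2(5)[of z] that e by auto
  have Dle: "norm (D z - 1) \<le> norm (z - 1)" if "z \<in> ball 1 e" for z
    using Dq[OF that] e2(3,4) by (smt (verit) mult_left_le_one_le norm_ge_zero)
  have Dball: "D ` ball 1 s \<subseteq> ball 1 s" if "s > 0" "s \<le> e" for s
  proof
    fix y assume "y \<in> D ` ball 1 s"
    then obtain z where z: "y = D z" "z \<in> ball 1 s" by auto
    then have "norm (D z - 1) \<le> norm (z - 1)" using Dle[of z] that by auto
    then show "y \<in> ball 1 s" using z by (auto simp: dist_norm norm_minus_commute)
  qed
  obtain A where A: "A holomorphic_on ball 1 e" "\<And>z. z \<in> ball 1 e \<Longrightarrow> A z = L z + A (D z)"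
    "\<And>z. z \<in> ball 1 e \<Longrightarrow> norm (A z) \<le> c3 / (1 - q) * norm (z - 1)"
    "(\<forall>z \<in> ball 1 e. z \<in> \<real> \<longrightarrow> D z \<in> \<real> \<and> L z \<in> \<real>) \<longrightarrow> (\<forall>z \<in> ball 1 e. z \<in> \<real> \<longrightarrow> A z \<in> \<real>)"
  proof (rule cohomological_equation[OF De e2(3,4) Dq holomorphic_on_subset[OF e3(4) sub(2)] e3(3) e3(6)[OF subsetD[OF sub(2)]]], goal_cases)
    case (3 A)
    show ?case by (rule 3(1)[OF 3(2-)])
  qed
  obtain B where B: "B holomorphic_on ball 1 e" "\<And>z. z \<in> ball 1 e \<Longrightarrow> B z = M z + B (D z)"
    "\<And>z. z \<in> ball 1 e \<Longrightarrow> norm (B z) \<le> c4 / (1 - q) * norm (z - 1)"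
  proof (rule cohomological_equation[OF De e2(3,4) Dq holomorphic_on_subset[OF e4(4) sub(3)] e4(3) e4(6)[OF subsetD[OF sub(3)]]], goal_cases)
    case (3 B)
    show ?case by (rule 3(1)[OF 3(2-4)])
  qed
  define c where "c = max (c3 / (1 - q)) (c4 / (1 - q))"
  show ?thesis
  proof (rule that[of e c D A B])
    show "c \<ge> 0" using e3(3) e2(4) by (auto simp: c_def le_max_iff_disj)
    show "D z \<in> ball 1 e" if "z \<in> ball 1 e" for z using Dball[OF e(1) order_refl] that by blast
    show "d (D z) = z" if "z \<in> ball 1 e" for z using r(7) sub that by auto
    show *: "D z \<in> \<real>" if "z \<in> ball 1 e" "z \<in> \<real>" for z using Dreal sub that by auto
    show "norm (A z) \<le> c * norm (z - 1)" if "z \<in> ball 1 e" for z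
      by (rule order_trans[OF A(3)[OF that]], rule mult_right_mono) (auto simp: c_def)
    show "norm (B z) \<le> c * norm (z - 1)" if "z \<in> ball 1 e" for z
      by (rule order_trans[OF B(3)[OF that]], rule mult_right_mono) (auto simp: c_def)
    show "1 - D z = (1 - z) * exp (A z - A (D z)) / of_real \<tau>" if "z \<in> ball 1 e" for z
    proof -
      have "exp (A z - A (D z)) = u z" using A(2)[OF that] e3(5) sub that by auto
      moreover have "(1 - z) * u z = of_real \<tau> * (1 - D z)" by (auto simp: u_def D1 field_simps)
      ultimately show ?thesis using d(5) by simp
    qed
    show "f (D z) = of_real (\<tau> / \<mu>) * exp (B z - B (D z))" if "z \<in> ball 1 e" for z
    proof -
      have "exp (B z - B (D z)) = v z" using B(2)[OF that] e4(5) sub that by auto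
      then show ?thesis using d(5) f(3) by (simp add: v_def)
    qed
    show "A z \<in> \<real>" if "z \<in> ball 1 e" "z \<in> \<real>" for z
    proof -
      have "L w \<in> \<real>" if "w \<in> ball 1 e" "w \<in> \<real>" for w
      proof (rule e3(7))
        show "w \<in> ball 1 e3" using that sub by auto
        show "u w \<in> \<real>" using *[OF that] that dD by (auto simp: u_def D1)
      qed
      then show ?thesis using A(4) * that by blast
    qed
  qed (use e De D1 Dball A(1) B(1) in auto)
qed

section \<open>Slit domains and periodic functions on a strip\<close>

lemma green_domain_iff: "z \<in> green_domain \<longleftrightarrow> z \<notin> \<real> \<or> \<bar>Re z\<bar> < 1"
  by (auto simp: green_domain_def image_iff abs_less_iff elim!: Reals_cases)

lemma open_green_domain: "open green_domain"
proof -
  have *: "green_domain = (- \<real>) \<union> {z. \<bar>Re z\<bar> < 1}"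
    using green_domain_iff by auto
  have "open {z. \<bar>Re z\<bar> < 1}"
    by (intro open_Collect_less continuous_intros)
  then show ?thesis unfolding * by (intro open_Un open_Compl closed_complex_Reals)
qed

text \<open>The set is starlike about the real point \<open>1 - e / 2\<close>: a segment from it to
  a nonreal point leaves the real axis at once, and one to a real point below 1 stays below
  1.\<close>

lemma slit_disc_connected:
  assumes "0 < e"
  shows "connected {z \<in> ball 1 e. z \<notin> \<real> \<or> Re z < 1}"
proof (rule starlike_imp_connected, unfold starlike_def, rule bexI, rule ballI, rule subsetI)
  let ?a = "complex_of_real (1 - e / 2)"
  have aB: "?a \<in> ball 1 e" using assms by (simp add: dist_norm norm_mult)
  then show "?a \<in> {z \<in> ball 1 e. z \<notin> \<real> \<or> Re z < 1}" using assms by simp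
  fix z y assume z: "z \<in> {z \<in> ball 1 e. z \<notin> \<real> \<or> Re z < 1}" and y: "y \<in> closed_segment ?a z"
  then obtain t where t: "0 \<le> t" "t \<le> 1" "y = (1 - t) *\<^sub>R ?a + t *\<^sub>R z"
    by (auto simp: closed_segment_def)
  have "y \<in> ball 1 e" using y z aB closed_segment_subset[OF aB _ convex_ball, of z] by blast
  moreover have "y \<notin> \<real> \<or> Re y < 1"
  proof (cases "y \<in> \<real> \<and> t > 0")
    case True
    then have "t * Im z = 0" "t \<noteq> 0" using t(3) by (auto simp: complex_is_Real_iff)
    then have "z \<in> \<real>" by (simp add: complex_is_Real_iff)
    then have "Re z < 1" using z by auto
    then have "(1 - t) * (1 - e / 2) + t * Re z < (1 - t) * 1 + t * 1"
      using assms t True by (intro add_le_less_mono mult_left_mono mult_strict_left_mono) auto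
    then show ?thesis using t by simp
  next
    case False
    then show ?thesis using t assms by (cases "t = 0") auto
  qed
  ultimately show "y \<in> {z \<in> ball 1 e. z \<notin> \<real> \<or> Re z < 1}" by simp
qed

lemma periodic_int:
  fixes \<omega> :: "complex \<Rightarrow> complex"
  assumes "\<And>s. s \<in> strip b \<Longrightarrow> \<omega> (s + 1) = \<omega> s" "s \<in> strip b"
  shows "\<omega> (s + of_int n) = \<omega> s"
proof (induction n rule: int_induct[where k = 0])
  case (step1 i)
  have "s + of_int i \<in> strip b" using assms(2) by (simp add: strip_def)
  then show ?case using assms(1)[of "s + of_int i"] step1 by (simp add: add_ac)
next
  case (step2 i)
  have "s + of_int (i - 1) \<in> strip b" using assms(2) by (simp add: strip_def)
  then show ?case using assms(1)[of "s + of_int (i - 1)"] step2 by (simp add: algebra_simps)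
qed simp

lemma open_strip: "open (strip b)"
  unfolding strip_def by (intro open_Collect_less continuous_intros)

text \<open>Periodicity reduces both bounds to one compact rectangle inside the strip, where
  \<open>\<omega>\<close> and its derivative are bounded.\<close>

lemma periodic_strip_bounds:
  fixes \<omega> :: "complex \<Rightarrow> complex"
  assumes hol: "\<omega> holomorphic_on strip b" and per: "\<And>s. s \<in> strip b \<Longrightarrow> \<omega> (s + 1) = \<omega> s"
    and h: "h < pi / ln b"
  obtains M where "M \<ge> 0" "\<And>s. \<bar>Im s\<bar> \<le> h \<Longrightarrow> norm (\<omega> s) \<le> M"
    "\<And>s s'. \<bar>Im s\<bar> \<le> h \<Longrightarrow> \<bar>Im s'\<bar> \<le> h \<Longrightarrow> norm (s' - s) \<le> 1 \<Longrightarrow> norm (\<omega> s' - \<omega> s) \<le> M * norm (s' - s)"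
proof -
  \<comment> \<open>One unit longer than a period on either side: the integer translation that
    brings \<open>s\<close> into a period also brings a point \<open>s'\<close> at distance at most
    1 into \<open>Q\<close>.\<close>
  define Q where "Q = cbox (Complex (-1) (-h)) (Complex 2 h)"
  have Qs: "Q \<subseteq> strip b" using h by (auto simp: Q_def strip_def in_cbox_complex_iff)
  have "compact (\<omega> ` Q)" "compact (deriv \<omega> ` Q)"
    using holomorphic_on_imp_continuous_on[OF hol] holomorphic_on_imp_continuous_on[OF holomorphic_deriv[OF hol open_strip]]
      Qs by (auto intro!: compact_continuous_image intro: continuous_on_subset simp: Q_def)
  then have "bounded (\<omega> ` Q \<union> deriv \<omega> ` Q)" by (simp add: compact_imp_bounded)
  then obtain M where M: "\<And>x. x \<in> \<omega> ` Q \<union> deriv \<omega> ` Q \<Longrightarrow> norm x \<le> M"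
    unfolding bounded_iff by blast
  define N where "N = max M 0"
  have N: "norm (\<omega> s) \<le> N" "norm (deriv \<omega> s) \<le> N" if "s \<in> Q" for s
    using M[of "\<omega> s"] M[of "deriv \<omega> s"] that by (auto simp: N_def)
  have shift: "\<omega> (s - of_int n) = \<omega> s" if "\<bar>Im s\<bar> \<le> h" for s n
    using periodic_int[of b \<omega> s "-n"] per that h by (auto simp: strip_def)
  show ?thesis
  proof (rule that[of N])
    show "N \<ge> 0" by (simp add: N_def)
    show "norm (\<omega> s) \<le> N" if "\<bar>Im s\<bar> \<le> h" for s
    proof -
      have "s - of_int \<lfloor>Re s\<rfloor> \<in> Q"
        using that floor_correct[of "Re s"] unfolding Q_def in_cbox_complex_iff by (simp; linarith)
      then show ?thesis using N(1) shift[OF that] by metis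
    qed
    show "norm (\<omega> s' - \<omega> s) \<le> N * norm (s' - s)" if "\<bar>Im s\<bar> \<le> h" "\<bar>Im s'\<bar> \<le> h" "norm (s' - s) \<le> 1" for s s'
    proof -
      define n where "n = \<lfloor>Re s\<rfloor>"
      have re: "\<bar>Re s' - Re s\<bar> \<le> 1" using abs_Re_le_cmod[of "s' - s"] that(3) by simp
      have inQ: "s - of_int n \<in> Q" "s' - of_int n \<in> Q"
        using that floor_correct[of "Re s"] re unfolding Q_def n_def in_cbox_complex_iff by (simp; linarith)+
      have "norm (\<omega> (s' - of_int n) - \<omega> (s - of_int n)) \<le> N * norm ((s' - of_int n) - (s - of_int n))"
      proof (rule field_differentiable_bound[of Q \<omega> "deriv \<omega>"])
        show "convex Q" by (simp add: Q_def)
        show "(\<omega> has_field_derivative deriv \<omega> z) (at z within Q)" if "z \<in> Q" for z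
          using holomorphic_derivI[OF hol open_strip] Qs that has_field_derivative_at_within by blast
      qed (use N inQ in auto)
      then show ?thesis using shift that by simp
    qed
  qed
qed

section \<open>From the renewal equation to the singular expansion\<close>

text \<open>All that the analytic argument uses of the graph: \<open>d\<close> and \<open>f\<close>
  are holomorphic near the repelling fixed point 1, and \<open>G\<close> satisfies the renewal
  equation, but only inside the unit disc.\<close>

locale singular_renewal =
  fixes G d f :: "complex \<Rightarrow> complex" and \<tau> \<mu> e0 :: real
  assumes G_hol: "G holomorphic_on green_domain"
    and d_hol: "d holomorphic_on ball 1 e0" and e0_pos: "e0 > 0" and d_1: "d 1 = 1"
    and d_deriv: "(d has_field_derivative of_real \<tau>) (at 1)" and \<tau>_gt: "\<tau> > 1"
    and d_cnj: "\<And>z. z \<in> ball 1 e0 \<Longrightarrow> d (cnj z) = cnj (d z)"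
    and f_hol: "f holomorphic_on ball 1 e0" and f_1: "f 1 = of_real (\<tau> / \<mu>)" and \<mu>_pos: "\<mu> > 0"
    and renewal: "\<And>z. z \<in> ball 1 e0 \<Longrightarrow> norm z < 1 \<Longrightarrow> norm (d z) < 1 \<and> G z = f z * G (d z)"
begin

text \<open>The exponent \<open>d_s / 2 - 1\<close> once \<open>\<tau>\<close> and
  \<open>\<mu>\<close> are the scaling factors. It is determined by
  \<open>\<tau> powr \<alpha> = \<mu> / \<tau>\<close>, the reciprocal of
  \<open>f 1\<close>.\<close>

definition \<alpha> :: real where "\<alpha> = ln \<mu> / ln \<tau> - 1"

lemma ln_\<tau>: "ln \<tau> > 0"
  using \<tau>_gt by simp

lemma \<tau>_powr_\<alpha>: "exp (of_real (\<alpha> * ln \<tau>)) = complex_of_real (\<mu> / \<tau>)"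
proof -
  have "\<alpha> * ln \<tau> = ln \<mu> - ln \<tau>" using less_imp_neq[OF ln_\<tau>] by (simp add: \<alpha>_def field_simps)
  then have "exp (\<alpha> * ln \<tau>) = \<mu> / \<tau>" using \<mu>_pos \<tau>_gt by (simp add: exp_diff)
  then have "complex_of_real (exp (\<alpha> * ln \<tau>)) = of_real (\<mu> / \<tau>)" by simp
  then show ?thesis by (simp only: exp_of_real)
qed

text \<open>Where \<open>D z\<close> lies in the unit disc this is the renewal equation at
  \<open>D z\<close>, since \<open>d (D z) = z\<close>. Both sides are holomorphic on the slit ball,
  which is connected, so the identity spreads over all of it. The left side makes sense there
  because \<open>D\<close> maps the slit ball into itself.\<close>

lemma renewal_inverse_branch:
  assumes "0 < e" "e \<le> e0" "e \<le> 1" "D holomorphic_on ball 1 e"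
    "\<And>z. z \<in> ball 1 e \<Longrightarrow> D z \<in> ball 1 e" "\<And>z. z \<in> ball 1 e \<Longrightarrow> d (D z) = z"
    "\<And>z. z \<in> ball 1 e \<Longrightarrow> z \<in> \<real> \<Longrightarrow> D z \<in> \<real>"
    "\<And>z. z \<in> ball 1 e \<Longrightarrow> 1 - D z = (1 - z) * exp (A z - A (D z)) / of_real \<tau>"
    "\<And>z. z \<in> ball 1 e \<Longrightarrow> z \<in> \<real> \<Longrightarrow> A z \<in> \<real>"
  assumes z: "z \<in> ball 1 e" "z \<notin> \<real> \<or> Re z < 1"
  shows "G (D z) = f (D z) * G z"
proof -
  let ?S = "{z \<in> ball 1 e. z \<notin> \<real> \<or> Re z < 1}"
  \<comment> \<open>On the real axis \<open>A\<close> is real, so \<open>1 - D w\<close> is a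
    positive multiple of \<open>1 - w\<close>.\<close>
  have side: "(Re (D w) < 1 \<longleftrightarrow> Re w < 1)" if w: "w \<in> ball 1 e" "w \<in> \<real>" for w
  proof -
    have "A w \<in> \<real>" "A (D w) \<in> \<real>"
      using assms(9)[OF w] assms(9)[OF assms(5)[OF w(1)] assms(7)[OF w]] by auto
    then obtain a b where ab: "A w = complex_of_real a" "A (D w) = complex_of_real b"
      unfolding Reals_def by blast
    obtain x where x: "w = complex_of_real x" using w(2) by (auto elim: Reals_cases)
    have "exp (A w - A (D w)) = of_real (exp (a - b))"
      by (simp add: ab flip: exp_of_real)
    then have "1 - D w = of_real ((1 - x) * exp (a - b) / \<tau>)"
      using assms(8)[OF w(1)] x by simp
    from arg_cong[OF this, of Re] have "1 - Re (D w) = (1 - x) * exp (a - b) / \<tau>"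
      by (simp only: minus_complex.sel one_complex.sel Re_complex_of_real)
    moreover have "(1 - x) * exp (a - b) / \<tau> > 0 \<longleftrightarrow> 1 - x > 0"
      using \<tau>_gt by (simp add: zero_less_mult_iff zero_less_divide_iff)
    ultimately have "1 - Re (D w) > 0 \<longleftrightarrow> 1 - x > 0" by (simp only:)
    then show ?thesis using x by simp
  qed
  have DS: "D w \<in> ?S" if "w \<in> ?S" for w
  proof -
    \<comment> \<open>A real \<open>D w\<close> forces \<open>w = d (D w)\<close> to be real, so
      \<open>D\<close> cannot push a nonreal point onto the slit.\<close>
    have "Re (D w) < 1" if "D w \<in> \<real>"
    proof -
      have "D w \<in> ball 1 e0" using subset_ball[OF assms(2)] assms(5)[of w] \<open>w \<in> ?S\<close> by blast
      then have "d (cnj (D w)) = cnj (d (D w))" by (rule d_cnj)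
      then have "w \<in> \<real>" using assms(6)[of w] \<open>w \<in> ?S\<close> that by (simp add: Reals_cnj_iff)
      then show ?thesis using side \<open>w \<in> ?S\<close> by auto
    qed
    then show ?thesis using assms(5) that by auto
  qed
  have Sg: "?S \<subseteq> green_domain"
  proof
    fix w assume w: "w \<in> ?S"
    then have "\<bar>Re (1 - w)\<bar> < 1" using abs_Re_le_cmod[of "1 - w"] assms(3) by (simp add: dist_norm)
    then show "w \<in> green_domain" using w by (auto simp: green_domain_iff)
  qed
  have Dh: "D holomorphic_on ?S" by (rule holomorphic_on_subset[OF assms(4)]) auto
  have "D ` ?S \<subseteq> green_domain" using DS Sg by blast
  then have h1: "(\<lambda>w. G (D w)) holomorphic_on ?S"
    using holomorphic_on_compose_gen[OF Dh G_hol] by (simp add: o_def)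
  have "ball (1::complex) e \<subseteq> ball 1 e0" using assms(2) by (rule subset_ball)
  then have "D ` ?S \<subseteq> ball 1 e0" using assms(5) by blast
  then have h2: "(\<lambda>w. f (D w)) holomorphic_on ?S"
    using holomorphic_on_compose_gen[OF Dh f_hol] by (simp add: o_def)
  have opS: "open ?S"
  proof -
    have "?S = ball 1 e \<inter> ((- \<real>) \<union> {z. Re z < 1})" by auto
    moreover have "open {z. Re z < 1}" by (simp add: open_halfspace_Re_lt)
    ultimately show ?thesis using closed_complex_Reals by (simp add: open_Compl open_Un open_Int)
  qed
  define T where "T = {w \<in> ?S. norm (D w) < 1}"
  have opT: "open T"
  proof -
    have "T = ?S \<inter> D -` (ball 0 1)" by (auto simp: T_def)
    then show ?thesis
      using continuous_open_preimage[OF holomorphic_on_imp_continuous_on[OF Dh] opS open_ball] by (simp only:)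
  qed
  \<comment> \<open>A real point below 1: its image under \<open>D\<close> lies between
    \<open>1 - e\<close> and 1, hence in the unit disc.\<close>
  let ?a = "complex_of_real (1 - e / 2)"
  have a: "?a \<in> ?S" using assms(1) by (simp add: dist_norm norm_mult)
  have "norm (D ?a) < 1"
  proof -
    have "?a \<in> ball 1 e" using a by blast
    then have "D ?a \<in> \<real>" using assms(7) Reals_of_real by blast
    then obtain x where x: "D ?a = complex_of_real x" unfolding Reals_def by blast
    have "x < 1" using side[of ?a] a x assms(1) by auto
    moreover have "\<bar>1 - x\<bar> < e" using assms(5)[of ?a] a x
      by (simp add: dist_norm flip: of_real_diff) (metis norm_of_real of_real_1 of_real_diff)
    ultimately show ?thesis using x assms(3) by simp
  qed
  then have "?a \<in> T" unfolding T_def using a by blast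
  then have Tne: "T \<noteq> {}" by blast
  show ?thesis
  proof (rule analytic_continuation_open[OF opT opS Tne slit_disc_connected[OF assms(1)] _ h1])
    show "T \<subseteq> ?S" by (auto simp: T_def)
    show "(\<lambda>w. f (D w) * G w) holomorphic_on ?S"
      using h2 holomorphic_on_subset[OF G_hol Sg] by (rule holomorphic_on_mult)
    show "G (D w) = f (D w) * G w" if "w \<in> T" for w
    proof -
      have w: "w \<in> ball 1 e" "norm (D w) < 1" using that by (auto simp: T_def)
      have "D w \<in> ball 1 e0" using subset_ball[OF assms(2)] assms(5)[OF w(1)] by blast
      then show ?thesis using renewal[of "D w"] w(2) assms(6)[OF w(1)] by simp
    qed
    show "z \<in> ?S" using z by simp
  qed
qed

text \<open>In the coordinate \<open>t = (1 - z) * exp (A z)\<close> the branch \<open>D\<close>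
  acts as division by \<open>\<tau>\<close> and multiplies \<open>G\<close> by
  \<open>f \<circ> D\<close>. The factors \<open>exp B\<close> and \<open>t powr - \<alpha>\<close>
  cancel this multiplier and leave the invariant function \<open>\<kappa>\<close>.\<close>

lemma invariant_function:
  obtains \<kappa> \<rho> A B :: "complex \<Rightarrow> complex" and r e c :: real
  where "0 < r" "r \<le> 1" "0 < e" "c \<ge> 0" "\<kappa> holomorphic_on ball 0 e - \<real>\<^sub>\<le>\<^sub>0"
    "\<forall>t \<in> ball 0 e - \<real>\<^sub>\<le>\<^sub>0. \<kappa> (t / of_real \<tau>) = \<kappa> t"
    "\<forall>z \<in> ball 1 r. norm (A z) \<le> c * norm (z - 1)" "\<forall>z \<in> ball 1 r. norm (B z) \<le> c * norm (z - 1)"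
    "\<forall>z \<in> ball 1 r. (1 - z) * exp (A z) \<in> ball 0 e"
    "\<forall>z \<in> ball 1 r. (1 - z) * exp (A z) \<notin> \<real>\<^sub>\<le>\<^sub>0 \<longrightarrow>
       G z = exp (- B z) * ((1 - z) * exp (A z)) powr of_real \<alpha> * \<kappa> ((1 - z) * exp (A z))"
proof -
  obtain e D A B c where K: "0 < e" "e \<le> e0" "e \<le> 1" "c \<ge> 0" "D holomorphic_on ball 1 e"
    "D 1 = 1" "\<And>z. z \<in> ball 1 e \<Longrightarrow> D z \<in> ball 1 e"
    "\<And>z. z \<in> ball 1 e \<Longrightarrow> d (D z) = z" "\<And>z. z \<in> ball 1 e \<Longrightarrow> z \<in> \<real> \<Longrightarrow> D z \<in> \<real>"
    "\<And>s. s > 0 \<Longrightarrow> s \<le> e \<Longrightarrow> D ` ball 1 s \<subseteq> ball 1 s"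
    "A holomorphic_on ball 1 e" "B holomorphic_on ball 1 e"
    "\<And>z. z \<in> ball 1 e \<Longrightarrow> norm (A z) \<le> c * norm (z - 1)" "\<And>z. z \<in> ball 1 e \<Longrightarrow> norm (B z) \<le> c * norm (z - 1)"
    "\<And>z. z \<in> ball 1 e \<Longrightarrow> 1 - D z = (1 - z) * exp (A z - A (D z)) / of_real \<tau>"
    "\<And>z. z \<in> ball 1 e \<Longrightarrow> f (D z) = of_real (\<tau> / \<mu>) * exp (B z - B (D z))"
    "\<And>z. z \<in> ball 1 e \<Longrightarrow> z \<in> \<real> \<Longrightarrow> A z \<in> \<real>"
  proof (rule koenigs_coordinates[OF d_hol e0_pos d_1 d_deriv \<tau>_gt d_cnj f_hol f_1 \<mu>_pos], goal_cases)
    case (2 e D A B c)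
    show ?case by (rule 2(1)[OF 2(2-)])
  qed
  define \<rho> where "\<rho> = (\<lambda>z. (1 - z) * exp (A z))"
  have \<rho>_hol: "\<rho> holomorphic_on ball 1 e"
    unfolding \<rho>_def using K(11) by (intro holomorphic_intros)
  have in1: "(1::complex) \<in> ball 1 e" using K(1) by simp
  have A1: "A 1 = 0" using K(13)[OF in1] by simp
  obtain A' where "(A has_field_derivative A') (at 1)"
    using holomorphic_derivI[OF K(11) open_ball in1] by blast
  then have "(\<rho> has_field_derivative -1) (at 1)"
    unfolding \<rho>_def by (auto intro!: derivative_eq_intros simp: A1)
  then have \<rho>': "deriv \<rho> 1 \<noteq> 0" using DERIV_imp_deriv by fastforce
  have \<rho>1: "\<rho> 1 = 0" by (simp add: \<rho>_def)
  obtain r4 e4 \<Phi> where L: "r4 > 0" "ball (1::complex) r4 \<subseteq> ball 1 e" "inj_on \<rho> (ball 1 r4)" "e4 > 0"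
    "ball (\<rho> 1) e4 \<subseteq> \<rho> ` ball 1 r4" "\<Phi> holomorphic_on ball (\<rho> 1) e4"
    "\<forall>w\<in>ball (\<rho> 1) e4. \<Phi> w \<in> ball 1 r4" "\<forall>w\<in>ball (\<rho> 1) e4. \<rho> (\<Phi> w) = w"
    "\<forall>z\<in>ball 1 r4. \<Phi> (\<rho> z) = z" "deriv \<rho> 1 * deriv \<Phi> (\<rho> 1) = 1"
  proof (rule holomorphic_local_inverse[OF \<rho>_hol open_ball in1 \<rho>'], goal_cases)
    case (1 r e g)
    show ?case by (rule 1(1)[OF 1(2-)])
  qed
  note L = L[unfolded \<rho>1]
  have r4e: "r4 \<le> e" using L(1,2) by (simp add: ball_subset_ball_iff)
  have \<rho>D: "\<rho> (D z) = \<rho> z / of_real \<tau>" if "z \<in> ball 1 e" for z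
    unfolding \<rho>_def K(15)[OF that] by (simp add: exp_diff)
  define S where "S = {z \<in> ball 1 e. z \<notin> \<real> \<or> Re z < 1}"
  \<comment> \<open>\<open>\<Phi>\<close> maps the disc slit along the nonpositive axis into the
    slit ball at 1: where \<open>\<Phi> t = x\<close> is real, so is \<open>A\<close> at this point,
    and \<open>t\<close> has the sign of \<open>1 - x\<close>.\<close>
  have \<Phi>S: "\<Phi> t \<in> S" if t: "t \<in> ball 0 e4 - \<real>\<^sub>\<le>\<^sub>0" for t
  proof -
    have b: "\<Phi> t \<in> ball 1 e" using L(2,7) t by blast
    have "Re (\<Phi> t) < 1" if r: "\<Phi> t \<in> \<real>"
    proof -
      obtain x where x: "\<Phi> t = complex_of_real x" using r unfolding Reals_def by blast
      obtain a where a: "A (\<Phi> t) = complex_of_real a" using K(17)[OF b r] unfolding Reals_def by blast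
      have "t = \<rho> (\<Phi> t)" using L(8) t by auto
      also have "\<dots> = of_real ((1 - x) * exp a)"
        unfolding \<rho>_def a by (simp add: x exp_of_real)
      finally have tt: "t = of_real ((1 - x) * exp a)" .
      have "\<not> (1 - x) * exp a \<le> 0"
      proof -
        have "t \<notin> \<real>\<^sub>\<le>\<^sub>0" using t by blast
        then show ?thesis unfolding tt by (simp only: nonpos_Reals_of_real_iff not_False_eq_True)
      qed
      then have "x < 1" by (simp add: mult_le_0_iff)
      then show ?thesis using x by simp
    qed
    then show ?thesis using b by (auto simp: S_def)
  qed
  have Sg: "S \<subseteq> green_domain"
  proof
    fix w assume w: "w \<in> S"
    then have "\<bar>Re (1 - w)\<bar> < 1" using abs_Re_le_cmod[of "1 - w"] K(3) by (simp add: dist_norm S_def)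
    then show "w \<in> green_domain" using w by (auto simp: green_domain_iff S_def)
  qed
  define \<kappa> where "\<kappa> = (\<lambda>t. exp (B (\<Phi> t)) * t powr of_real (- \<alpha>) * G (\<Phi> t))"
  let ?N = "ball 0 e4 - \<real>\<^sub>\<le>\<^sub>0 :: complex set"
  have \<Phi>N: "\<Phi> holomorphic_on ?N" using L(6) by (rule holomorphic_on_subset) auto
  have "\<Phi> ` ?N \<subseteq> green_domain" using \<Phi>S Sg by blast
  then have h1: "(\<lambda>t. G (\<Phi> t)) holomorphic_on ?N"
    using holomorphic_on_compose_gen[OF \<Phi>N G_hol] by (simp add: o_def)
  have "\<Phi> ` ?N \<subseteq> ball 1 e" using \<Phi>S by (auto simp: S_def)
  then have h2: "(\<lambda>t. B (\<Phi> t)) holomorphic_on ?N"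
    using holomorphic_on_compose_gen[OF \<Phi>N K(12)] by (simp add: o_def)
  have h\<kappa>: "\<kappa> holomorphic_on ?N"
    unfolding \<kappa>_def by (intro holomorphic_intros h1 h2) auto
  \<comment> \<open>Passing from \<open>t\<close> to \<open>t / \<tau>\<close> multiplies
    \<open>t powr - \<alpha>\<close> by \<open>\<mu> / \<tau>\<close> and \<open>G\<close> by
    \<open>(\<tau> / \<mu>) * exp (B z - B (D z))\<close>, and replaces \<open>exp (B z)\<close> by
    \<open>exp (B (D z))\<close>: the product does not change.\<close>
  have inv: "\<kappa> (t / of_real \<tau>) = \<kappa> t" if t: "t \<in> ?N" for t
  proof -
    define z where "z = \<Phi> t"
    have tb: "t \<in> ball 0 e4" using t by blast
    have z: "z \<in> ball 1 r4" "z \<in> ball 1 e" using L(2,7) tb by (auto simp only: z_def)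
    have Dz: "D z \<in> ball 1 r4" using K(10)[OF L(1) r4e] z(1) by blast
    have "\<rho> z = t" using L(8) tb by (auto simp: z_def)
    then have "\<Phi> (t / of_real \<tau>) = \<Phi> (\<rho> (D z))" using \<rho>D[OF z(2)] by simp
    also have "\<dots> = D z" using L(9) Dz by blast
    finally have 1: "\<Phi> (t / of_real \<tau>) = D z" .
    have zS: "z \<notin> \<real> \<or> Re z < 1" using \<Phi>S[OF t] by (simp add: S_def z_def)
    have 2: "G (D z) = of_real (\<tau> / \<mu>) * exp (B z - B (D z)) * G z"
      using renewal_inverse_branch[OF K(1,2,3,5,7,8,9,15,17) z(2) zS] K(16)[OF z(2)] by simp
    have t0: "t \<noteq> 0" using t by auto
    have "Ln (of_real (1 / \<tau>) * t) = of_real (ln (1 / \<tau>)) + Ln t"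
      using t0 \<tau>_gt by (subst Ln_times_of_real) (simp_all add: Ln_of_real del: of_real_divide)
    also have "ln (1 / \<tau>) = - ln \<tau>" using \<tau>_gt by (simp add: ln_div)
    finally have "Ln (t / of_real \<tau>) = Ln t - of_real (ln \<tau>)" by simp
    then have "(t / of_real \<tau>) powr of_real (- \<alpha>) = exp (of_real (- \<alpha>) * (Ln t - of_real (ln \<tau>)))"
      using t0 \<tau>_gt by (simp add: powr_def)
    also have "of_real (- \<alpha>) * (Ln t - of_real (ln \<tau>)) = of_real (- \<alpha>) * Ln t + of_real (\<alpha> * ln \<tau>)"
      by (simp add: algebra_simps)
    also have "exp (of_real (- \<alpha>) * Ln t + of_real (\<alpha> * ln \<tau>)) = t powr of_real (- \<alpha>) * of_real (\<mu> / \<tau>)"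
      unfolding exp_add \<tau>_powr_\<alpha> using t0 by (simp add: powr_def)
    finally have 3: "(t / of_real \<tau>) powr of_real (- \<alpha>) = t powr of_real (- \<alpha>) * of_real (\<mu> / \<tau>)" .
    have "\<kappa> (t / of_real \<tau>) = exp (B (D z)) * (t powr of_real (- \<alpha>) * of_real (\<mu> / \<tau>))
        * (of_real (\<tau> / \<mu>) * exp (B z - B (D z)) * G z)"
      unfolding \<kappa>_def 1 2 3 ..
    also have "\<dots> = (exp (B (D z)) * exp (B z - B (D z))) * t powr of_real (- \<alpha>) * G z * (of_real (\<mu> / \<tau>) * of_real (\<tau> / \<mu>))"
      by (simp only: mult_ac)
    also have "\<dots> = exp (B z) * t powr of_real (- \<alpha>) * G z"
    proof -
      have "exp (B (D z)) * exp (B z - B (D z)) = exp (B z)" by (simp flip: exp_add)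
      moreover have "complex_of_real (\<mu> / \<tau>) * of_real (\<tau> / \<mu>) = 1" using \<tau>_gt \<mu>_pos by simp
      ultimately show ?thesis by (simp only: mult_1_right)
    qed
    finally show ?thesis by (simp add: \<kappa>_def z_def)
  qed
  have "continuous (at 1) \<rho>"
    using holomorphic_on_imp_continuous_on[OF \<rho>_hol] in1 continuous_on_interior
    by (metis continuous_on_eq_continuous_at open_ball)
  then obtain r5 where r5: "r5 > 0" "\<And>z. dist z 1 < r5 \<Longrightarrow> dist (\<rho> z) (\<rho> 1) < e4"
    using L(4) unfolding continuous_at_eps_delta by blast
  define r where "r = min r4 r5"
  show ?thesis
  proof (rule that[of r e4 c \<kappa> A B])
    show "0 < r" "r \<le> 1" using L(1) r5(1) r4e K(3) by (auto simp: r_def)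
    show "\<forall>t\<in>?N. \<kappa> (t / of_real \<tau>) = \<kappa> t" using inv by blast
    have rb: "z \<in> ball 1 e" if "z \<in> ball 1 r" for z using that r4e by (auto simp: r_def)
    show "\<forall>z\<in>ball 1 r. norm (A z) \<le> c * norm (z - 1)" "\<forall>z\<in>ball 1 r. norm (B z) \<le> c * norm (z - 1)"
      using K(13,14) rb by blast+
    have "\<rho> z \<in> ball 0 e4" if "z \<in> ball 1 r" for z
      using r5(2)[of z] that \<rho>1 by (simp add: r_def dist_commute)
    then show *: "\<forall>z\<in>ball 1 r. (1 - z) * exp (A z) \<in> ball 0 e4" unfolding \<rho>_def by blast
    show "\<forall>z\<in>ball 1 r. (1 - z) * exp (A z) \<notin> \<real>\<^sub>\<le>\<^sub>0 \<longrightarrow>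
       G z = exp (- B z) * ((1 - z) * exp (A z)) powr of_real \<alpha> * \<kappa> ((1 - z) * exp (A z))"
    proof (intro ballI impI)
      fix z :: complex assume z: "z \<in> ball 1 r" and n: "(1 - z) * exp (A z) \<notin> \<real>\<^sub>\<le>\<^sub>0"
      define t where "t = \<rho> z"
      have \<Phi>t: "\<Phi> t = z" using L(9) z by (simp add: t_def r_def)
      have "t \<noteq> 0" using n by (auto simp: t_def \<rho>_def)
      then have "t powr of_real \<alpha> * t powr of_real (- \<alpha>) = 1"
        by (simp add: powr_def flip: exp_add)
      moreover have "exp (- B z) * exp (B z) = 1" by (simp flip: exp_add)
      moreover have "exp (- B z) * t powr of_real \<alpha> * \<kappa> t
         = (exp (- B z) * exp (B z)) * (t powr of_real \<alpha> * t powr of_real (- \<alpha>)) * G z"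
        unfolding \<kappa>_def \<Phi>t by (simp only: mult_ac)
      ultimately have "G z = exp (- B z) * t powr of_real \<alpha> * \<kappa> t" by simp
      then show "G z = exp (- B z) * ((1 - z) * exp (A z)) powr of_real \<alpha> * \<kappa> ((1 - z) * exp (A z))"
        by (simp add: t_def \<rho>_def)
    qed
  qed (use L(4) K(4) h\<kappa> in auto)
qed

end

lemma exp_notin_nonpos_Reals:
  assumes "\<bar>Im w\<bar> < pi" shows "exp w \<notin> \<real>\<^sub>\<le>\<^sub>0"
proof
  assume *: "exp w \<in> \<real>\<^sub>\<le>\<^sub>0"
  have "Ln (exp w) = w" using assms by (intro Ln_exp) auto
  moreover have "Im (Ln (exp w)) = pi" using * exp_not_eq_zero[of w]
    by (subst Im_Ln_eq_pi) (auto simp: complex_nonpos_Reals_iff complex_eq_iff less_le)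
  ultimately show False using assms by simp
qed

context singular_renewal begin

lemma exp_ln_Ln: "t \<noteq> 0 \<Longrightarrow> exp (Ln t / of_real (ln \<tau>) * of_real (ln \<tau>)) = t"
  using ln_\<tau> by simp

text \<open>With \<open>s = Ln t / ln \<tau>\<close>, division of \<open>t\<close> by
  \<open>\<tau>\<close> becomes the shift to \<open>s - 1\<close>, and the slit plane corresponds to
  the strip. \<open>\<kappa>\<close> is given on a small disc only, but every \<open>s\<close> leads
  into it after subtraction of a large integer, and invariance makes the value independent of that
  integer.\<close>

lemma periodic_lift:
  assumes hol: "\<kappa> holomorphic_on ball 0 e - \<real>\<^sub>\<le>\<^sub>0" and e: "e > 0"
    and inv: "\<forall>t \<in> ball 0 e - \<real>\<^sub>\<le>\<^sub>0. \<kappa> (t / of_real \<tau>) = \<kappa> t"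
  obtains \<omega> :: "complex \<Rightarrow> complex" where "\<omega> holomorphic_on strip \<tau>" "\<forall>s\<in>strip \<tau>. \<omega> (s + 1) = \<omega> s"
    "\<forall>t \<in> ball 0 e - \<real>\<^sub>\<le>\<^sub>0. \<kappa> t = \<omega> (Ln t / of_real (ln \<tau>))"
proof -
  define E where "E = (\<lambda>n s. exp ((s - of_nat n) * complex_of_real (ln \<tau>)))"
  have E_Suc: "E (Suc n) s = E n s / of_real \<tau>" for n s
  proof -
    have "(s - of_nat (Suc n)) * complex_of_real (ln \<tau>) = (s - of_nat n) * complex_of_real (ln \<tau>) - of_real (ln \<tau>)"
      by (simp add: algebra_simps)
    moreover have "exp (complex_of_real (ln \<tau>)) = of_real \<tau>" using \<tau>_gt by (simp add: exp_of_real)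
    ultimately show ?thesis unfolding E_def by (simp add: exp_diff)
  qed
  have E_slit: "E n s \<notin> \<real>\<^sub>\<le>\<^sub>0" if "s \<in> strip \<tau>" for n s
  proof -
    have "\<bar>Im s\<bar> * ln \<tau> < pi" using that ln_\<tau> by (simp add: strip_def field_simps)
    then have "\<bar>Im ((s - of_nat n) * complex_of_real (ln \<tau>))\<bar> < pi" using ln_\<tau> by (simp add: abs_mult)
    then show ?thesis unfolding E_def by (rule exp_notin_nonpos_Reals)
  qed
  have nE: "norm (E n s) = norm (E 0 s) * (1 / \<tau>) ^ n" for n s
    by (induction n) (use \<tau>_gt in \<open>simp_all add: E_Suc norm_divide\<close>)
  have ex: "\<exists>n. norm (E n s) < e" for s
  proof -
    have "(\<lambda>n. norm (E 0 s) * (1 / \<tau>) ^ n) \<longlonglongrightarrow> norm (E 0 s) * 0"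
      by (intro tendsto_intros LIMSEQ_power_zero) (use \<tau>_gt in auto)
    then have "\<forall>\<^sub>F n in sequentially. norm (E 0 s) * (1 / \<tau>) ^ n < e" 
      using order_tendstoD(2)[of _ "norm (E 0 s) * 0" _ e] e by simp
    then obtain n where "norm (E 0 s) * (1 / \<tau>) ^ n < e" unfolding eventually_sequentially by blast
    then have "norm (E n s) < e" using nE[of n s] by linarith
    then show ?thesis by blast
  qed
  have const: "\<kappa> (E (n + k) s) = \<kappa> (E n s)" if s: "s \<in> strip \<tau>" "norm (E n s) < e" for n k s
  proof (induction k)
    case (Suc k)
    have "norm (E (n + k) s) = norm (E n s) * (1 / \<tau>) ^ k"
      unfolding nE[of "n + k"] nE[of n] by (simp add: power_add)
    also have "\<dots> \<le> norm (E n s)" using \<tau>_gt by (intro mult_right_le_one_le power_le_one) auto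
    finally have "E (n + k) s \<in> ball 0 e - \<real>\<^sub>\<le>\<^sub>0" using s E_slit by auto
    then have "\<kappa> (E (Suc (n + k)) s) = \<kappa> (E (n + k) s)" using bspec[OF inv] by (simp only: E_Suc)
    then show ?case using Suc by simp
  qed simp
  \<comment> \<open>Any admissible \<open>n\<close> may be taken; by \<open>const\<close> all give
    the same value.\<close>
  define \<omega> where "\<omega> = (\<lambda>s. \<kappa> (E (SOME n. norm (E n s) < e) s))"
  have \<omega>: "\<omega> s = \<kappa> (E n s)" if s: "s \<in> strip \<tau>" "norm (E n s) < e" for n s
  proof -
    let ?m = "SOME n. norm (E n s) < e"
    have m: "norm (E ?m s) < e" using someI_ex[OF ex[of s]] .
    show ?thesis
    proof (cases "?m \<le> n")
      case True
      then show ?thesis using const[OF s(1) m, of "n - ?m"] by (simp add: \<omega>_def)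
    next
      case False
      then show ?thesis using const[OF s, of "?m - n"] by (simp add: \<omega>_def)
    qed
  qed
  have cE: "E n holomorphic_on UNIV" for n unfolding E_def by (intro holomorphic_intros)
  \<comment> \<open>On the open set where a fixed \<open>n\<close> is admissible,
    \<open>\<omega>\<close> is a composition of holomorphic maps; these sets cover the
    strip.\<close>
  have "\<omega> holomorphic_on (\<Union>n. strip \<tau> \<inter> E n -` ball 0 e)"
  proof (rule holomorphic_on_UN_open)
    fix n
    show "open (strip \<tau> \<inter> E n -` ball 0 e)"
      by (intro continuous_open_preimage open_strip open_ball holomorphic_on_imp_continuous_on
           holomorphic_on_subset[OF cE]) auto
    have "E n ` (strip \<tau> \<inter> E n -` ball 0 e) \<subseteq> ball 0 e - \<real>\<^sub>\<le>\<^sub>0" using E_slit by auto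
    then have "(\<lambda>s. \<kappa> (E n s)) holomorphic_on (strip \<tau> \<inter> E n -` ball 0 e)"
      using holomorphic_on_compose_gen[OF holomorphic_on_subset[OF cE[of n] subset_UNIV] hol, of "strip \<tau> \<inter> E n -` ball 0 e"]
      by (simp add: o_def)
    then show "\<omega> holomorphic_on (strip \<tau> \<inter> E n -` ball 0 e)"
      by (rule holomorphic_transform) (use \<omega> in auto)
  qed
  moreover have "(\<Union>n. strip \<tau> \<inter> E n -` ball 0 e) = strip \<tau>" using ex by auto
  ultimately have h\<omega>: "\<omega> holomorphic_on strip \<tau>" by simp
  show ?thesis
  proof (rule that[OF h\<omega>])
    show "\<forall>s\<in>strip \<tau>. \<omega> (s + 1) = \<omega> s"
    proof
      fix s assume s: "s \<in> strip \<tau>"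
      obtain n where n: "norm (E n s) < e" using ex by blast
      have "E (Suc n) (s + 1) = E n s" by (simp add: E_def)
      moreover have "s + 1 \<in> strip \<tau>" using s by (simp add: strip_def)
      ultimately show "\<omega> (s + 1) = \<omega> s" using \<omega>[of "s + 1" "Suc n"] \<omega>[OF s n] n by simp
    qed
    show "\<forall>t \<in> ball 0 e - \<real>\<^sub>\<le>\<^sub>0. \<kappa> t = \<omega> (Ln t / of_real (ln \<tau>))"
    proof
      fix t :: complex assume t: "t \<in> ball 0 e - \<real>\<^sub>\<le>\<^sub>0"
      then have t0: "t \<noteq> 0" by auto
      have E0: "E 0 (Ln t / of_real (ln \<tau>)) = t" unfolding E_def using exp_ln_Ln[OF t0] by simp
      have "\<bar>Im (Ln t)\<bar> < pi" using t Im_Ln_less_pi[of t] mpi_less_Im_Ln[OF t0] by (auto simp: abs_less_iff)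
      then have "Ln t / of_real (ln \<tau>) \<in> strip \<tau>" using ln_\<tau> by (simp add: strip_def divide_strict_right_mono)
      then show "\<kappa> t = \<omega> (Ln t / of_real (ln \<tau>))" using \<omega>[of _ 0] E0 t by simp
    qed
  qed
qed

text \<open>One radius, namely 1, serves all \<open>\<delta>\<close>. Close to 1, replacing
  \<open>t\<close> by \<open>1 - z\<close> in the invariant representation costs a factor
  \<open>1 + O(z - 1)\<close> and a small shift in the argument of \<open>\<omega>\<close>. On the
  rest of the sector the remainder is bounded by compactness, and \<open>norm (z - 1)\<close> is
  bounded below.\<close>

lemma singular_expansion:
  obtains \<omega> :: "complex \<Rightarrow> complex" where "\<omega> holomorphic_on strip \<tau>" "\<forall>s\<in>strip \<tau>. \<omega> (s + 1) = \<omega> s"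
    "\<forall>\<delta>. 0 < \<delta> \<and> \<delta> < pi \<longrightarrow> (\<exists>R K. (\<forall>z\<in>U_region \<delta> 1 1. norm (R z) \<le> K * norm (z - 1)) \<and>
       (\<forall>z\<in>U_region \<delta> 1 1. G z = (1 - z) powr of_real \<alpha> * (\<omega> (Ln (1 - z) / of_real (ln \<tau>)) + R z)))"
proof -
  obtain \<kappa> A B r e c where I: "0 < r" "r \<le> 1" "0 < e" "c \<ge> 0" "\<kappa> holomorphic_on ball 0 e - \<real>\<^sub>\<le>\<^sub>0"
    "\<forall>t \<in> ball 0 e - \<real>\<^sub>\<le>\<^sub>0. \<kappa> (t / of_real \<tau>) = \<kappa> t"
    "\<forall>z \<in> ball 1 r. norm (A z) \<le> c * norm (z - 1)" "\<forall>z \<in> ball 1 r. norm (B z) \<le> c * norm (z - 1)"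
    "\<forall>z \<in> ball 1 r. (1 - z) * exp (A z) \<in> ball 0 e"
    "\<forall>z \<in> ball 1 r. (1 - z) * exp (A z) \<notin> \<real>\<^sub>\<le>\<^sub>0 \<longrightarrow>
       G z = exp (- B z) * ((1 - z) * exp (A z)) powr of_real \<alpha> * \<kappa> ((1 - z) * exp (A z))"
    by (rule invariant_function)
  obtain \<omega> where \<omega>: "\<omega> holomorphic_on strip \<tau>" "\<forall>s\<in>strip \<tau>. \<omega> (s + 1) = \<omega> s"
    "\<forall>t \<in> ball 0 e - \<real>\<^sub>\<le>\<^sub>0. \<kappa> t = \<omega> (Ln t / of_real (ln \<tau>))"
    by (rule periodic_lift[OF I(5,3,6)])
  have powr_split: "(1 - z) powr of_real \<alpha> \<noteq> 0" if "z \<noteq> 1" for z :: complex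
    using that by (simp add: powr_def)
  show ?thesis
  proof (rule that[OF \<omega>(1,2)], intro allI impI)
    fix \<delta> :: real assume \<delta>: "0 < \<delta> \<and> \<delta> < pi"
    \<comment> \<open>Half of the angle between the sector and the slit; \<open>exp (A z)\<close>
      will turn \<open>1 - z\<close> by less than \<open>\<eta>\<close>, so that \<open>t\<close>
      stays off the slit.\<close>
    define \<eta> where "\<eta> = (pi - \<delta>) / 2"
    have \<eta>: "\<eta> > 0" "\<delta> + \<eta> < pi" using \<delta> by (auto simp: \<eta>_def field_simps)
    define h where "h = (\<delta> + \<eta>) / ln \<tau>"
    have h: "h < pi / ln \<tau>" using \<eta>(2) ln_\<tau> by (simp add: h_def divide_strict_right_mono)
    obtain M where M: "M \<ge> 0" "\<And>s. \<bar>Im s\<bar> \<le> h \<Longrightarrow> norm (\<omega> s) \<le> M"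
      "\<And>s s'. \<bar>Im s\<bar> \<le> h \<Longrightarrow> \<bar>Im s'\<bar> \<le> h \<Longrightarrow> norm (s' - s) \<le> 1 \<Longrightarrow> norm (\<omega> s' - \<omega> s) \<le> M * norm (s' - s)"
      by (rule periodic_strip_bounds[OF \<omega>(1) _ h]) (use \<omega>(2) in blast)+
    obtain e' c' where ex: "0 < e'" "c' \<ge> 0" "\<And>x::complex. x \<in> ball 0 e' \<Longrightarrow> norm (exp x - exp 0) \<le> c' * norm (x - 0)"
      by (rule holomorphic_lipschitz_at[of exp 0 1]) (auto intro: holomorphic_intros)
    \<comment> \<open>\<open>\<eta>\<close> controls the argument of \<open>t\<close>,
      \<open>ln \<tau>\<close> keeps the shift in the argument of \<open>\<omega>\<close> below 1,
      and the last term keeps \<open>\<alpha> * a - b\<close> where the Lipschitz estimate for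
      \<open>exp\<close> holds.\<close>
    define m where "m = min \<eta> (min (ln \<tau>) (e' / (\<bar>\<alpha>\<bar> + 1)))"
    have m: "m > 0" "m \<le> \<eta>" "m \<le> ln \<tau>" "m \<le> e' / (\<bar>\<alpha>\<bar> + 1)" using \<eta> ln_\<tau> ex(1) by (auto simp: m_def)
    \<comment> \<open>This makes \<open>c * norm (z - 1) < m\<close>, so that \<open>A z\<close> and
      \<open>B z\<close> are below \<open>m\<close>.\<close>
    define r1 where "r1 = min r (m / (c + 1))"
    have r1: "r1 > 0" "r1 \<le> r" "r1 \<le> 1" using I m by (auto simp: r1_def)
    define R where "R = (\<lambda>z. G z / (1 - z) powr of_real \<alpha> - \<omega> (Ln (1 - z) / of_real (ln \<tau>)))"
    define K1 where "K1 = c' * ((\<bar>\<alpha>\<bar> + 1) * c) * M + M * (c / ln \<tau>)"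
    have near: "norm (R z) \<le> K1 * norm (z - 1)" if z: "z \<in> U_region \<delta> 1 1" and zr: "norm (z - 1) < r1" for z
    proof -
      have z1: "z \<noteq> 1" and arg: "\<bar>Im (Ln (1 - z))\<bar> < \<delta>" using z Arg_eq_Im_Ln[of "1 - z"] by (auto simp: U_region_def)
      have zb: "z \<in> ball 1 r" using zr r1 by (simp add: dist_norm norm_minus_commute)
      have "c * norm (z - 1) \<le> c * (m / (c + 1))" using zr I(4) by (intro mult_left_mono) (auto simp: r1_def)
      also have "\<dots> < m" using m(1) I(4) by (simp add: field_simps)
      finally have cm: "c * norm (z - 1) < m" .
      define a b where "a = A z" and "b = B z"
      have a: "norm a \<le> c * norm (z - 1)" "norm a < m" and b: "norm b \<le> c * norm (z - 1)"
        using I(7,8) zb cm by (auto simp: a_def b_def simp del: mem_ball intro: le_less_trans)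
      define x where "x = Ln (1 - z)"
      have ima: "\<bar>Im a\<bar> < \<eta>" using abs_Im_le_cmod[of a] a(2) m(2) by linarith
      have imxa: "\<bar>Im (x + a)\<bar> < \<delta> + \<eta>" using arg ima by (simp add: x_def)
      then have imp: "\<bar>Im (x + a)\<bar> < pi" using \<eta>(2) by linarith
      have t: "(1 - z) * exp (A z) = exp (x + a)" using z1 by (simp add: x_def a_def exp_add)
      have Lnt: "Ln (exp (x + a)) = x + a" using imp by (intro Ln_exp) auto
      have "G z = exp (- b) * exp (x + a) powr of_real \<alpha> * \<kappa> (exp (x + a))"
        using bspec[OF I(10) zb, unfolded t] exp_notin_nonpos_Reals[OF imp] unfolding b_def by blast
      moreover have "\<kappa> (exp (x + a)) = \<omega> ((x + a) / of_real (ln \<tau>))"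
        using \<omega>(3) bspec[OF I(9) zb, unfolded t] exp_notin_nonpos_Reals[OF imp] Lnt by (simp del: mem_ball)
      moreover have "exp (x + a) powr of_real \<alpha> = exp (of_real \<alpha> * x) * exp (of_real \<alpha> * a)"
        using Lnt by (simp add: powr_def distrib_left exp_add)
      moreover have p: "(1 - z) powr of_real \<alpha> = exp (of_real \<alpha> * x)" using z1 by (simp add: powr_def x_def)
      ultimately have "G z = (1 - z) powr of_real \<alpha> * (exp (- b) * exp (of_real \<alpha> * a) * \<omega> ((x + a) / of_real (ln \<tau>)))"
        by (simp add: mult_ac)
      then have Gz: "G z / (1 - z) powr of_real \<alpha> = exp (of_real \<alpha> * a - b) * \<omega> ((x + a) / of_real (ln \<tau>))"
        using p by (simp add: exp_diff exp_minus field_simps)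
      define y where "y = of_real \<alpha> * a - b"
      have yn: "norm y \<le> (\<bar>\<alpha>\<bar> + 1) * (c * norm (z - 1))"
      proof -
        have "norm y \<le> \<bar>\<alpha>\<bar> * norm a + norm b" unfolding y_def
          by (rule order_trans[OF norm_triangle_ineq4]) (simp add: norm_mult)
        also have "\<dots> \<le> \<bar>\<alpha>\<bar> * (c * norm (z - 1)) + c * norm (z - 1)"
          using a b by (intro add_mono mult_left_mono) auto
        finally show ?thesis by (simp add: algebra_simps)
      qed
      also have "\<dots> < (\<bar>\<alpha>\<bar> + 1) * m" using cm by (intro mult_strict_left_mono) auto
      also have "\<dots> \<le> e'" using m(4) by (simp add: field_simps)
      finally have "norm (exp y - 1) \<le> c' * norm y" using ex(3)[of y] by simp
      also have "\<dots> \<le> c' * ((\<bar>\<alpha>\<bar> + 1) * (c * norm (z - 1)))" using yn ex(2) by (rule mult_left_mono)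
      finally have ey: "norm (exp y - 1) \<le> c' * ((\<bar>\<alpha>\<bar> + 1) * (c * norm (z - 1)))" .
      let ?s = "x / of_real (ln \<tau>)" and ?s' = "(x + a) / of_real (ln \<tau>)"
      have ims: "\<bar>Im ?s\<bar> \<le> h" "\<bar>Im ?s'\<bar> \<le> h"
        using arg imxa \<eta>(1) ln_\<tau> by (simp_all add: h_def x_def abs_divide divide_right_mono)
      have sd: "norm (?s' - ?s) = norm a / ln \<tau>"
        using ln_\<tau> by (simp add: add_divide_distrib norm_divide)
      also have sd1: "\<dots> \<le> 1" using a(2) m(3) ln_\<tau> by simp
      finally have "norm (\<omega> ?s' - \<omega> ?s) \<le> M * norm (?s' - ?s)" using M(3)[OF ims] by blast
      also have "\<dots> \<le> M * (c / ln \<tau> * norm (z - 1))"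
        unfolding sd using M(1) a(1) ln_\<tau> by (intro mult_left_mono) (auto simp: field_simps)
      finally have wd: "norm (\<omega> ?s' - \<omega> ?s) \<le> M * (c / ln \<tau> * norm (z - 1))" .
      have "R z = (exp y - 1) * \<omega> ?s' + (\<omega> ?s' - \<omega> ?s)"
        unfolding R_def Gz y_def x_def by (simp add: algebra_simps)
      then have "norm (R z) \<le> norm (exp y - 1) * norm (\<omega> ?s') + norm (\<omega> ?s' - \<omega> ?s)"
        by (metis norm_mult norm_triangle_ineq)
      also have "\<dots> \<le> c' * ((\<bar>\<alpha>\<bar> + 1) * (c * norm (z - 1))) * M + M * (c / ln \<tau> * norm (z - 1))"
        using ey wd M(2)[OF ims(2)] ex(2) I(4) by (intro add_mono mult_mono) auto
      finally show ?thesis by (simp add: K1_def algebra_simps)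
    qed
    \<comment> \<open>The closed sector with \<open>norm (1 - z)\<close> between \<open>r1\<close>
      and 1, in polar coordinates, which show that it is compact.\<close>
    define P where "P = (\<lambda>(\<rho>, \<theta>). 1 - of_real \<rho> * cis \<theta>) ` ({r1..1} \<times> {-\<delta>..\<delta>})"
    define W where "W = {z \<in> green_domain. 1 - z \<notin> \<real>\<^sub>\<le>\<^sub>0}"
    have "compact P" unfolding P_def
      by (intro compact_continuous_image compact_Times compact_Icc)
         (auto simp: case_prod_unfold intro!: continuous_intros)
    have PW: "P \<subseteq> W"
    proof
      fix z assume "z \<in> P"
      then obtain \<rho> \<theta> where p: "z = 1 - of_real \<rho> * cis \<theta>" "r1 \<le> \<rho>" "\<rho> \<le> 1" "\<bar>\<theta>\<bar> \<le> \<delta>"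
        unfolding P_def by (auto simp: abs_le_iff)
      then have \<rho>: "\<rho> > 0" using r1 by simp
      have "1 - z = exp (Complex (ln \<rho>) \<theta>)" using \<rho> p(1) by (simp add: exp_eq_polar exp_of_real)
      moreover have "\<bar>Im (Complex (ln \<rho>) \<theta>)\<bar> < pi" using p \<delta> by simp
      ultimately have n: "1 - z \<notin> \<real>\<^sub>\<le>\<^sub>0" using exp_notin_nonpos_Reals by metis
      have "norm (1 - z) \<le> 1" using p \<rho> by (simp add: norm_mult)
      then have "\<bar>1 - Re z\<bar> \<le> 1" using abs_Re_le_cmod[of "1 - z"] by simp
      then have "z \<in> green_domain" using n
        by (auto simp: green_domain_iff complex_nonpos_Reals_iff complex_is_Real_iff)
      then show "z \<in> W" using n by (simp add: W_def)
    qed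
    have "continuous_on W R" unfolding R_def
    proof (intro continuous_intros)
      show "continuous_on W G" using holomorphic_on_imp_continuous_on[OF G_hol] by (rule continuous_on_subset) (auto simp: W_def)
      show "continuous_on W (\<lambda>z. \<omega> (Ln (1 - z) / complex_of_real (ln \<tau>)))"
      proof (rule continuous_on_compose2[OF holomorphic_on_imp_continuous_on[OF \<omega>(1)]])
        show "continuous_on W (\<lambda>z. Ln (1 - z) / complex_of_real (ln \<tau>))"
          using ln_\<tau> by (intro continuous_intros) (auto simp: W_def)
        show "(\<lambda>z. Ln (1 - z) / complex_of_real (ln \<tau>)) ` W \<subseteq> strip \<tau>"
        proof (rule image_subsetI)
          fix z assume "z \<in> W"
          then have z: "1 - z \<notin> \<real>\<^sub>\<le>\<^sub>0" by (simp add: W_def)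
          then have "1 - z \<noteq> 0" by auto
          then have "\<bar>Im (Ln (1 - z))\<bar> < pi" using Im_Ln_less_pi[OF z] mpi_less_Im_Ln[of "1 - z"] by linarith
          then show "Ln (1 - z) / complex_of_real (ln \<tau>) \<in> strip \<tau>"
            using ln_\<tau> by (simp add: strip_def abs_divide divide_strict_right_mono)
        qed
      qed
      show "\<forall>z\<in>W. (1 - z) powr complex_of_real \<alpha> \<noteq> 0" using powr_split by (auto simp: W_def)
    qed (auto simp: W_def complex_nonpos_Reals_iff)
    then have "bounded (R ` P)" using \<open>compact P\<close> PW
      by (meson compact_continuous_image compact_imp_bounded continuous_on_subset)
    then obtain K2 where K2: "\<And>z. z \<in> P \<Longrightarrow> norm (R z) \<le> K2" unfolding bounded_iff by blast
    have far: "norm (R z) \<le> \<bar>K2\<bar> / r1 * norm (z - 1)" if z: "z \<in> U_region \<delta> 1 1" and zr: "\<not> norm (z - 1) < r1" for z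
    proof -
      have "1 - z = of_real (norm (1 - z)) * cis (Arg (1 - z))" using rcis_cmod_Arg[of "1 - z"] by (simp add: rcis_def)
      then have "z = 1 - of_real (norm (1 - z)) * cis (Arg (1 - z))" by (simp add: algebra_simps)
      then have "z \<in> P" unfolding P_def using z zr
        by (intro image_eqI[of _ _ "(norm (1 - z), Arg (1 - z))"]) (auto simp: U_region_def norm_minus_commute)
      then have "norm (R z) \<le> \<bar>K2\<bar>" using K2 by force
      also have "\<dots> = \<bar>K2\<bar> / r1 * r1" using r1 by simp
      also have "\<dots> \<le> \<bar>K2\<bar> / r1 * norm (z - 1)" using zr r1 by (intro mult_left_mono) auto
      finally show ?thesis .
    qed
    show "\<exists>R K. (\<forall>z\<in>U_region \<delta> 1 1. norm (R z) \<le> K * norm (z - 1)) \<and>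
       (\<forall>z\<in>U_region \<delta> 1 1. G z = (1 - z) powr of_real \<alpha> * (\<omega> (Ln (1 - z) / of_real (ln \<tau>)) + R z))"
    proof (intro exI conjI ballI)
      fix z assume z: "z \<in> U_region \<delta> 1 1"
      show "norm (R z) \<le> max K1 (\<bar>K2\<bar> / r1) * norm (z - 1)"
      proof (cases "norm (z - 1) < r1")
        case True
        show ?thesis by (rule order_trans[OF near[OF z True]], rule mult_right_mono) auto
      next
        case False
        show ?thesis by (rule order_trans[OF far[OF z False]], rule mult_right_mono) auto
      qed
      show "G z = (1 - z) powr of_real \<alpha> * (\<omega> (Ln (1 - z) / of_real (ln \<tau>)) + R z)"
        using powr_split[of z] z by (simp add: R_def U_region_def)
    qed
  qed
qed

end

section \<open>Killed random walks and the continuation of the Green function\<close>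

lemma adj_sym: "adj X x y \<longleftrightarrow> adj X y x"
  by (simp add: adj_def insert_commute)

locale lf_graph =
  fixes Y :: "'a ugraph"
  assumes simple: "simple_graph Y" and lf: "locally_finite_graph Y"
begin

lemma adj_vertsD: "adj Y x y \<Longrightarrow> x \<in> verts Y" "adj Y x y \<Longrightarrow> y \<in> verts Y"
  using simple by (auto simp: simple_graph_def adj_def)

lemma not_adj_self: "\<not> adj Y x x"
  using simple by (force simp: simple_graph_def adj_def)

lemma finite_neighbours: "finite (neighbours Y x)"
proof (cases "x \<in> verts Y")
  case False
  then have "neighbours Y x = {}" using adj_vertsD by (auto simp: neighbours_def)
  then show ?thesis by simp
qed (use lf in \<open>auto simp: locally_finite_graph_def\<close>)

end

text \<open>The transition operator, for real and complex functions alike. At a vertex without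
  neighbours the value is 0.\<close>

definition avg :: "'a ugraph \<Rightarrow> ('a \<Rightarrow> 'b::real_normed_field) \<Rightarrow> 'a \<Rightarrow> 'b" where
  "avg X u x = (\<Sum>w\<in>neighbours X x. u w) / of_nat (degree X x)"

text \<open>\<open>kprob X B n x y\<close> is the entry of \<open>Q\<^sub>B\<^sup>n\<close> at \<open>(x, y)\<close>, and \<open>kgf X B z\<close> is \<open>Q\<^sub>B\<^sup>*(z)\<close>.\<close>

fun kprob :: "'a ugraph \<Rightarrow> 'a set \<Rightarrow> nat \<Rightarrow> 'a \<Rightarrow> 'a \<Rightarrow> real" where
  "kprob X B 0 x y = of_bool (x = y)"
| "kprob X B (Suc n) x y = (if x \<in> B then 0 else avg X (\<lambda>w. kprob X B n w y) x)"

definition kgf :: "'a ugraph \<Rightarrow> 'a set \<Rightarrow> complex \<Rightarrow> 'a \<Rightarrow> 'a \<Rightarrow> complex" where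
  "kgf X B z x y = (\<Sum>n. of_real (kprob X B n x y) * z ^ n)"

lemma srw_prob_eq_kprob: "srw_prob X n x y = kprob X {} n x y"
  by (induction n arbitrary: x) (simp_all add: avg_def sum_divide_distrib)

lemma avg_mult: "avg X (\<lambda>w. c * u w) x = c * avg X u x"
  by (simp add: avg_def sum_distrib_left)

lemma avg_add: "avg X (\<lambda>w. u w + v w) x = avg X u x + avg X v x"
  by (simp add: avg_def sum.distrib add_divide_distrib)

lemma avg_diff: "avg X (\<lambda>w. u w - v w) x = avg X u x - avg X v x"
  by (simp add: avg_def sum_subtractf diff_divide_distrib)

lemma avg_of_real: "avg X (\<lambda>w. complex_of_real (u w)) x = of_real (avg X u x)"
  by (simp add: avg_def)

lemma norm_avg_le:
  fixes u :: "'a \<Rightarrow> 'b::real_normed_field"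
  assumes "\<And>w. w \<in> neighbours X x \<Longrightarrow> norm (u w) \<le> M" "M \<ge> 0"
  shows "norm (avg X u x) \<le> M"
proof -
  have "norm (avg X u x) = norm (\<Sum>w\<in>neighbours X x. u w) / real (degree X x)"
    by (simp add: avg_def norm_divide)
  also have "norm (\<Sum>w\<in>neighbours X x. u w) \<le> (\<Sum>w\<in>neighbours X x. M)"
    by (rule sum_norm_le) (use assms in auto)
  finally have "norm (avg X u x) \<le> (\<Sum>w\<in>neighbours X x. M) / real (degree X x)"
    by (simp add: divide_right_mono)
  also have "\<dots> \<le> M" using assms(2) by (simp add: degree_def divide_le_eq)
  finally show ?thesis .
qed

lemma kprob_nonneg: "kprob X B n x y \<ge> 0"
  by (induction n arbitrary: x) (auto simp: avg_def intro!: sum_nonneg divide_nonneg_nonneg)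

lemma kprob_le_1: "kprob X B n x y \<le> 1"
proof (induction n arbitrary: x)
  case (Suc n)
  have "norm (avg X (\<lambda>w. kprob X B n w y) x) \<le> 1"
    by (rule norm_avg_le) (use Suc in \<open>simp_all add: kprob_nonneg\<close>)
  then show ?case by auto
qed auto

lemma kgf_summable:
  assumes "norm z < 1"
  shows "summable (\<lambda>n. of_real (kprob X B n x y) * z ^ n :: complex)"
proof (rule summable_comparison_test'[where g = "\<lambda>n. norm z ^ n" and N = 0])
  show "norm (of_real (kprob X B n x y) * z ^ n) \<le> norm z ^ n" for n
    using kprob_le_1[of X B n x y] kprob_nonneg[of X B n x y]
    by (simp add: norm_mult norm_power mult_left_le_one_le)
qed (use assms in \<open>simp add: summable_geometric\<close>)

text \<open>Stated under summability rather than for \<open>norm z < 1\<close>: in a finite network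
  with absorption the same step is needed beyond the unit disc.\<close>

lemma suminf_kprob_step:
  assumes "\<And>w. w \<in> insert x (neighbours X x) \<Longrightarrow> summable (\<lambda>n. of_real (kprob X B n w y) * z ^ n :: complex)"
  shows "kgf X B z x y = of_bool (x = y) + (if x \<in> B then 0 else z * avg X (\<lambda>w. kgf X B z w y) x)"
proof -
  have "kgf X B z x y = of_bool (x = y) + (\<Sum>n. of_real (kprob X B (Suc n) x y) * z ^ Suc n)"
    unfolding kgf_def using suminf_split_head[OF assms[OF insertI1]] by simp
  also have "(\<Sum>n. of_real (kprob X B (Suc n) x y) * z ^ Suc n) = (if x \<in> B then 0 else z * avg X (\<lambda>w. kgf X B z w y) x)"
  proof (cases "x \<in> B")
    case False
    have "(\<lambda>n. of_real (kprob X B (Suc n) x y) * z ^ Suc n)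
       = (\<lambda>n. \<Sum>w\<in>neighbours X x. z / of_nat (degree X x) * (of_real (kprob X B n w y) * z ^ n))"
      using False by (simp add: avg_def sum_distrib_left sum_distrib_right sum_divide_distrib mult_ac)
    moreover have "(\<Sum>n. \<Sum>w\<in>neighbours X x. z / of_nat (degree X x) * (of_real (kprob X B n w y) * z ^ n))
       = (\<Sum>w\<in>neighbours X x. \<Sum>n. z / of_nat (degree X x) * (of_real (kprob X B n w y) * z ^ n))"
      by (rule suminf_sum) (intro summable_mult assms insertI2)
    moreover have "\<dots> = (\<Sum>w\<in>neighbours X x. z / of_nat (degree X x) * kgf X B z w y)"
      unfolding kgf_def by (intro sum.cong suminf_mult assms insertI2 refl)
    ultimately show ?thesis using False by (simp add: avg_def sum_distrib_left sum_divide_distrib)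
  qed simp
  finally show ?thesis .
qed

lemmas kgf_step = suminf_kprob_step[OF kgf_summable]

lemma norm_kgf_le:
  assumes "norm z < 1" shows "norm (kgf X B z x y) \<le> 1 / (1 - norm z)"
proof -
  have "norm (kgf X B z x y) \<le> (\<Sum>n. norm z ^ n)"
    unfolding kgf_def
  proof (rule norm_suminf_le)
    show "norm (of_real (kprob X B n x y) * z ^ n) \<le> norm z ^ n" for n
      using kprob_le_1[of X B n x y] kprob_nonneg[of X B n x y]
      by (simp add: norm_mult norm_power mult_left_le_one_le)
  qed (use assms in \<open>simp add: summable_geometric\<close>)
  then show ?thesis using assms by (simp add: suminf_geometric)
qed

text \<open>Averaging does not increase a bound, so \<open>n\<close> applications of the equation
  bound \<open>h\<close> by \<open>norm z ^ n * M\<close>.\<close>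

lemma bounded_harmonic_zero:
  fixes h :: "'a \<Rightarrow> complex"
  assumes "norm z < 1" "M \<ge> 0" "\<And>x. x \<in> V \<Longrightarrow> norm (h x) \<le> M"
    "\<And>x. x \<in> V \<Longrightarrow> h x = z * avg X h x" "\<And>x. x \<in> V \<Longrightarrow> neighbours X x \<subseteq> V" "x \<in> V"
  shows "h x = 0"
proof -
  have b: "norm (h x) \<le> norm z ^ n * M" if "x \<in> V" for n x
    using that
  proof (induction n arbitrary: x)
    case (Suc n)
    have "norm (avg X h x) \<le> norm z ^ n * M"
    proof (rule norm_avg_le)
      show "norm (h w) \<le> norm z ^ n * M" if "w \<in> neighbours X x" for w
        using Suc.IH[of w] assms(5)[OF Suc.prems] that by blast
    qed (use assms in auto)
    then have "norm z * norm (avg X h x) \<le> norm z * (norm z ^ n * M)" by (rule mult_left_mono) simp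
    moreover have "norm (h x) = norm z * norm (avg X h x)" using assms(4)[OF Suc.prems] by (metis norm_mult)
    ultimately show ?case by simp
  qed (use assms in auto)
  have "(\<lambda>n. norm z ^ n * M) \<longlonglongrightarrow> 0 * M"
    by (intro tendsto_intros LIMSEQ_power_zero) (use assms in auto)
  then have "norm (h x) \<le> 0 * M"
    by (rule LIMSEQ_le_const) (use b[OF assms(6)] in auto)
  then show ?thesis by simp
qed

text \<open>The means of recognising a Green function: inside the unit disc it is the only bounded
  solution of its resolvent equation. This is applied to the Chebyshev series and to the Green
  function observed on \<open>F\<close>.\<close>

lemma bounded_solution_unique:
  fixes u v :: "'a \<Rightarrow> complex"
  assumes "norm z < 1" "\<And>x. x \<in> V \<Longrightarrow> norm (u x) \<le> M" "\<And>x. x \<in> V \<Longrightarrow> norm (v x) \<le> N"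
    "\<And>x. x \<in> V \<Longrightarrow> u x = b x + z * avg X u x" "\<And>x. x \<in> V \<Longrightarrow> v x = b x + z * avg X v x"
    "\<And>x. x \<in> V \<Longrightarrow> neighbours X x \<subseteq> V" "x \<in> V"
  shows "u x = v x"
proof -
  have "u x - v x = 0"
  proof (rule bounded_harmonic_zero[where h = "\<lambda>x. u x - v x" and M = "\<bar>M\<bar> + \<bar>N\<bar>" and V = V and z = z and X = X])
    show "norm (u x - v x) \<le> \<bar>M\<bar> + \<bar>N\<bar>" if "x \<in> V" for x
      using assms(2,3)[OF that] norm_triangle_ineq4[of "u x" "v x"] by linarith
    show "u x - v x = z * avg X (\<lambda>x. u x - v x) x" if "x \<in> V" for x
      using assms(4,5)[OF that] by (simp add: avg_diff algebra_simps)
  qed (use assms in auto)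
  then show ?thesis by simp
qed

text \<open>
  \<open>cheb X v n\<close> is \<open>T\<^sub>n(P)\<close> applied to the indicator of \<open>v\<close>, for the Chebyshev polynomial \<open>T\<^sub>n\<close>
  and the transition operator \<open>P\<close>.
\<close>

fun cheb :: "'a ugraph \<Rightarrow> 'a \<Rightarrow> nat \<Rightarrow> 'a \<Rightarrow> real" where
  "cheb X v 0 = (\<lambda>x. of_bool (x = v))"
| "cheb X v (Suc 0) = avg X (\<lambda>x. of_bool (x = v))"
| "cheb X v (Suc (Suc n)) = (\<lambda>x. 2 * avg X (cheb X v (Suc n)) x - cheb X v n x)"

section \<open>The energy method for Chebyshev polynomials of the transition operator\<close>

definition weighted_ip :: "'a ugraph \<Rightarrow> 'a set \<Rightarrow> ('a \<Rightarrow> real) \<Rightarrow> ('a \<Rightarrow> real) \<Rightarrow> real" where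
  "weighted_ip X S u v = (\<Sum>x\<in>S. real (degree X x) * u x * v x)"

lemma weighted_ip_commute: "weighted_ip X S u v = weighted_ip X S v u"
  by (simp add: weighted_ip_def mult_ac)

lemma weighted_ip_diff_left: "weighted_ip X S (\<lambda>x. u x - u' x) v = weighted_ip X S u v - weighted_ip X S u' v"
  by (simp add: weighted_ip_def algebra_simps sum_subtractf)

lemma weighted_ip_scale_left: "weighted_ip X S (\<lambda>x. c * u x) v = c * weighted_ip X S u v"
  by (simp add: weighted_ip_def sum_distrib_left mult_ac)

lemma weighted_ip_diff_right: "weighted_ip X S v (\<lambda>x. u x - u' x) = weighted_ip X S v u - weighted_ip X S v u'"
  by (simp add: weighted_ip_def algebra_simps sum_subtractf)

lemma weighted_ip_scale_right: "weighted_ip X S v (\<lambda>x. c * u x) = c * weighted_ip X S v u"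
  by (simp add: weighted_ip_def sum_distrib_left mult_ac)

context lf_graph
begin

lemma degree_mult_avg: "real (degree Y x) * avg Y u x = (\<Sum>w\<in>neighbours Y x. u w)"
  using finite_neighbours[of x] by (cases "degree Y x = 0") (auto simp: avg_def degree_def)

lemma sum_neighbours_support:
  assumes "finite S" "\<And>w. w \<notin> S \<Longrightarrow> u w = 0"
  shows "(\<Sum>w\<in>neighbours Y x. u w) = (\<Sum>w\<in>S. if adj Y x w then u w else (0::real))"
proof -
  have "(\<Sum>w\<in>neighbours Y x. u w) = (\<Sum>w\<in>neighbours Y x \<inter> S. u w)"
    by (rule sum.mono_neutral_right) (use finite_neighbours assms in auto)
  also have "\<dots> = (\<Sum>w\<in>S. if adj Y x w then u w else 0)"
    using assms(1) by (simp add: sum.If_cases neighbours_def Int_commute)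
  finally show ?thesis .
qed

text \<open>The weight \<open>degree\<close> cancels the normalisation of \<open>avg\<close> and
  leaves the symmetric adjacency relation. \<open>S\<close> makes the sums finite; it contains the
  supports of \<open>u\<close> and \<open>v\<close>, though not necessarily those of their
  averages.\<close>

lemma weighted_ip_avg_symmetric:
  assumes "finite S" "\<And>w. w \<notin> S \<Longrightarrow> u w = 0" "\<And>w. w \<notin> S \<Longrightarrow> v w = 0"
  shows "weighted_ip Y S (avg Y u) v = weighted_ip Y S u (avg Y v)"
proof -
  have "real (degree Y x) * avg Y u x * v x = (\<Sum>w\<in>S. if adj Y x w then u w * v x else 0)" for x
  proof -
    have "real (degree Y x) * avg Y u x * v x = (\<Sum>w\<in>S. if adj Y x w then u w else 0) * v x"
      unfolding degree_mult_avg using sum_neighbours_support[OF assms(1), of u x] assms(2) by simp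
    then show ?thesis by (auto simp: sum_distrib_right intro: sum.cong)
  qed
  then have "weighted_ip Y S (avg Y u) v = (\<Sum>x\<in>S. \<Sum>w\<in>S. if adj Y x w then u w * v x else 0)"
    by (simp only: weighted_ip_def)
  also have "\<dots> = (\<Sum>w\<in>S. \<Sum>x\<in>S. if adj Y x w then u w * v x else 0)"
    by (rule sum.swap)
  also have "\<dots> = (\<Sum>w\<in>S. u w * (\<Sum>x\<in>S. if adj Y w x then v x else 0))"
    by (simp add: sum_distrib_left adj_sym[of Y] if_distrib cong: if_cong)
  also have "\<dots> = weighted_ip Y S u (avg Y v)"
  proof -
    have "(\<Sum>x\<in>S. if adj Y w x then v x else 0) = real (degree Y w) * avg Y v w" for w
      unfolding degree_mult_avg using sum_neighbours_support[OF assms(1), of v w] assms(3) by simp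
    then show ?thesis by (simp add: weighted_ip_def mult_ac)
  qed
  finally show ?thesis .
qed

text \<open>Cauchy-Schwarz at each vertex bounds the left side by a sum over edges, in which the
  square of \<open>u w\<close> is counted at most \<open>degree Y w\<close> times.\<close>

lemma weighted_ip_avg_contraction:
  assumes "finite S" "\<And>w. w \<notin> S \<Longrightarrow> u w = 0"
  shows "weighted_ip Y S (avg Y u) (avg Y u) \<le> weighted_ip Y S u u"
proof -
  have le: "real (degree Y x) * avg Y u x * avg Y u x \<le> (\<Sum>w\<in>S. if adj Y x w then (u w)\<^sup>2 else 0)" for x
  proof -
    have "(\<Sum>w\<in>neighbours Y x. u w)\<^sup>2 \<le> (\<Sum>w\<in>neighbours Y x. (u w)\<^sup>2) * real (degree Y x)"
      using Cauchy_Schwarz_ineq_sum[of u "\<lambda>_. 1" "neighbours Y x"] by (simp add: degree_def)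
    then have "real (degree Y x) * avg Y u x * avg Y u x \<le> (\<Sum>w\<in>neighbours Y x. (u w)\<^sup>2)"
      by (cases "degree Y x = 0") (auto simp: avg_def power2_eq_square divide_le_eq sum_nonneg)
    also have "\<dots> = (\<Sum>w\<in>S. if adj Y x w then (u w)\<^sup>2 else 0)"
      by (rule sum_neighbours_support) (use assms in auto)
    finally show ?thesis .
  qed
  have "weighted_ip Y S (avg Y u) (avg Y u) \<le> (\<Sum>x\<in>S. \<Sum>w\<in>S. if adj Y x w then (u w)\<^sup>2 else 0)"
    unfolding weighted_ip_def by (rule sum_mono) (rule le)
  also have "\<dots> = (\<Sum>w\<in>S. \<Sum>x\<in>S. if adj Y x w then (u w)\<^sup>2 else 0)"
    by (rule sum.swap)
  also have "\<dots> \<le> (\<Sum>w\<in>S. real (degree Y w) * u w * u w)"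
  proof (rule sum_mono)
    fix w
    have "(\<Sum>x\<in>S. if adj Y x w then (u w)\<^sup>2 else 0) = real (card (S \<inter> {x. adj Y x w})) * (u w)\<^sup>2"
      using assms(1) by (simp add: sum.If_cases)
    also have "card (S \<inter> {x. adj Y x w}) \<le> degree Y w"
      unfolding degree_def
      by (rule card_mono[OF finite_neighbours]) (auto simp: neighbours_def adj_sym)
    finally show "(\<Sum>x\<in>S. if adj Y x w then (u w)\<^sup>2 else 0) \<le> real (degree Y w) * u w * u w"
      by (simp add: power2_eq_square mult_right_mono mult.assoc)
  qed
  finally show ?thesis by (simp add: weighted_ip_def)
qed

lemma finite_support_avg:
  assumes "finite {x. u x \<noteq> (0::real)}"
  shows "finite {x. avg Y u x \<noteq> 0}"
proof (rule finite_subset)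
  show "{x. avg Y u x \<noteq> 0} \<subseteq> (\<Union>w\<in>{x. u x \<noteq> 0}. neighbours Y w)"
  proof
    fix x assume "x \<in> {x. avg Y u x \<noteq> 0}"
    then have "(\<Sum>w\<in>neighbours Y x. u w) \<noteq> 0" by (auto simp: avg_def)
    then obtain w where "w \<in> neighbours Y x" "u w \<noteq> 0" by (meson sum.neutral)
    then show "x \<in> (\<Union>w\<in>{x. u x \<noteq> 0}. neighbours Y w)" by (auto simp: neighbours_def adj_sym)
  qed
qed (use assms finite_neighbours in auto)

lemma finite_support_cheb: "finite {x. cheb Y v n x \<noteq> 0}"
proof (induction n rule: induct_nat_012)
  case 0
  show ?case by simp
next
  case 1
  show ?case using finite_support_avg[of "\<lambda>x. of_bool (x = v)"] by simp
next
  case (ge2 n)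
  have "{x. cheb Y v (Suc (Suc n)) x \<noteq> 0} \<subseteq> {x. avg Y (cheb Y v (Suc n)) x \<noteq> 0} \<union> {x. cheb Y v n x \<noteq> 0}"
    by auto
  then show ?case using finite_support_avg[OF ge2(2)] ge2(1) finite_subset by blast
qed

text \<open>
  The recurrence is a discrete wave equation, and the quantity computed here is its conserved energy.
\<close>

lemma cheb_energy:
  assumes "finite S" "\<And>i x. i \<le> Suc n \<Longrightarrow> x \<notin> S \<Longrightarrow> cheb Y v i x = 0"
  shows "weighted_ip Y S (cheb Y v (Suc n)) (cheb Y v (Suc n)) + weighted_ip Y S (cheb Y v n) (cheb Y v n)
       - 2 * weighted_ip Y S (avg Y (cheb Y v n)) (cheb Y v (Suc n))
     = weighted_ip Y S (cheb Y v 0) (cheb Y v 0) - weighted_ip Y S (cheb Y v 1) (cheb Y v 1)"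
  using assms(2)
proof (induction n)
  case (Suc n)
  let ?c = "cheb Y v"
  have sym: "weighted_ip Y S (avg Y (?c (Suc n))) (?c n) = weighted_ip Y S (?c (Suc n)) (avg Y (?c n))"
    by (rule weighted_ip_avg_symmetric) (use assms(1) Suc.prems in auto)
  have e: "?c (Suc (Suc n)) = (\<lambda>x. 2 * avg Y (?c (Suc n)) x - ?c n x)" by simp
  have "weighted_ip Y S (?c (Suc (Suc n))) (?c (Suc (Suc n))) - 2 * weighted_ip Y S (avg Y (?c (Suc n))) (?c (Suc (Suc n)))
     = weighted_ip Y S (?c n) (?c n) - 2 * weighted_ip Y S (avg Y (?c n)) (?c (Suc n))"
    unfolding e weighted_ip_diff_left weighted_ip_diff_right weighted_ip_scale_left weighted_ip_scale_right
    using sym weighted_ip_commute[of Y S "?c (Suc n)" "avg Y (?c n)"] weighted_ip_commute[of Y S "?c n" "avg Y (?c (Suc n))"] by simp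
  moreover have "weighted_ip Y S (?c (Suc n)) (?c (Suc n)) + weighted_ip Y S (?c n) (?c n) - 2 * weighted_ip Y S (avg Y (?c n)) (?c (Suc n))
     = weighted_ip Y S (?c 0) (?c 0) - weighted_ip Y S (?c 1) (?c 1)"
    by (rule Suc.IH) (use Suc.prems in auto)
  ultimately show ?case by linarith
qed simp

text \<open>By the conserved energy and the contraction property of \<open>avg\<close>, the squared
  weighted norm of the difference is at most that of the indicator of \<open>v\<close>, which is
  \<open>degree Y v\<close>; the contribution of the vertex \<open>v\<close> alone gives the claim.
  In the variable \<open>x = cos t\<close> the difference is
  \<open>- sin t sin (n t)\<close>.\<close>

lemma cheb_diff_bound:
  assumes "degree Y v > 0"
  shows "\<bar>cheb Y v (Suc n) v - avg Y (cheb Y v n) v\<bar> \<le> 1"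
proof -
  let ?c = "cheb Y v"
  define S where "S = insert v (\<Union>i\<le>Suc n. {x. ?c i x \<noteq> 0})"
  have S: "finite S" "v \<in> S" using finite_support_cheb by (auto simp: S_def)
  have supp: "?c i x = 0" if "i \<le> Suc n" "x \<notin> S" for i x using that by (auto simp: S_def)
  let ?w = "\<lambda>x. ?c (Suc n) x - avg Y (?c n) x"
  have "real (degree Y v) * ?w v * ?w v \<le> weighted_ip Y S ?w ?w"
    unfolding weighted_ip_def by (rule member_le_sum[OF S(2)]) (use S in \<open>auto simp: mult.assoc\<close>)
  also have "\<dots> = weighted_ip Y S (?c (Suc n)) (?c (Suc n)) - 2 * weighted_ip Y S (avg Y (?c n)) (?c (Suc n)) + weighted_ip Y S (avg Y (?c n)) (avg Y (?c n))"
    unfolding weighted_ip_diff_left weighted_ip_diff_right using weighted_ip_commute[of Y S "?c (Suc n)" "avg Y (?c n)"] by simp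
  also have "\<dots> \<le> weighted_ip Y S (?c (Suc n)) (?c (Suc n)) - 2 * weighted_ip Y S (avg Y (?c n)) (?c (Suc n)) + weighted_ip Y S (?c n) (?c n)"
    using weighted_ip_avg_contraction[OF S(1), of "?c n"] supp by simp
  also have "\<dots> = weighted_ip Y S (?c 0) (?c 0) - weighted_ip Y S (?c 1) (?c 1)"
  proof -
    have "weighted_ip Y S (?c (Suc n)) (?c (Suc n)) + weighted_ip Y S (?c n) (?c n) - 2 * weighted_ip Y S (avg Y (?c n)) (?c (Suc n))
      = weighted_ip Y S (?c 0) (?c 0) - weighted_ip Y S (?c 1) (?c 1)"
      by (rule cheb_energy[OF S(1)]) (use supp in auto)
    then show ?thesis by linarith
  qed
  also have "\<dots> \<le> weighted_ip Y S (?c 0) (?c 0)" by (simp add: weighted_ip_def sum_nonneg mult.assoc)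
  also have "\<dots> = real (degree Y v)"
    using S by (simp add: weighted_ip_def of_bool_def if_distrib cong: if_cong)
  finally have "?w v * ?w v \<le> 1" using assms by (simp add: mult.assoc)
  then show ?thesis by (simp add: abs_square_le_1 flip: power2_eq_square)
qed

text \<open>The recurrence can be written
  \<open>T (n+2) = 2 * (T (n+2) - P (T (n+1))) + T n\<close>, and the bracket is at most 1 in
  modulus at \<open>v\<close>: two steps add at most 2. Linear growth is enough for convergence on
  the unit disc.\<close>

lemma cheb_linear_bound:
  assumes "degree Y v > 0" shows "\<bar>cheb Y v n v\<bar> \<le> real (Suc n)"
proof (induction n rule: induct_nat_012)
  case 1
  have "\<bar>cheb Y v 1 v - avg Y (cheb Y v 0) v\<bar> = 0" by simp
  moreover have "\<bar>avg Y (cheb Y v 0) v\<bar> \<le> 1" using norm_avg_le[of Y v "cheb Y v 0" 1] by simp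
  ultimately show ?case by simp
next
  case (ge2 n)
  then show ?case using cheb_diff_bound[OF assms, of "Suc n"] by simp
qed simp

text \<open>A crude bound, but at all vertices: for small \<open>\<zeta>\<close> it makes the series
  bounded on the whole graph, as uniqueness of the resolvent solution requires.\<close>

lemma cheb_exp_bound: "\<bar>cheb Y v n x\<bar> \<le> 3 ^ n"
proof (induction n arbitrary: x rule: induct_nat_012)
  case 1
  have "\<bar>avg Y (cheb Y v 0) x\<bar> \<le> 1" using norm_avg_le[of Y x "cheb Y v 0" 1] by simp
  then show ?case by simp
next
  case (ge2 n)
  have "\<bar>avg Y (cheb Y v (Suc n)) x\<bar> \<le> 3 ^ Suc n" using norm_avg_le[of Y x "cheb Y v (Suc n)" "3 ^ Suc n"] ge2 by simp
  then show ?case using ge2(1)[of x] by simp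
qed simp

lemma summable_Suc_mult_power:
  assumes "norm (z::complex) < 1"
  shows "summable (\<lambda>n. real (Suc n) * norm z ^ n)"
  using geometric_deriv_sums[of "norm z"] assms sums_summable by auto

lemma cheb_series_holomorphic:
  assumes "degree Y v > 0"
  shows "(\<lambda>\<zeta>. \<Sum>n. of_real (cheb Y v n v) * \<zeta> ^ n) holomorphic_on ball (0::complex) 1"
proof (rule power_series_holomorphic[where a = "\<lambda>n. of_real (cheb Y v n v)"])
  fix w :: complex assume "w \<in> ball 0 1"
  then have w: "norm w < 1" by simp
  have "summable (\<lambda>n. of_real (cheb Y v n v) * w ^ n)"
  proof (rule summable_comparison_test'[OF summable_Suc_mult_power[OF w], of 0])
    show "norm (of_real (cheb Y v n v) * w ^ n) \<le> real (Suc n) * norm w ^ n" for n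
      using cheb_linear_bound[OF assms, of n] by (simp add: norm_mult norm_power mult_right_mono)
  qed
  then show "(\<lambda>n. of_real (cheb Y v n v) * (w - 0) ^ n) sums (\<Sum>n. of_real (cheb Y v n v) * w ^ n)"
    by (simp add: summable_sums)
qed

text \<open>The scalar identity \<open>2 * (\<Sum>n. T n x * \<zeta> ^ n) - 1 = (1 - \<zeta>^2) / (1
  - 2 * x * \<zeta> + \<zeta>^2)\<close>, with the transition operator in place of \<open>x\<close>
  and the denominator multiplied out. The radius \<open>1 / 3\<close> comes from the bound
  \<open>3 ^ n\<close>.\<close>

lemma cheb_generating_function:
  fixes \<zeta> :: complex and v x :: 'a
  assumes z: "norm \<zeta> < 1 / 3"
  defines "W \<equiv> \<lambda>x. \<Sum>n. of_real (cheb Y v n x) * \<zeta> ^ n"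
  shows "(1 + \<zeta>\<^sup>2) * (2 * W x - of_bool (x = v)) = (1 - \<zeta>\<^sup>2) * of_bool (x = v)
      + 2 * \<zeta> * avg Y (\<lambda>x. 2 * W x - of_bool (x = v)) x"
    and "norm (W x) \<le> 1 / (1 - 3 * norm \<zeta>)"
proof -
  have geo: "summable (\<lambda>n. (3 * norm \<zeta>) ^ n)" using z by (intro summable_geometric) simp
  have bnd: "norm (of_real (cheb Y v n x) * \<zeta> ^ n) \<le> (3 * norm \<zeta>) ^ n" for n x
    using cheb_exp_bound[of v n x] by (simp add: norm_mult norm_power power_mult_distrib mult_right_mono)
  have sm: "summable (\<lambda>n. of_real (cheb Y v n x) * \<zeta> ^ n)" for x
    by (rule summable_comparison_test'[OF geo, of 0]) (rule bnd)
  have "norm (W x) \<le> (\<Sum>n. (3 * norm \<zeta>) ^ n)"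
    unfolding W_def by (rule norm_suminf_le[OF bnd geo])
  also have "\<dots> = 1 / (1 - 3 * norm \<zeta>)" using z by (intro suminf_geometric) simp
  finally show "norm (W x) \<le> 1 / (1 - 3 * norm \<zeta>)" .
  let ?c = "\<lambda>n x. complex_of_real (cheb Y v n x)"
  have smA: "summable (\<lambda>n. avg Y (?c n) x * \<zeta> ^ n)"
   and sA: "avg Y W x = (\<Sum>n. avg Y (?c n) x * \<zeta> ^ n)"
  proof -
    have 1: "avg Y (?c n) x * \<zeta> ^ n = (\<Sum>w\<in>neighbours Y x. 1 / of_nat (degree Y x) * (?c n w * \<zeta> ^ n))" for n
      by (simp add: avg_def sum_distrib_left sum_distrib_right sum_divide_distrib mult_ac)
    show "summable (\<lambda>n. avg Y (?c n) x * \<zeta> ^ n)" unfolding 1 by (intro summable_sum summable_mult sm)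
    have "(\<Sum>n. avg Y (?c n) x * \<zeta> ^ n) = (\<Sum>w\<in>neighbours Y x. \<Sum>n. 1 / of_nat (degree Y x) * (?c n w * \<zeta> ^ n))"
      unfolding 1 by (rule suminf_sum) (intro summable_mult sm)
    also have "\<dots> = (\<Sum>w\<in>neighbours Y x. 1 / of_nat (degree Y x) * W w)"
      unfolding W_def by (intro sum.cong suminf_mult sm refl)
    finally show "avg Y W x = (\<Sum>n. avg Y (?c n) x * \<zeta> ^ n)"
      by (simp add: avg_def sum_divide_distrib)
  qed
  have t1: "W x = ?c 0 x + (\<Sum>n. ?c (Suc n) x * \<zeta> ^ Suc n)"
    unfolding W_def using suminf_split_head[OF sm[of x]] by simp
  have sm1: "summable (\<lambda>n. ?c (Suc n) x * \<zeta> ^ Suc n)" using iffD2[OF summable_Suc_iff sm[of x]] .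
  have t2: "W x = ?c 0 x + ?c 1 x * \<zeta> + (\<Sum>n. ?c (Suc (Suc n)) x * \<zeta> ^ Suc (Suc n))"
    using suminf_split_head[OF sm1] t1 by simp
  have smA1: "summable (\<lambda>n. avg Y (?c (Suc n)) x * \<zeta> ^ Suc n)" using iffD2[OF summable_Suc_iff smA] .
  have tA: "(\<Sum>n. avg Y (?c (Suc n)) x * \<zeta> ^ Suc n) = avg Y W x - avg Y (?c 0) x"
    unfolding sA using suminf_split_head[OF smA] by simp
  have "(\<Sum>n. ?c (Suc (Suc n)) x * \<zeta> ^ Suc (Suc n))
     = (\<Sum>n. 2 * \<zeta> * (avg Y (?c (Suc n)) x * \<zeta> ^ Suc n) - \<zeta>\<^sup>2 * (?c n x * \<zeta> ^ n))"
    by (rule arg_cong[of _ _ suminf], rule ext) (simp add: avg_of_real algebra_simps power2_eq_square)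
  also have "\<dots> = 2 * \<zeta> * (avg Y W x - avg Y (?c 0) x) - \<zeta>\<^sup>2 * W x"
    using suminf_diff[OF summable_mult[OF smA1, of "2 * \<zeta>"] summable_mult[OF sm[of x], of "\<zeta>\<^sup>2"]]
      suminf_mult[OF smA1, of "2 * \<zeta>"] suminf_mult[OF sm[of x], of "\<zeta>\<^sup>2"] unfolding tA W_def by simp
  finally have key: "W x = ?c 0 x + ?c 1 x * \<zeta> + (2 * \<zeta> * (avg Y W x - avg Y (?c 0) x) - \<zeta>\<^sup>2 * W x)"
    using t2 by simp
  have c1: "?c 1 x = avg Y (?c 0) x"
    using avg_of_real[of Y "cheb Y v 0" x] by (simp only: One_nat_def cheb.simps)
  have c0: "?c 0 = (\<lambda>x. of_bool (x = v))" by (auto simp: fun_eq_iff of_bool_def)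
  have a: "avg Y (\<lambda>x. 2 * W x - of_bool (x = v)) x = 2 * avg Y W x - avg Y (?c 0) x"
    unfolding c0 by (simp add: avg_diff avg_mult)
  show "(1 + \<zeta>\<^sup>2) * (2 * W x - of_bool (x = v)) = (1 - \<zeta>\<^sup>2) * of_bool (x = v)
      + 2 * \<zeta> * avg Y (\<lambda>x. 2 * W x - of_bool (x = v)) x"
  proof -
    have gen: "(1 + \<zeta>\<^sup>2) * (2 * w - b) = (1 - \<zeta>\<^sup>2) * b + 2 * \<zeta> * (2 * A - a)"
      if "w = b + a * \<zeta> + (2 * \<zeta> * (A - a) - \<zeta>\<^sup>2 * w)" for w b a A
    proof -
      have "(1 + \<zeta>\<^sup>2) * w = b - \<zeta> * a + 2 * \<zeta> * A" using that by (simp add: algebra_simps)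
      then have "(1 + \<zeta>\<^sup>2) * (2 * w - b) = 2 * (b - \<zeta> * a + 2 * \<zeta> * A) - (1 + \<zeta>\<^sup>2) * b"
        by (simp only: right_diff_distrib mult.left_commute[of _ 2])
      then show ?thesis by (simp add: algebra_simps)
    qed
    show ?thesis using gen[OF key[unfolded c1]] unfolding a fun_cong[OF c0, of x] .
  qed
qed

end

text \<open>Of the solutions of \<open>z = 2 * \<zeta> / (1 + \<zeta>^2)\<close> this is the one in
  the unit disc. On the slit plane \<open>1 - z^2\<close> avoids the nonpositive axis, so its root
  \<open>s\<close> has positive real part, and \<open>\<zeta>^2 = (1 - s) / (1 + s)\<close> has
  modulus below 1.\<close>

lemma joukowski_inverse:
  assumes "z \<in> green_domain"
  defines "s \<equiv> csqrt (1 - z\<^sup>2)"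
  defines "\<zeta> \<equiv> z / (1 + s)"
  shows "1 - z\<^sup>2 \<notin> \<real>\<^sub>\<le>\<^sub>0" "Re s > 0" "1 + s \<noteq> 0" "norm \<zeta> < 1" "z * (1 + \<zeta>\<^sup>2) = 2 * \<zeta>" "1 - \<zeta>\<^sup>2 = s * (1 + \<zeta>\<^sup>2)"
proof -
  show *: "1 - z\<^sup>2 \<notin> \<real>\<^sub>\<le>\<^sub>0"
  proof
    assume "1 - z\<^sup>2 \<in> \<real>\<^sub>\<le>\<^sub>0"
    then have h: "Im (z\<^sup>2) = 0" "Re (z\<^sup>2) \<ge> 1" by (auto simp: complex_nonpos_Reals_iff)
    have "Im z = 0"
    proof (rule ccontr)
      assume i: "Im z \<noteq> 0"
      then have "Re z = 0" using h(1) by (simp add: power2_eq_square)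
      then have "Re (z\<^sup>2) \<le> 0" by (simp add: power2_eq_square)
      then show False using h(2) by simp
    qed
    then have "z \<in> \<real>" "1 \<le> (Re z)\<^sup>2" using h(2) by (simp_all add: complex_is_Real_iff power2_eq_square)
    then show False using assms(1) by (auto simp: green_domain_iff abs_square_less_1[symmetric])
  qed
  show s: "Re s > 0"
  proof -
    have "s \<noteq> 0" using * by (auto simp: s_def)
    have "s\<^sup>2 = 1 - z\<^sup>2" by (simp add: s_def)
    have "Re s \<noteq> 0"
    proof
      assume "Re s = 0"
      then have "s\<^sup>2 \<in> \<real>\<^sub>\<le>\<^sub>0" by (simp add: complex_nonpos_Reals_iff power2_eq_square)
      then show False using * by (simp add: s_def)
    qed
    then show ?thesis using csqrt_principal[of "1 - z\<^sup>2"] by (auto simp: s_def)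
  qed
  then show s1: "1 + s \<noteq> 0" by (auto simp: complex_eq_iff)
  have s2: "s\<^sup>2 = 1 - z\<^sup>2" by (simp add: s_def)
  have z2: "\<zeta>\<^sup>2 = (1 - s) / (1 + s)"
  proof -
    have "\<zeta>\<^sup>2 = (1 - s\<^sup>2) / (1 + s)\<^sup>2" by (simp add: \<zeta>_def power_divide s2)
    also have "\<dots> = (1 - s) * (1 + s) / ((1 + s) * (1 + s))" by (simp add: power2_eq_square algebra_simps)
    also have "\<dots> = (1 - s) / (1 + s)" using s1 by simp
    finally show ?thesis .
  qed
  have p: "1 + \<zeta>\<^sup>2 = 2 / (1 + s)" unfolding z2 using s1 by (simp add: field_simps)
  show "z * (1 + \<zeta>\<^sup>2) = 2 * \<zeta>" unfolding p by (simp add: \<zeta>_def)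
  show "1 - \<zeta>\<^sup>2 = s * (1 + \<zeta>\<^sup>2)" unfolding p z2 using s1 by (simp add: field_simps)
  have "(cmod (1 - s))\<^sup>2 < (cmod (1 + s))\<^sup>2" using s unfolding cmod_power2 by (simp add: power2_eq_square algebra_simps)
  then have "cmod (1 - s) < cmod (1 + s)" by (rule power2_less_imp_less) simp
  then have "(cmod \<zeta>)\<^sup>2 < 1" using s1 by (simp add: z2 norm_divide flip: norm_power)
  then show "norm \<zeta> < 1" by (simp add: abs_square_less_1)
qed

context lf_graph
begin

text \<open>Dividing the generating identity by \<open>s * (1 + \<zeta>^2)\<close> turns it into the
  resolvent equation, because \<open>2 * \<zeta> / (1 + \<zeta>^2) = z\<close> and
  \<open>(1 - \<zeta>^2) / (1 + \<zeta>^2) = s\<close>. For small \<open>z\<close>, uniqueness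
  identifies the solution with the Green function; its value at \<open>v\<close> is a series that
  converges for all \<open>\<zeta>\<close> in the unit disc, hence on the whole slit plane.\<close>

lemma green_continuation:
  assumes v: "v \<in> verts Y" "degree Y v > 0"
  shows "\<exists>G. G holomorphic_on green_domain \<and>
     (\<forall>z. norm z < 1 \<longrightarrow> (\<lambda>n. of_real (srw_prob Y n v v) * z ^ n) sums G z)"
proof -
  define s where "s = (\<lambda>z::complex. csqrt (1 - z\<^sup>2))"
  define \<zeta> where "\<zeta> = (\<lambda>z. z / (1 + s z))"
  define H where "H = (\<lambda>\<zeta>::complex. \<Sum>n. of_real (cheb Y v n v) * \<zeta> ^ n)"
  define G where "G = (\<lambda>z. (2 * H (\<zeta> z) - 1) / s z)"
  have J: "1 - z\<^sup>2 \<notin> \<real>\<^sub>\<le>\<^sub>0" "Re (s z) > 0" "1 + s z \<noteq> 0" "norm (\<zeta> z) < 1"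
      "z * (1 + (\<zeta> z)\<^sup>2) = 2 * \<zeta> z" "1 - (\<zeta> z)\<^sup>2 = s z * (1 + (\<zeta> z)\<^sup>2)" if z: "z \<in> green_domain" for z
    using joukowski_inverse[OF z] unfolding s_def \<zeta>_def by blast+
  have s_hol: "s holomorphic_on green_domain"
    unfolding s_def by (intro holomorphic_intros) (use J(1) in auto)
  have \<zeta>_hol: "\<zeta> holomorphic_on green_domain"
    unfolding \<zeta>_def by (intro holomorphic_intros s_hol) (use J(3) in auto)
  have "\<zeta> ` green_domain \<subseteq> ball 0 1" using J(4) by auto
  then have "(\<lambda>z. H (\<zeta> z)) holomorphic_on green_domain"
    using holomorphic_on_compose_gen[OF \<zeta>_hol cheb_series_holomorphic[OF v(2)]] by (simp add: o_def H_def)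
  then have G_hol: "G holomorphic_on green_domain"
    unfolding G_def by (intro holomorphic_intros s_hol) (use J(2) in force)+
  have ball_dom: "ball 0 1 \<subseteq> green_domain"
  proof
    fix z :: complex assume "z \<in> ball 0 1"
    then show "z \<in> green_domain" using abs_Re_le_cmod[of z] by (auto simp: green_domain_iff)
  qed
  have kgf_hol: "(\<lambda>z. kgf Y {} z v v) holomorphic_on ball 0 1"
    by (rule power_series_holomorphic[where a = "\<lambda>n. of_real (kprob Y {} n v v)"])
       (use summable_sums[OF kgf_summable] in \<open>auto simp: kgf_def\<close>)
  have "0 \<in> green_domain" by (simp add: green_domain_iff)
  then have "continuous (at 0) \<zeta>"
    using holomorphic_on_imp_continuous_on[OF \<zeta>_hol] open_green_domain continuous_on_eq_continuous_at by blast
  moreover have "\<zeta> 0 = 0" by (simp add: \<zeta>_def)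
  ultimately obtain \<eta> where \<eta>: "\<eta> > 0" "\<And>z. dist z 0 < \<eta> \<Longrightarrow> dist (\<zeta> z) 0 < 1 / 3"
    unfolding continuous_at_eps_delta by (metis zero_less_divide_1_iff zero_less_numeral)
  have pull: "a * k * b + c * k * d = k * (a * b + c * d)" for a b c d k :: complex
    by (simp add: algebra_simps)
  have local: "G z = kgf Y {} z v v" if z: "z \<in> ball 0 (min 1 \<eta>)" for z
  proof -
    have z1: "norm z < 1" and zd: "z \<in> green_domain" using z ball_dom by auto
    have z3: "norm (\<zeta> z) < 1 / 3" using \<eta>(2)[of z] z by simp
    define W where "W = (\<lambda>x. \<Sum>n. of_real (cheb Y v n x) * \<zeta> z ^ n)"
    define w where "w = (\<lambda>x. (2 * W x - of_bool (x = v)) / s z)"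
    have cg: "(1 + (\<zeta> z)\<^sup>2) * (2 * W x - of_bool (x = v)) = (1 - (\<zeta> z)\<^sup>2) * of_bool (x = v)
      + 2 * \<zeta> z * avg Y (\<lambda>x. 2 * W x - of_bool (x = v)) x" "norm (W x) \<le> 1 / (1 - 3 * norm (\<zeta> z))" for x
      unfolding W_def by (rule cheb_generating_function[OF z3])+
    have sz: "s z \<noteq> 0" using J(2)[OF zd] by auto
    have p: "1 + (\<zeta> z)\<^sup>2 \<noteq> 0"
    proof
      assume "1 + (\<zeta> z)\<^sup>2 = 0"
      then have "(\<zeta> z)\<^sup>2 = -1" by (simp add: add_eq_0_iff)
      then have "(norm (\<zeta> z))\<^sup>2 = 1" by (metis norm_minus_cancel norm_one norm_power)
      then show False using J(4)[OF zd] by (simp add: abs_square_eq_1)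
    qed
    have weq: "w x = of_bool (x = v) + z * avg Y w x" for x
    proof -
      have aw: "avg Y w x = avg Y (\<lambda>x. 2 * W x - of_bool (x = v)) x / s z"
        unfolding w_def using avg_mult[of Y "1 / s z"] by simp
      have "(1 + (\<zeta> z)\<^sup>2) * (2 * W x - of_bool (x = v)) = s z * (1 + (\<zeta> z)\<^sup>2) * of_bool (x = v)
          + z * (1 + (\<zeta> z)\<^sup>2) * avg Y (\<lambda>x. 2 * W x - of_bool (x = v)) x"
        using cg(1)[of x] J(5,6)[OF zd] by simp
      also have "\<dots> = (1 + (\<zeta> z)\<^sup>2) * (s z * of_bool (x = v) + z * avg Y (\<lambda>x. 2 * W x - of_bool (x = v)) x)"
        by (rule pull)
      finally have "2 * W x - of_bool (x = v) = s z * of_bool (x = v) + z * avg Y (\<lambda>x. 2 * W x - of_bool (x = v)) x"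
        using p by simp
      then show ?thesis unfolding aw unfolding w_def using sz by (simp add: add_divide_distrib)
    qed
    have "w v = kgf Y {} z v v"
    proof (rule bounded_solution_unique[where V = UNIV and u = w and v = "\<lambda>x. kgf Y {} z x v"
            and b = "\<lambda>x. of_bool (x = v)" and X = Y and z = z])
      show "norm (w x) \<le> (2 * (1 / (1 - 3 * norm (\<zeta> z))) + 1) / norm (s z)" for x
        unfolding w_def norm_divide
      proof (rule divide_right_mono)
        have "norm (2 * W x - of_bool (x = v)) \<le> norm (2 * W x) + norm (of_bool (x = v) :: complex)"
          by (rule norm_triangle_ineq4)
        also have "\<dots> \<le> 2 * (1 / (1 - 3 * norm (\<zeta> z))) + 1"
          using cg(2)[of x] by (intro add_mono) (auto simp: norm_mult)
        finally show "norm (2 * W x - of_bool (x = v)) \<le> 2 * (1 / (1 - 3 * norm (\<zeta> z))) + 1" .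
      qed simp
      show "norm (kgf Y {} z x v) \<le> 1 / (1 - norm z)" for x by (rule norm_kgf_le[OF z1])
      show "kgf Y {} z x v = of_bool (x = v) + z * avg Y (\<lambda>x. kgf Y {} z x v) x" for x
        using kgf_step[OF z1, of Y "{}" x v] by simp
    qed (use z1 weq in auto)
    then show ?thesis by (simp add: w_def G_def W_def H_def)
  qed
  have eq: "G z = kgf Y {} z v v" if "z \<in> ball 0 1" for z
  proof (rule analytic_continuation_open[where s = "ball 0 (min 1 \<eta>)" and s' = "ball 0 1" and f = G])
    show "ball 0 (min 1 \<eta>) \<noteq> ({} :: complex set)" using \<eta>(1) by simp
    show "G holomorphic_on ball 0 1" using holomorphic_on_subset[OF G_hol ball_dom] .
  qed (use local kgf_hol that in auto)
  show ?thesis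
  proof (rule exI[of _ G], intro conjI allI impI)
    fix z :: complex assume z: "norm z < 1"
    then show "(\<lambda>n. of_real (srw_prob Y n v v) * z ^ n) sums G z"
      using summable_sums[OF kgf_summable[OF z, of Y "{}" v v]] eq[of z]
      by (simp add: srw_prob_eq_kprob kgf_def)
  qed (rule G_hol)
qed

lemma green_function_props:
  assumes "v \<in> verts Y" "degree Y v > 0"
  shows "green_function Y v holomorphic_on green_domain"
    and "norm z < 1 \<Longrightarrow> green_function Y v z = kgf Y {} z v v"
proof -
  have *: "green_function Y v holomorphic_on green_domain \<and>
     (\<forall>z. norm z < 1 \<longrightarrow> (\<lambda>n. of_real (srw_prob Y n v v) * z ^ n) sums green_function Y v z)"
    unfolding green_function_def by (rule someI_ex[OF green_continuation[OF assms]])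
  then show "green_function Y v holomorphic_on green_domain" by blast
  show "green_function Y v z = kgf Y {} z v v" if "norm z < 1"
    using * that by (simp add: kgf_def sums_iff srw_prob_eq_kprob)
qed

end

section \<open>Absorption in finite networks\<close>

lemma avg_cong: "(\<And>w. w \<in> neighbours X x \<Longrightarrow> u w = v w) \<Longrightarrow> avg X u x = avg X v x"
  by (simp add: avg_def cong: sum.cong)

lemma avg_sum: "avg X (\<lambda>w. \<Sum>i\<in>I. u i w) x = (\<Sum>i\<in>I. avg X (u i) x)"
  unfolding avg_def by (subst sum.swap) (simp add: sum_divide_distrib)

lemma avg_mono:
  fixes u v :: "'a \<Rightarrow> real"
  assumes "\<And>w. w \<in> neighbours X x \<Longrightarrow> u w \<le> v w"
  shows "avg X u x \<le> avg X v x"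
  unfolding avg_def by (intro divide_right_mono sum_mono assms) auto

locale killed_net = lf_graph Y for Y :: "'a ugraph" +
  fixes B :: "'a set"
  assumes fin: "finite (verts Y)" and conn: "connected_graph Y"
    and B_sub: "B \<subseteq> verts Y" and B_ne: "B \<noteq> {}"
begin

lemma neighbours_sub: "neighbours Y x \<subseteq> verts Y"
  using adj_vertsD by (auto simp: neighbours_def)

lemma degree_pos:
  assumes "x \<in> verts Y" "x \<notin> B"
  shows "degree Y x > 0"
proof -
  obtain b where b: "b \<in> B" using B_ne by blast
  then have "(adj Y)\<^sup>*\<^sup>* x b" using conn assms B_sub by (auto simp: connected_graph_def linked_def)
  moreover have "x \<noteq> b" using assms b by auto
  ultimately obtain w where "adj Y x w" by (metis converse_rtranclpE)
  then show ?thesis using finite_neighbours[of x] by (auto simp: degree_def card_gt_0_iff neighbours_def)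
qed

lemma avg_const: "x \<in> verts Y \<Longrightarrow> x \<notin> B \<Longrightarrow> avg Y (\<lambda>_. c) x = c"
  using degree_pos[of x] by (simp add: avg_def degree_def)

lemma kprob_Suc_0: "kprob Y B (Suc 0) x y = (if x \<notin> B \<and> adj Y x y then 1 / real (degree Y x) else 0)"
  using finite_neighbours[of x] by (auto simp: avg_def neighbours_def of_bool_def)

lemma avg_eq_sum:
  fixes u :: "'a \<Rightarrow> 'b::real_normed_field"
  assumes "x \<notin> B"
  shows "avg Y u x = (\<Sum>w\<in>verts Y. of_real (kprob Y B (Suc 0) x w) * u w)"
proof -
  have "(\<Sum>w\<in>verts Y. of_real (kprob Y B (Suc 0) x w) * u w)
     = (\<Sum>w\<in>verts Y. if w \<in> neighbours Y x then u w / of_nat (degree Y x) else 0)"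
    unfolding kprob_Suc_0 by (rule sum.cong) (auto simp: neighbours_def assms)
  also have "\<dots> = (\<Sum>w\<in>neighbours Y x. u w / of_nat (degree Y x))"
    using fin neighbours_sub[of x] by (simp add: sum.If_cases Int_absorb1)
  finally show ?thesis by (simp add: avg_def sum_divide_distrib)
qed

lemma kprob_add:
  assumes "x \<in> verts Y"
  shows "kprob Y B (n + m) x y = (\<Sum>w\<in>verts Y. kprob Y B n x w * kprob Y B m w y)"
  using assms
proof (induction n arbitrary: x)
  case 0
  then show ?case using fin by (simp add: of_bool_def if_distrib[of "\<lambda>c. c * _"] cong: if_cong)
next
  case (Suc n)
  show ?case
  proof (cases "x \<in> B")
    case False
    have "avg Y (\<lambda>w. kprob Y B (n + m) w y) x = avg Y (\<lambda>w. \<Sum>v\<in>verts Y. kprob Y B m v y * kprob Y B n w v) x"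
      by (rule avg_cong) (use Suc.IH neighbours_sub[of x] in \<open>auto simp: mult.commute\<close>)
    also have "\<dots> = (\<Sum>v\<in>verts Y. kprob Y B m v y * avg Y (\<lambda>w. kprob Y B n w v) x)"
      by (simp add: avg_sum avg_mult)
    finally show ?thesis using False by (simp add: mult.commute)
  qed simp
qed

text \<open>The probability that the walk from \<open>x\<close> avoids \<open>B\<close> at times
  \<open>0\<close> to \<open>n - 1\<close>; a vertex of \<open>B\<close> still counts at the moment
  it is reached.\<close>

definition mass :: "nat \<Rightarrow> 'a \<Rightarrow> real" where
  "mass n x = (\<Sum>y\<in>verts Y. kprob Y B n x y)"

lemma mass_0: "x \<in> verts Y \<Longrightarrow> mass 0 x = 1"
  using fin by (simp add: mass_def of_bool_def)

lemma mass_Suc: "mass (Suc n) x = (if x \<in> B then 0 else avg Y (mass n) x)"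
  unfolding mass_def by (simp add: avg_sum)

lemma mass_nonneg: "mass n x \<ge> 0"
  by (simp add: mass_def sum_nonneg kprob_nonneg)

lemma mass_le_1: "x \<in> verts Y \<Longrightarrow> mass n x \<le> 1"
proof (induction n arbitrary: x)
  case (Suc n)
  have "norm (avg Y (mass n) x) \<le> 1"
    by (rule norm_avg_le) (use Suc.IH mass_nonneg neighbours_sub[of x] in auto)
  then show ?case by (auto simp: mass_Suc)
qed (simp add: mass_0)

lemma mass_decreasing: "x \<in> verts Y \<Longrightarrow> mass (Suc n) x \<le> mass n x"
proof (induction n arbitrary: x)
  case 0
  then show ?case using mass_le_1 mass_0 by metis
next
  case (Suc n)
  have "avg Y (mass (Suc n)) x \<le> avg Y (mass n) x"
    by (rule avg_mono) (use Suc.IH neighbours_sub[of x] in blast)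
  then show ?case by (subst (1 2) mass_Suc) simp
qed

lemma mass_antimono:
  assumes "x \<in> verts Y" "m \<le> n" shows "mass n x \<le> mass m x"
  using assms(2)
proof (induction n rule: dec_induct)
  case (step n)
  then show ?case using mass_decreasing[OF assms(1), of n] by linarith
qed simp

text \<open>A deficit at \<open>y\<close> is passed on to each neighbour of \<open>y\<close> one
  step later, and every vertex is joined to \<open>B\<close> by a path.\<close>

lemma mass_eventually_less_1:
  assumes "x \<in> verts Y" shows "\<exists>n. mass n x < 1"
proof -
  obtain b where b: "b \<in> B" using B_ne by blast
  then have "(adj Y)\<^sup>*\<^sup>* x b" using conn assms B_sub by (auto simp: connected_graph_def linked_def)
  then show ?thesis
  proof (induction rule: converse_rtranclp_induct)
    case base
    have "mass (Suc 0) b = 0" using b by (simp add: mass_Suc)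
    then show ?case by (metis zero_less_one)
  next
    case (step x y)
    then obtain n where n: "mass n y < 1" by blast
    have xV: "x \<in> verts Y" and yN: "y \<in> neighbours Y x" using step(1) adj_vertsD by (auto simp: neighbours_def)
    have "mass (Suc n) x < 1"
    proof (cases "x \<in> B")
      case False
      have "(\<Sum>w\<in>neighbours Y x. mass n w) < (\<Sum>w\<in>neighbours Y x. 1)"
      proof (rule sum_strict_mono_ex1[OF finite_neighbours])
        show "\<forall>w\<in>neighbours Y x. mass n w \<le> 1" using mass_le_1 neighbours_sub by blast
        show "\<exists>w\<in>neighbours Y x. mass n w < 1" using yN n by blast
      qed
      then show ?thesis using False degree_pos[OF xV False] by (simp add: mass_Suc avg_def degree_def)
    qed (simp add: mass_Suc)
    then show ?case by blast
  qed
qed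

text \<open>After \<open>m\<close> further steps a fixed proportion is lost,
  \<open>mass (n + m) x \<le> q * mass n x\<close>; \<open>\<rho>\<close> is the \<open>m\<close>-th
  root of \<open>q\<close>.\<close>

lemma geometric_decay:
  obtains \<rho> K where "0 < \<rho>" "\<rho> < 1" "\<And>n x y. x \<in> verts Y \<Longrightarrow> y \<in> verts Y \<Longrightarrow> kprob Y B n x y \<le> K * \<rho> ^ n"
proof -
  obtain N where N: "\<And>x. x \<in> verts Y \<Longrightarrow> mass (N x) x < 1" using mass_eventually_less_1 by metis
  \<comment> \<open>\<open>Suc\<close> makes \<open>m\<close> positive, as the \<open>m\<close>-th
    root requires.\<close>
  define m where "m = Suc (Max (insert 0 (N ` verts Y)))"
  have m: "N x \<le> m" if "x \<in> verts Y" for x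
    unfolding m_def by (rule le_SucI, rule Max_ge) (use fin that in auto)
  have mm: "mass m x < 1" if "x \<in> verts Y" for x
    using N[OF that] mass_antimono[OF that m[OF that]] by linarith
  \<comment> \<open>The value \<open>1/2\<close> keeps \<open>q\<close>, and hence
    \<open>\<rho>\<close>, positive.\<close>
  define q where "q = Max (insert (1/2) (mass m ` verts Y))"
  have q: "q < 1" unfolding q_def using fin mm by (subst Max_less_iff) auto
  have q0: "1/2 \<le> q" unfolding q_def using fin by (intro Max_ge) auto
  have mq: "mass m x \<le> q" if "x \<in> verts Y" for x
    unfolding q_def using fin that by (intro Max_ge) auto
  have sub: "mass (n + m) x \<le> q * mass n x" if "x \<in> verts Y" for n x
  proof -
    have "mass (n + m) x = (\<Sum>w\<in>verts Y. kprob Y B n x w * mass m w)"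
      unfolding mass_def kprob_add[OF that] by (subst sum.swap) (simp add: sum_distrib_left)
    also have "\<dots> \<le> (\<Sum>w\<in>verts Y. kprob Y B n x w * q)"
      by (intro sum_mono mult_left_mono mq kprob_nonneg)
    finally show ?thesis by (simp add: mass_def sum_distrib_left mult.commute)
  qed
  have it: "mass (k * m + r) x \<le> q ^ k" if "x \<in> verts Y" for k r x
  proof (induction k)
    case (Suc k)
    have "mass (Suc k * m + r) x \<le> q * mass (k * m + r) x" using sub[OF that, of "k * m + r"] by (simp add: add_ac)
    also have "\<dots> \<le> q * q ^ k" using Suc q0 by (intro mult_left_mono) auto
    finally show ?case by simp
  qed (use mass_le_1 that in simp)
  define \<rho> where "\<rho> = root m q"
  have m0: "m > 0" by (simp add: m_def)
  have \<rho>: "0 < \<rho>" "\<rho> < 1" "\<rho> ^ m = q"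
    using q q0 m0 by (auto simp: \<rho>_def real_root_pow_pos2 real_root_gt_zero)
  show ?thesis
  \<comment> \<open>The constant compensates for the rounding in \<open>n div m\<close>.\<close>
  proof (rule that[of \<rho> "1 / \<rho> ^ m"])
    fix n x y assume xy: "x \<in> verts Y" "y \<in> verts Y"
    have "kprob Y B n x y \<le> mass n x"
      unfolding mass_def by (rule member_le_sum) (use xy fin kprob_nonneg in auto)
    also have "mass n x = mass (n div m * m + n mod m) x" by simp
    also have "\<dots> \<le> q ^ (n div m)" by (rule it[OF xy(1)])
    also have "\<dots> = \<rho> ^ (m * (n div m))" by (simp add: power_mult \<rho>(3))
    also have "\<dots> * \<rho> ^ m \<le> \<rho> ^ n" 
    proof -
      have "n \<le> m * (n div m) + m" using m0 by (metis add_le_cancel_left div_mult_mod_eq less_imp_le mod_less_divisor mult.commute)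
      then show ?thesis unfolding power_add[symmetric] using \<rho>(1,2) by (intro power_decreasing) auto
    qed
    then have "\<rho> ^ (m * (n div m)) \<le> 1 / \<rho> ^ m * \<rho> ^ n" using \<rho> q0 by (simp add: field_simps)
    finally show "kprob Y B n x y \<le> 1 / \<rho> ^ m * \<rho> ^ n" .
  qed (use \<rho> in auto)
qed

lemma kprob_outside: "x \<in> verts Y \<Longrightarrow> y \<notin> verts Y \<Longrightarrow> kprob Y B n x y = 0"
proof (induction n arbitrary: x)
  case (Suc n)
  have "avg Y (\<lambda>w. kprob Y B n w y) x = avg Y (\<lambda>w. 0) x"
    by (rule avg_cong) (use Suc neighbours_sub[of x] in blast)
  then show ?case by (simp add: avg_def)
qed auto

text \<open>The radius \<open>1 / \<rho>\<close> exceeds 1, so the point 1, where the time scaling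
  factor is a derivative, is interior.\<close>

lemma convergence_radius:
  obtains r where "r > 1" "\<And>x y z. x \<in> verts Y \<Longrightarrow> norm z < r \<Longrightarrow> summable (\<lambda>n. of_real (kprob Y B n x y) * z ^ n :: complex)"
proof -
  obtain \<rho> K where \<rho>: "0 < \<rho>" "\<rho> < 1" "\<And>n x y. x \<in> verts Y \<Longrightarrow> y \<in> verts Y \<Longrightarrow> kprob Y B n x y \<le> K * \<rho> ^ n"
    using geometric_decay by metis
  show ?thesis
  proof (rule that[of "1 / \<rho>"])
    show "1 / \<rho> > 1" using \<rho> by simp
    fix x y and z :: complex assume x: "x \<in> verts Y" and z: "norm z < 1 / \<rho>"
    show "summable (\<lambda>n. of_real (kprob Y B n x y) * z ^ n)"
    proof (cases "y \<in> verts Y")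
      case True
      have "summable (\<lambda>n. K * (\<rho> * norm z) ^ n)"
        using z \<rho> by (intro summable_mult summable_geometric) (simp add: field_simps)
      then show ?thesis
      proof (rule summable_comparison_test'[where N = 0])
        show "norm (of_real (kprob Y B n x y) * z ^ n) \<le> K * (\<rho> * norm z) ^ n" for n
          using mult_right_mono[OF \<rho>(3)[OF x True, of n], of "norm z ^ n"] kprob_nonneg[of Y B n x y]
          by (simp add: norm_mult norm_power power_mult_distrib mult_ac)
      qed
    qed (use kprob_outside x in simp)
  qed
qed

definition conv :: "complex \<Rightarrow> bool" where
  "conv z \<longleftrightarrow> (\<forall>x\<in>verts Y. \<forall>y. summable (\<lambda>n. of_real (kprob Y B n x y) * z ^ n :: complex))"

lemma conv_less_1: "norm z < 1 \<Longrightarrow> conv z"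
  by (simp add: conv_def kgf_summable)

lemma conv_step:
  assumes "conv z" "x \<in> verts Y"
  shows "kgf Y B z x y = of_bool (x = y) + (if x \<in> B then 0 else z * avg Y (\<lambda>w. kgf Y B z w y) x)"
  by (rule suminf_kprob_step) (use assms neighbours_sub[of x] in \<open>auto simp: conv_def\<close>)

text \<open>Splits off the last step of the walk instead of the first one; this makes
  \<open>kgf\<close> a left inverse of \<open>I - z Q\<close> as well as a right inverse.\<close>

lemma conv_step_left:
  assumes "conv z" "x \<in> verts Y"
  shows "kgf Y B z x y = of_bool (x = y) + z * (\<Sum>w\<in>verts Y. kgf Y B z x w * of_real (kprob Y B (Suc 0) w y))"
proof -
  have s: "summable (\<lambda>n. of_real (kprob Y B n x w) * z ^ n :: complex)" for w
    using assms unfolding conv_def by blast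
  have "kgf Y B z x y = of_bool (x = y) + (\<Sum>n. of_real (kprob Y B (Suc n) x y) * z ^ Suc n)"
    unfolding kgf_def using suminf_split_head[OF s] by simp
  also have "(\<lambda>n. of_real (kprob Y B (Suc n) x y) * z ^ Suc n)
     = (\<lambda>n. \<Sum>w\<in>verts Y. z * of_real (kprob Y B (Suc 0) w y) * (of_real (kprob Y B n x w) * z ^ n))"
  proof
    fix n
    have "kprob Y B (Suc n) x y = (\<Sum>w\<in>verts Y. kprob Y B n x w * kprob Y B (Suc 0) w y)"
      using kprob_add[OF assms(2), of n "Suc 0" y] by simp
    then show "of_real (kprob Y B (Suc n) x y) * z ^ Suc n
      = (\<Sum>w\<in>verts Y. z * of_real (kprob Y B (Suc 0) w y) * (of_real (kprob Y B n x w) * z ^ n))"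
      by (simp only: of_real_sum of_real_mult sum_distrib_right power_Suc) (simp add: mult_ac)
  qed
  also have "(\<Sum>n. \<Sum>w\<in>verts Y. z * of_real (kprob Y B (Suc 0) w y) * (of_real (kprob Y B n x w) * z ^ n))
     = (\<Sum>w\<in>verts Y. \<Sum>n. z * of_real (kprob Y B (Suc 0) w y) * (of_real (kprob Y B n x w) * z ^ n))"
    by (rule suminf_sum) (intro summable_mult s)
  also have "\<dots> = (\<Sum>w\<in>verts Y. z * of_real (kprob Y B (Suc 0) w y) * kgf Y B z x w)"
    unfolding kgf_def by (intro sum.cong suminf_mult s refl)
  finally show ?thesis by (simp add: sum_distrib_left mult_ac)
qed

text \<open>The identity \<open>u = N (I - z Q) u\<close> for the inverse \<open>N\<close> of
  \<open>I - z Q\<close>, valid for every function \<open>u\<close>. It will be used for a constant,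
  for the Green kernel without absorption, and for functions with \<open>u = z * avg Y u\<close> off
  the boundary.\<close>

lemma first_hit:
  assumes "conv z" "x \<in> verts Y"
  shows "u x = (\<Sum>y\<in>verts Y. kgf Y B z x y * (u y - (if y \<in> B then 0 else z * avg Y u y)))"
proof -
  let ?q = "\<lambda>y w. complex_of_real (kprob Y B (Suc 0) y w)"
  have q: "(if y \<in> B then 0 else z * avg Y u y) = z * (\<Sum>w\<in>verts Y. ?q y w * u w)" for y
  proof (cases "y \<in> B")
    case True
    then show ?thesis by simp
  next
    case False
    then show ?thesis using avg_eq_sum[OF False, of u] by simp
  qed
  have "(\<Sum>y\<in>verts Y. kgf Y B z x y * (u y - (if y \<in> B then 0 else z * avg Y u y)))
     = (\<Sum>y\<in>verts Y. kgf Y B z x y * u y) - (\<Sum>y\<in>verts Y. \<Sum>w\<in>verts Y. z * (kgf Y B z x y * ?q y w) * u w)"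
    unfolding q by (simp add: right_diff_distrib sum_subtractf sum_distrib_left mult_ac)
  also have "(\<Sum>y\<in>verts Y. \<Sum>w\<in>verts Y. z * (kgf Y B z x y * ?q y w) * u w)
     = (\<Sum>w\<in>verts Y. z * (\<Sum>y\<in>verts Y. kgf Y B z x y * ?q y w) * u w)"
    by (subst sum.swap) (simp add: sum_distrib_left sum_distrib_right)
  also have "(\<Sum>y\<in>verts Y. kgf Y B z x y * u y) - \<dots>
     = (\<Sum>w\<in>verts Y. (kgf Y B z x w - z * (\<Sum>y\<in>verts Y. kgf Y B z x y * ?q y w)) * u w)"
    by (simp add: left_diff_distrib sum_subtractf)
  also have "\<dots> = (\<Sum>w\<in>verts Y. of_bool (x = w) * u w)"
  proof -
    have "kgf Y B z x w - z * (\<Sum>y\<in>verts Y. kgf Y B z x y * ?q y w) = of_bool (x = w)" for w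
      by (subst conv_step_left[OF assms]) simp
    then show ?thesis by (simp only:)
  qed
  also have "\<dots> = u x" using fin assms(2) by (simp add: of_bool_def if_distrib[of "\<lambda>c. c * _"] cong: if_cong)
  finally show ?thesis by simp
qed

text \<open>For the constant 1, \<open>I - z Q\<close> yields 1 on \<open>B\<close> and
  \<open>1 - z\<close> elsewhere. The factor \<open>1 - z\<close> later exposes the derivative of
  \<open>d\<close> at 1.\<close>

lemma first_hit_const:
  assumes "conv z" "x \<in> verts Y"
  shows "1 = (1 - z) * (\<Sum>y\<in>verts Y - B. kgf Y B z x y) + (\<Sum>y\<in>B. kgf Y B z x y)"
proof -
  have "1 = (\<Sum>y\<in>verts Y. kgf Y B z x y * (1 - (if y \<in> B then 0 else z * avg Y (\<lambda>_. 1) y)))"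
    using first_hit[OF assms, of "\<lambda>_. 1"] .
  also have "\<dots> = (\<Sum>y\<in>verts Y. if y \<in> B then kgf Y B z x y else (1 - z) * kgf Y B z x y)"
    by (rule sum.cong) (auto simp: avg_const)
  also have "\<dots> = (\<Sum>y\<in>verts Y \<inter> B. kgf Y B z x y) + (\<Sum>y\<in>verts Y \<inter> - B. (1 - z) * kgf Y B z x y)"
    using fin by (simp add: sum.If_cases)
  also have "verts Y \<inter> B = B" using B_sub by blast
  also have "verts Y \<inter> - B = verts Y - B" by blast
  finally show ?thesis by (simp only: sum_distrib_left add.commute)
qed

lemma kgf_holomorphic:
  assumes "\<And>z. norm z < r \<Longrightarrow> conv z" "x \<in> verts Y"
  shows "(\<lambda>z. kgf Y B z x y) holomorphic_on ball 0 r"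
  by (rule power_series_holomorphic[where a = "\<lambda>n. of_real (kprob Y B n x y)"])
     (use assms in \<open>auto simp: kgf_def conv_def summable_sums\<close>)

text \<open>The zero entries outside \<open>verts Y\<close> match the normalisation of
  \<open>inverse_matrix_on\<close>; a two-sided inverse is then unique by associativity.\<close>

lemma inverse_matrix:
  assumes "conv z"
  shows "inverse_matrix_on (verts Y) (\<lambda>x y. of_bool (x = y) - z * of_real (kprob Y B (Suc 0) x y))
    = (\<lambda>x y. if x \<in> verts Y \<and> y \<in> verts Y then kgf Y B z x y else 0)"
proof -
  let ?V = "verts Y"
  define q where "q = (\<lambda>y w. complex_of_real (kprob Y B (Suc 0) y w))"
  have qavg: "avg Y u y = (\<Sum>w\<in>?V. q y w * u w)" if "y \<notin> B" for u y
    unfolding q_def by (rule avg_eq_sum[OF that])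
  have q0: "q y w = 0" if "y \<in> B" for y w using that by (simp add: q_def)
  have qleft: "kgf Y B z x y = of_bool (x = y) + z * (\<Sum>w\<in>?V. kgf Y B z x w * q w y)" if "x \<in> ?V" for x y
    unfolding q_def by (rule conv_step_left[OF assms that])
  let ?A = "\<lambda>x y. of_bool (x = y) - z * q x y"
  let ?N = "\<lambda>x y. if x \<in> ?V \<and> y \<in> ?V then kgf Y B z x y else 0"
  have diag: "(\<Sum>k\<in>?V. of_bool (x = k) * g k) = g x" "(\<Sum>k\<in>?V. g k * of_bool (k = x)) = g x"
    if "x \<in> ?V" for x and g :: "'a \<Rightarrow> complex"
    using fin that by (simp_all add: of_bool_def if_distrib[of "\<lambda>c. c * _"] if_distrib[of "\<lambda>c. _ * c"] cong: if_cong)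
  have right: "(\<Sum>k\<in>?V. ?A x k * ?N k y) = of_bool (x = y)" if "x \<in> ?V" "y \<in> ?V" for x y
  proof -
    have "(\<Sum>k\<in>?V. ?A x k * ?N k y) = (\<Sum>k\<in>?V. of_bool (x = k) * kgf Y B z k y) - z * (\<Sum>k\<in>?V. q x k * kgf Y B z k y)"
      using that by (simp add: algebra_simps sum_subtractf sum_distrib_left)
    also have "\<dots> = kgf Y B z x y - z * (\<Sum>k\<in>?V. q x k * kgf Y B z k y)" using diag(1)[OF that(1)] by simp
    also have "\<dots> = of_bool (x = y)"
    proof (cases "x \<in> B")
      case True
      then show ?thesis using conv_step[OF assms that(1), of y] q0 by simp
    next
      case False
      then show ?thesis using conv_step[OF assms that(1), of y] qavg[OF False, of "\<lambda>k. kgf Y B z k y"] by simp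
    qed
    finally show ?thesis .
  qed
  have left: "(\<Sum>k\<in>?V. ?N x k * ?A k y) = of_bool (x = y)" if "x \<in> ?V" "y \<in> ?V" for x y
  proof -
    have "(\<Sum>k\<in>?V. ?N x k * ?A k y) = (\<Sum>k\<in>?V. kgf Y B z x k * of_bool (k = y)) - z * (\<Sum>k\<in>?V. kgf Y B z x k * q k y)"
      using that by (simp add: algebra_simps sum_subtractf sum_distrib_left)
    then show ?thesis using diag(2)[OF that(2)] qleft[OF that(1), of y] by simp
  qed
  have "inverse_matrix_on ?V ?A = ?N" unfolding inverse_matrix_on_def
  proof (rule the_equality)
    show "(\<forall>x y. x \<notin> ?V \<or> y \<notin> ?V \<longrightarrow> ?N x y = 0) \<and>
      (\<forall>x\<in>?V. \<forall>y\<in>?V. (\<Sum>k\<in>?V. ?A x k * ?N k y) = of_bool (x = y)) \<and>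
      (\<forall>x\<in>?V. \<forall>y\<in>?V. (\<Sum>k\<in>?V. ?N x k * ?A k y) = of_bool (x = y))"
      using right left by auto
    fix M assume M: "(\<forall>x y. x \<notin> ?V \<or> y \<notin> ?V \<longrightarrow> M x y = 0) \<and>
      (\<forall>x\<in>?V. \<forall>y\<in>?V. (\<Sum>k\<in>?V. ?A x k * M k y) = of_bool (x = y)) \<and>
      (\<forall>x\<in>?V. \<forall>y\<in>?V. (\<Sum>k\<in>?V. M x k * ?A k y) = of_bool (x = y))"
    show "M = ?N"
    proof (intro ext)
      fix x y
      show "M x y = ?N x y"
      proof (cases "x \<in> ?V \<and> y \<in> ?V")
        case True
        have "M x y = (\<Sum>k\<in>?V. M x k * of_bool (k = y))" using diag(2) True by simp
        also have "\<dots> = (\<Sum>k\<in>?V. M x k * (\<Sum>j\<in>?V. ?A k j * ?N j y))"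
          by (rule sum.cong) (use right True in simp_all)
        also have "\<dots> = (\<Sum>j\<in>?V. (\<Sum>k\<in>?V. M x k * ?A k j) * ?N j y)"
          unfolding sum_distrib_left sum_distrib_right by (subst sum.swap) (simp add: mult.assoc)
        also have "\<dots> = (\<Sum>j\<in>?V. of_bool (x = j) * ?N j y)"
          by (rule sum.cong) (use M True in simp_all)
        also have "\<dots> = ?N x y" using diag(1) True by simp
        finally show ?thesis .
      qed (use M in auto)
    qed
  qed
  then show ?thesis by (simp only: q_def)
qed

end

section \<open>Transport along isomorphisms; networks with interchangeable boundary points\<close>

lemma graph_iso_neighbours:
  assumes "lf_graph Y" "lf_graph Y'" "graph_iso Y Y' \<phi>" "x \<in> verts Y"
  shows "neighbours Y' (\<phi> x) = \<phi> ` neighbours Y x" "inj_on \<phi> (neighbours Y x)"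
    "degree Y' (\<phi> x) = degree Y x"
proof -
  interpret Y: lf_graph Y by fact
  interpret Y': lf_graph Y' by fact
  have bij: "bij_betw \<phi> (verts Y) (verts Y')"
    and adj: "\<And>x y. x \<in> verts Y \<Longrightarrow> y \<in> verts Y \<Longrightarrow> adj Y x y \<longleftrightarrow> adj Y' (\<phi> x) (\<phi> y)"
    using assms(3) by (auto simp: graph_iso_def)
  show nb: "neighbours Y' (\<phi> x) = \<phi> ` neighbours Y x"
  proof (intro equalityI subsetI)
    fix y assume "y \<in> neighbours Y' (\<phi> x)"
    then have y: "adj Y' (\<phi> x) y" by (simp add: neighbours_def)
    then have "y \<in> verts Y'" using Y'.adj_vertsD by blast
    then obtain w where "w \<in> verts Y" "y = \<phi> w" using bij by (auto simp: bij_betw_def)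
    moreover from this have "adj Y x w" using adj[OF assms(4)] y by simp
    ultimately show "y \<in> \<phi> ` neighbours Y x" by (simp add: neighbours_def)
  next
    fix y assume "y \<in> \<phi> ` neighbours Y x"
    then obtain w where w: "y = \<phi> w" "adj Y x w" by (auto simp: neighbours_def)
    then have "adj Y' (\<phi> x) (\<phi> w)" using adj[OF assms(4)] Y.adj_vertsD(2) by blast
    then show "y \<in> neighbours Y' (\<phi> x)" using w(1) by (simp add: neighbours_def)
  qed
  show inj: "inj_on \<phi> (neighbours Y x)"
  proof (rule inj_on_subset)
    show "inj_on \<phi> (verts Y)" using bij by (simp add: bij_betw_def)
    show "neighbours Y x \<subseteq> verts Y" using Y.adj_vertsD(2) by (auto simp: neighbours_def)
  qed
  show "degree Y' (\<phi> x) = degree Y x" unfolding degree_def nb by (rule card_image[OF inj])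
qed

lemma graph_iso_avg:
  assumes "lf_graph Y" "lf_graph Y'" "graph_iso Y Y' \<phi>" "x \<in> verts Y"
  shows "avg Y' u (\<phi> x) = avg Y (\<lambda>w. u (\<phi> w)) x"
  unfolding avg_def graph_iso_neighbours(1,3)[OF assms]
  by (simp add: sum.reindex[OF graph_iso_neighbours(2)[OF assms]] o_def)

lemma graph_iso_kprob:
  assumes "lf_graph Y" "lf_graph Y'" "graph_iso Y Y' \<phi>" "x \<in> verts Y" "y \<in> verts Y"
  shows "kprob Y' {} n (\<phi> x) (\<phi> y) = kprob Y {} n x y"
  using assms(4)
proof (induction n arbitrary: x)
  case 0
  have "inj_on \<phi> (verts Y)" using assms(3) by (auto simp: graph_iso_def bij_betw_def)
  then show ?case using 0 assms(5) by (auto dest: inj_onD)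
next
  case (Suc n)
  have "avg Y (\<lambda>w. kprob Y' {} n (\<phi> w) (\<phi> y)) x = avg Y (\<lambda>w. kprob Y {} n w y) x"
  proof (rule avg_cong)
    fix w assume "w \<in> neighbours Y x"
    then have "w \<in> verts Y" using lf_graph.adj_vertsD[OF assms(1)] by (auto simp: neighbours_def)
    then show "kprob Y' {} n (\<phi> w) (\<phi> y) = kprob Y {} n w y" by (rule Suc.IH)
  qed
  then show ?case using graph_iso_avg[OF assms(1-3) Suc.prems, of "\<lambda>v. kprob Y' {} n v (\<phi> y)"] by simp
qed

lemma power_series_coeff_unique:
  fixes a b :: "nat \<Rightarrow> complex"
  assumes "summable (\<lambda>n. a n * (1/2) ^ n)" "summable (\<lambda>n. b n * (1/2) ^ n)"
    and "eventually (\<lambda>z. (\<Sum>n. a n * z ^ n) = (\<Sum>n. b n * z ^ n)) (nhds 0)"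
  shows "a = b"
proof -
  have "Abs_fps a = Abs_fps b"
  proof (rule eval_fps_eqD)
    have h: "(0::ereal) < ereal (norm (1/2 :: complex))" by (simp add: norm_divide)
    show "fps_conv_radius (Abs_fps a) > 0" "fps_conv_radius (Abs_fps b) > 0"
      unfolding fps_conv_radius_def
      using less_le_trans[OF h conv_radius_geI[OF assms(1)]] less_le_trans[OF h conv_radius_geI[OF assms(2)]]
      by simp_all
  qed (use assms(3) in \<open>simp add: eval_fps_def\<close>)
  then show ?thesis by (metis (no_types) ext fps_nth_Abs_fps)
qed

text \<open>
  Any two points of \<open>\<Theta>\<close> look alike to the random walk with no killing.
  The symmetries of \<open>Y\<close> need not map \<open>\<Theta>\<close> to itself; that the walk killed on \<open>\<Theta> - {x}\<close> is
  nevertheless symmetric in the points of \<open>\<Theta> - {x}\<close> is the content of \<open>killed_determined\<close>.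
\<close>

locale sym_net = lf_graph Y for Y :: "'a ugraph" +
  fixes \<Theta> :: "'a set" and \<theta> :: nat and \<gamma>0 \<gamma>1 :: "nat \<Rightarrow> real"
  assumes fin: "finite (verts Y)" and conn: "connected_graph Y"
    and \<Theta>_sub: "\<Theta> \<subseteq> verts Y" and card_\<Theta>: "card \<Theta> = \<theta>" and \<theta>_ge: "\<theta> \<ge> 2"
    and diag: "\<And>n x. x \<in> \<Theta> \<Longrightarrow> kprob Y {} n x x = \<gamma>0 n"
    and off_diag: "\<And>n x y. x \<in> \<Theta> \<Longrightarrow> y \<in> \<Theta> \<Longrightarrow> x \<noteq> y \<Longrightarrow> kprob Y {} n x y = \<gamma>1 n"
begin

lemma finite_\<Theta>: "finite \<Theta>"
  using \<Theta>_sub fin finite_subset by blast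

lemma card_remove: "x \<in> \<Theta> \<Longrightarrow> card (\<Theta> - {x}) = \<theta> - 1"
  using finite_\<Theta> card_\<Theta> by simp

lemma killed: "x \<in> \<Theta> \<Longrightarrow> killed_net Y (\<Theta> - {x})"
proof unfold_locales
  assume "x \<in> \<Theta>"
  then have "card (\<Theta> - {x}) > 0" using card_remove \<theta>_ge by simp
  then show "\<Theta> - {x} \<noteq> {}" by (metis card.empty less_irrefl)
qed (use fin conn \<Theta>_sub in auto)

definition g0 :: "complex \<Rightarrow> complex" where "g0 z = (\<Sum>n. of_real (\<gamma>0 n) * z ^ n)"
definition g1 :: "complex \<Rightarrow> complex" where "g1 z = (\<Sum>n. of_real (\<gamma>1 n) * z ^ n)"

lemma two_points: obtains x y where "x \<in> \<Theta>" "y \<in> \<Theta>" "x \<noteq> y"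
proof -
  have "card \<Theta> \<ge> 2" using card_\<Theta> \<theta>_ge by simp
  then obtain x y where "x \<in> \<Theta>" "y \<in> \<Theta>" "x \<noteq> y"
    by (metis (no_types, lifting) card_2_iff insert_subset obtain_subset_with_card_n)
  then show ?thesis by (rule that)
qed

lemma g_tendsto: "(g0 \<longlongrightarrow> 1) (at 0)" "(g1 \<longlongrightarrow> 0) (at 0)" "g0 0 = 1" "g1 0 = 0"
proof -
  obtain x y where xy: "x \<in> \<Theta>" "y \<in> \<Theta>" "x \<noteq> y" by (rule two_points)
  have 0: "\<gamma>0 0 = 1" "\<gamma>1 0 = 0" using diag[OF xy(1), of 0] off_diag[OF xy, of 0] xy(3) by auto
  have s: "(\<lambda>n. of_real (\<gamma>0 n) * z ^ n) sums g0 z" "(\<lambda>n. of_real (\<gamma>1 n) * z ^ n) sums g1 z" if "norm z < 1" for z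
    unfolding g0_def g1_def
    using kgf_summable[OF that, of Y "{}" x x] kgf_summable[OF that, of Y "{}" x y] diag[OF xy(1)] off_diag[OF xy]
    by (auto intro: summable_sums)
  show "(g0 \<longlongrightarrow> 1) (at 0)" "(g1 \<longlongrightarrow> 0) (at 0)"
    using powser_limit_0[of 1 "\<lambda>n. complex_of_real (\<gamma>0 n)" g0] powser_limit_0[of 1 "\<lambda>n. complex_of_real (\<gamma>1 n)" g1] s 0 by auto
  show "g0 0 = 1" "g1 0 = 0" unfolding g0_def g1_def by (simp_all add: powser_zero 0)
qed

text \<open>At 0 the Green kernel is the identity matrix, \<open>g0 = 1\<close> and
  \<open>g1 = 0\<close>, so the denominators in \<open>killed_determined\<close> do not vanish
  nearby.\<close>

lemma eventually_generic:
  "eventually (\<lambda>z. norm z < 1 \<and> g0 z \<noteq> g1 z \<and> g0 z + of_nat (\<theta> - 2) * g1 z \<noteq> 0) (nhds 0)"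
proof -
  have 1: "eventually (\<lambda>z::complex. norm z < 1) (nhds 0)"
    using eventually_nhds_in_open[of "ball 0 1" "0::complex"] by simp
  have "((\<lambda>z. g0 z - g1 z) \<longlongrightarrow> 1 - 0) (at 0)" by (intro tendsto_intros g_tendsto)
  then have "eventually (\<lambda>z. g0 z - g1 z \<noteq> 0) (at 0)" by (rule tendsto_imp_eventually_ne) simp
  then have 2: "eventually (\<lambda>z. g0 z \<noteq> g1 z) (nhds 0)"
    using g_tendsto(3,4) by (auto simp: eventually_at_filter elim!: eventually_mono)
  have "((\<lambda>z. g0 z + of_nat (\<theta> - 2) * g1 z) \<longlongrightarrow> 1 + of_nat (\<theta> - 2) * 0) (at 0)"
    by (intro tendsto_intros g_tendsto)
  then have "eventually (\<lambda>z. g0 z + of_nat (\<theta> - 2) * g1 z \<noteq> 0) (at 0)"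
    by (rule tendsto_imp_eventually_ne) simp
  then have 3: "eventually (\<lambda>z. g0 z + of_nat (\<theta> - 2) * g1 z \<noteq> 0) (nhds 0)"
    using g_tendsto(3,4) by (auto simp: eventually_at_filter elim!: eventually_mono)
  show ?thesis using 1 2 3 by eventually_elim auto
qed

lemma kgf_diag: "x \<in> \<Theta> \<Longrightarrow> kgf Y {} z x x = g0 z"
  by (simp add: kgf_def g0_def diag)

lemma kgf_off_diag: "x \<in> \<Theta> \<Longrightarrow> y \<in> \<Theta> \<Longrightarrow> x \<noteq> y \<Longrightarrow> kgf Y {} z x y = g1 z"
  by (simp add: kgf_def g1_def off_diag)

text \<open>Decomposing the Green kernel without absorption at the first visit to
  \<open>\<Theta> - {x}\<close> gives one linear equation for each point of \<open>\<Theta>\<close>.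
  The coefficients are only \<open>g0\<close> and \<open>g1\<close>, so the solution cannot
  distinguish the points \<open>w\<close>. \<open>D\<close> is the sum of the unknown entries over
  \<open>\<Theta> - {x}\<close>.\<close>

lemma killed_determined:
  assumes x: "x \<in> \<Theta>" and w: "w \<in> \<Theta> - {x}"
    and z: "norm z < 1" "g0 z \<noteq> g1 z" "g0 z + of_nat (\<theta> - 2) * g1 z \<noteq> 0"
  defines "D \<equiv> of_nat (\<theta> - 1) * g1 z / (g0 z + of_nat (\<theta> - 2) * g1 z)"
  shows "kgf Y (\<Theta> - {x}) z x w = g1 z * (1 - D) / (g0 z - g1 z)"
    and "kgf Y (\<Theta> - {x}) z x x = g0 z - D * g1 z"
proof -
  let ?B = "\<Theta> - {x}" and ?N = "kgf Y (\<Theta> - {x}) z x"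
  interpret K: killed_net Y ?B by (rule killed[OF x])
  have xV: "x \<in> verts Y" using x \<Theta>_sub by blast
  have hit: "kgf Y {} z x y = (\<Sum>v\<in>?B. ?N v * kgf Y {} z v y) + (if y = x then ?N x else 0)" if y: "y \<in> \<Theta>" for y
  proof -
    have "kgf Y {} z x y = (\<Sum>v\<in>verts Y. ?N v * (kgf Y {} z v y - (if v \<in> ?B then 0 else z * avg Y (\<lambda>v. kgf Y {} z v y) v)))"
      by (rule K.first_hit[OF K.conv_less_1[OF z(1)] xV])
    also have "\<dots> = (\<Sum>v\<in>verts Y. if v \<in> ?B then ?N v * kgf Y {} z v y else ?N v * of_bool (v = y))"
    proof (rule sum.cong)
      fix v
      have "kgf Y {} z v y - z * avg Y (\<lambda>v. kgf Y {} z v y) v = of_bool (v = y)"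
        using kgf_step[OF z(1), of Y "{}" v y] by simp
      then show "?N v * (kgf Y {} z v y - (if v \<in> ?B then 0 else z * avg Y (\<lambda>v. kgf Y {} z v y) v))
        = (if v \<in> ?B then ?N v * kgf Y {} z v y else ?N v * of_bool (v = y))" by simp
    qed simp
    also have "\<dots> = (\<Sum>v\<in>verts Y \<inter> ?B. ?N v * kgf Y {} z v y) + (\<Sum>v\<in>verts Y \<inter> - ?B. ?N v * of_bool (v = y))"
      using sum.If_cases[OF fin, of "\<lambda>v. v \<in> ?B"] by (simp only: Collect_mem_eq)
    also have "verts Y \<inter> ?B = ?B" using \<Theta>_sub by blast
    also have "(\<Sum>v\<in>verts Y \<inter> - ?B. ?N v * of_bool (v = y)) = (if y = x then ?N x else 0)"
    proof -
      have "(\<Sum>v\<in>verts Y \<inter> - ?B. ?N v * of_bool (v = y)) = (\<Sum>v\<in>verts Y \<inter> - ?B. if v = y then ?N v else 0)"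
        by (rule sum.cong) auto
      also have "\<dots> = (if y \<in> verts Y \<inter> - ?B then ?N y else 0)" using fin by simp
      finally show ?thesis using y \<Theta>_sub by auto
    qed
    finally show ?thesis .
  qed
  define S where "S = (\<Sum>v\<in>?B. ?N v)"
  have hx: "g0 z = S * g1 z + ?N x"
  proof -
    have "(\<Sum>v\<in>?B. ?N v * kgf Y {} z v x) = (\<Sum>v\<in>?B. ?N v * g1 z)"
      by (rule sum.cong) (use x in \<open>auto simp: kgf_off_diag\<close>)
    then show ?thesis using hit[OF x] by (simp add: kgf_diag[OF x] S_def sum_distrib_right)
  qed
  have hw: "g1 z = ?N y * (g0 z - g1 z) + S * g1 z" if y: "y \<in> ?B" for y
  proof -
    have "(\<Sum>v\<in>?B. ?N v * kgf Y {} z v y) = ?N y * g0 z + (\<Sum>v\<in>?B - {y}. ?N v * kgf Y {} z v y)"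
      using y finite_\<Theta> by (subst sum.remove[of _ y]) (auto simp: kgf_diag)
    also have "(\<Sum>v\<in>?B - {y}. ?N v * kgf Y {} z v y) = (\<Sum>v\<in>?B - {y}. ?N v * g1 z)"
      by (rule sum.cong) (use y in \<open>auto simp: kgf_off_diag\<close>)
    also have "\<dots> = (S - ?N y) * g1 z"
      using y finite_\<Theta> by (simp add: S_def sum_distrib_right[symmetric] sum.remove[of ?B y])
    finally show ?thesis using hit[of y] y x by (auto simp: kgf_off_diag algebra_simps)
  qed
  \<comment> \<open>Summing over \<open>\<Theta> - {x}\<close> determines the total
    \<open>S\<close>, after which each entry follows from \<open>hw\<close>.\<close>
  have "(\<Sum>y\<in>?B. g1 z) = (\<Sum>y\<in>?B. ?N y * (g0 z - g1 z) + S * g1 z)"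
    by (rule sum.cong[OF refl]) (rule hw)
  then have "of_nat (\<theta> - 1) * g1 z = (\<Sum>y\<in>?B. ?N y * (g0 z - g1 z) + S * g1 z)"
    using card_remove[OF x] by simp
  also have "\<dots> = S * (g0 z - g1 z) + of_nat (\<theta> - 1) * (S * g1 z)"
    using card_remove[OF x] by (simp add: sum.distrib S_def sum_distrib_right)
  also have "of_nat (\<theta> - 1) = (1 + of_nat (\<theta> - 2) :: complex)"
    using \<theta>_ge by (simp add: of_nat_diff)
  finally have "of_nat (\<theta> - 1) * g1 z = S * (g0 z + of_nat (\<theta> - 2) * g1 z)"
    using \<theta>_ge by (simp add: of_nat_diff algebra_simps)
  then have S: "S = D" unfolding D_def using z(3) by (simp add: field_simps)
  show "?N x = g0 z - D * g1 z" using hx unfolding S by (simp add: algebra_simps)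
  have "?N w * (g0 z - g1 z) = g1 z * (1 - D)" using hw[OF w] unfolding S by (simp add: algebra_simps)
  then show "?N w = g1 z * (1 - D) / (g0 z - g1 z)" using z(2) by (simp add: field_simps)
qed

end

text \<open>The generating functions agree near 0 for any two networks with the same
  \<open>\<gamma>0\<close> and \<open>\<gamma>1\<close>, hence so do their coefficients. This
  compares different points as well as different cells.\<close>

lemma sym_net_killed_eq:
  assumes "sym_net Y \<Theta> \<theta> \<gamma>0 \<gamma>1" "sym_net Y' \<Theta>' \<theta> \<gamma>0 \<gamma>1"
    and "x \<in> \<Theta>" "w \<in> \<Theta> - {x}" "x' \<in> \<Theta>'" "w' \<in> \<Theta>' - {x'}"
  shows "kprob Y (\<Theta> - {x}) n x w = kprob Y' (\<Theta>' - {x'}) n x' w'"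
    and "kprob Y (\<Theta> - {x}) n x x = kprob Y' (\<Theta>' - {x'}) n x' x'"
proof -
  interpret A: sym_net Y \<Theta> \<theta> \<gamma>0 \<gamma>1 by fact
  interpret B: sym_net Y' \<Theta>' \<theta> \<gamma>0 \<gamma>1 by fact
  have g: "A.g0 = B.g0" "A.g1 = B.g1" unfolding A.g0_def B.g0_def A.g1_def B.g1_def by (rule refl)+
  have half: "norm (1/2 :: complex) < 1" by (simp add: norm_divide)
  have ev1: "eventually (\<lambda>z. kgf Y (\<Theta> - {x}) z x w = kgf Y' (\<Theta>' - {x'}) z x' w') (nhds 0)"
    using A.eventually_generic
    by eventually_elim (use A.killed_determined(1)[OF assms(3,4)] B.killed_determined(1)[OF assms(5,6)] g in auto)
  have ev2: "eventually (\<lambda>z. kgf Y (\<Theta> - {x}) z x x = kgf Y' (\<Theta>' - {x'}) z x' x') (nhds 0)"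
    using A.eventually_generic
    by eventually_elim (use A.killed_determined(2)[OF assms(3,4)] B.killed_determined(2)[OF assms(5,6)] g in auto)
  have "(\<lambda>n. complex_of_real (kprob Y (\<Theta> - {x}) n x w)) = (\<lambda>n. complex_of_real (kprob Y' (\<Theta>' - {x'}) n x' w'))"
    using ev1 unfolding kgf_def by (intro power_series_coeff_unique kgf_summable half)
  then show "kprob Y (\<Theta> - {x}) n x w = kprob Y' (\<Theta>' - {x'}) n x' w'" by (metis of_real_eq_iff)
  have "(\<lambda>n. complex_of_real (kprob Y (\<Theta> - {x}) n x x)) = (\<lambda>n. complex_of_real (kprob Y' (\<Theta>' - {x'}) n x' x'))"
    using ev2 unfolding kgf_def by (intro power_series_coeff_unique kgf_summable half)
  then show "kprob Y (\<Theta> - {x}) n x x = kprob Y' (\<Theta>' - {x'}) n x' x'" by (metis of_real_eq_iff)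
qed

text \<open>With the coefficients of a cell, these are the functions \<open>d\<close> and \<open>f\<close> of the renewal equation.\<close>

definition hit_gf :: "nat \<Rightarrow> (nat \<Rightarrow> real) \<Rightarrow> complex \<Rightarrow> complex" where
  "hit_gf \<theta> a z = of_nat (\<theta> - 1) * (\<Sum>n. of_real (a n) * z ^ n)"

definition return_gf :: "(nat \<Rightarrow> real) \<Rightarrow> complex \<Rightarrow> complex" where
  "return_gf b z = (\<Sum>n. of_real (b n) * z ^ n)"

section \<open>Transition and return functions of a cell, and their values at 1\<close>

text \<open>The coefficient sequences are parameters, so that one pair of functions \<open>d\<close>
  and \<open>f\<close> can be shared by all cells.\<close>

locale hitting_net = sym_net +
  fixes a b :: "nat \<Rightarrow> real" and \<delta>0 :: nat
  assumes indep: "\<And>x y. x \<in> \<Theta> \<Longrightarrow> y \<in> \<Theta> \<Longrightarrow> \<not> adj Y x y"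
    and deg_\<Theta>: "\<And>x. x \<in> \<Theta> \<Longrightarrow> degree Y x = \<delta>0"
    and hit: "\<And>x w n. x \<in> \<Theta> \<Longrightarrow> w \<in> \<Theta> - {x} \<Longrightarrow> kprob Y (\<Theta> - {x}) n x w = a n"
    and ret: "\<And>x n. x \<in> \<Theta> \<Longrightarrow> kprob Y (\<Theta> - {x}) n x x = b n"
begin

lemma kgf_hit: "x \<in> \<Theta> \<Longrightarrow> w \<in> \<Theta> - {x} \<Longrightarrow> kgf Y (\<Theta> - {x}) z x w = (\<Sum>n. of_real (a n) * z ^ n)"
  unfolding kgf_def by (subst hit) auto

lemma kgf_ret: "x \<in> \<Theta> \<Longrightarrow> kgf Y (\<Theta> - {x}) z x x = return_gf b z"
  unfolding kgf_def return_gf_def by (subst ret) auto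

lemma sum_kgf_hit:
  assumes "x \<in> \<Theta>" shows "(\<Sum>w\<in>\<Theta> - {x}. kgf Y (\<Theta> - {x}) z x w) = hit_gf \<theta> a z"
proof -
  have "(\<Sum>w\<in>\<Theta> - {x}. kgf Y (\<Theta> - {x}) z x w) = (\<Sum>w\<in>\<Theta> - {x}. \<Sum>n. of_real (a n) * z ^ n)"
    by (rule sum.cong[OF refl kgf_hit[OF assms]])
  then show ?thesis using card_remove[OF assms] by (simp add: hit_gf_def)
qed

lemma \<theta>_1: "of_nat (\<theta> - 1) \<noteq> (0 :: complex)"
  using \<theta>_ge by simp

text \<open>\<open>first_hit\<close> for a function without sources off \<open>\<Theta>\<close>:
  what survives is the source at \<open>x\<close>, weighted by the returns to \<open>x\<close>, and
  the values at the other boundary points.\<close>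

lemma first_hit_\<Theta>:
  assumes x: "x \<in> \<Theta>" and z: "norm z < 1"
    and u: "\<And>y. y \<in> verts Y - \<Theta> \<Longrightarrow> u y = z * avg Y u y"
  shows "u x = return_gf b z * (u x - z * avg Y u x)
    + hit_gf \<theta> a z / of_nat (\<theta> - 1) * (\<Sum>w\<in>\<Theta> - {x}. u w)"
proof -
  let ?B = "\<Theta> - {x}" and ?N = "kgf Y (\<Theta> - {x}) z x"
  interpret K: killed_net Y ?B by (rule killed[OF x])
  have xV: "x \<in> verts Y" using x \<Theta>_sub by blast
  have "u x = (\<Sum>y\<in>verts Y. ?N y * (u y - (if y \<in> ?B then 0 else z * avg Y u y)))"
    by (rule K.first_hit[OF K.conv_less_1[OF z] xV])
  also have "\<dots> = (\<Sum>y\<in>verts Y - \<Theta>. ?N y * (u y - (if y \<in> ?B then 0 else z * avg Y u y)))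
     + (\<Sum>y\<in>\<Theta>. ?N y * (u y - (if y \<in> ?B then 0 else z * avg Y u y)))"
    by (rule sum.subset_diff[OF \<Theta>_sub fin])
  also have "(\<Sum>y\<in>verts Y - \<Theta>. ?N y * (u y - (if y \<in> ?B then 0 else z * avg Y u y))) = 0"
    by (rule sum.neutral) (use u in auto)
  also have "(\<Sum>y\<in>\<Theta>. ?N y * (u y - (if y \<in> ?B then 0 else z * avg Y u y)))
     = ?N x * (u x - z * avg Y u x) + (\<Sum>y\<in>?B. ?N y * u y)"
    by (subst sum.remove[OF finite_\<Theta> x]) simp
  also have "(\<Sum>y\<in>?B. ?N y * u y) = (\<Sum>y\<in>?B. (\<Sum>n. of_real (a n) * z ^ n) * u y)"
    by (rule sum.cong) (use kgf_hit[OF x] in auto)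
  also have "\<dots> = hit_gf \<theta> a z / of_nat (\<theta> - 1) * (\<Sum>w\<in>?B. u w)"
    using \<theta>_1 by (simp add: hit_gf_def sum_distrib_left)
  finally show ?thesis using kgf_ret[OF x] by simp
qed

text \<open>The degrees form a stationary measure of the walk.\<close>

lemma sum_degree_avg: "(\<Sum>y\<in>verts Y. of_nat (degree Y y) * avg Y u y) = (\<Sum>y\<in>verts Y. of_nat (degree Y y) * (u y :: complex))"
proof -
  have nb: "neighbours Y y \<subseteq> verts Y" for y using adj_vertsD by (auto simp: neighbours_def)
  have "of_nat (degree Y y) * avg Y u y = (\<Sum>w\<in>verts Y. if adj Y y w then u w else 0)" for y
  proof -
    have "of_nat (degree Y y) * avg Y u y = (\<Sum>w\<in>neighbours Y y. u w)"
      using finite_neighbours[of y] by (cases "degree Y y = 0") (auto simp: avg_def degree_def)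
    also have "\<dots> = (\<Sum>w\<in>verts Y. if w \<in> neighbours Y y then u w else 0)"
      using fin nb[of y] by (simp add: sum.If_cases Int_absorb1)
    finally show ?thesis by (simp add: neighbours_def)
  qed
  then have "(\<Sum>y\<in>verts Y. of_nat (degree Y y) * avg Y u y) = (\<Sum>y\<in>verts Y. \<Sum>w\<in>verts Y. if adj Y y w then u w else 0)"
    by (simp only:)
  also have "\<dots> = (\<Sum>w\<in>verts Y. \<Sum>y\<in>verts Y. if adj Y y w then u w else 0)" by (rule sum.swap)
  also have "\<dots> = (\<Sum>w\<in>verts Y. of_nat (degree Y w) * u w)"
  proof (rule sum.cong)
    fix w
    have "verts Y \<inter> {y. adj Y y w} = neighbours Y w" using nb[of w] adj_sym[of Y] by (auto simp: neighbours_def)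
    then show "(\<Sum>y\<in>verts Y. if adj Y y w then u w else 0) = of_nat (degree Y w) * u w"
      using fin by (simp add: sum.If_cases degree_def)
  qed simp
  finally show ?thesis .
qed

text \<open>The coefficients are nonnegative, there is no constant term and the value at 1 is 1;
  hence the modulus is at most \<open>norm z\<close>.\<close>

lemma norm_hit_gf_less_1:
  assumes "summable a" "hit_gf \<theta> a 1 = 1" "norm z < 1"
  shows "norm (hit_gf \<theta> a z) < 1"
proof -
  obtain x w where xw: "x \<in> \<Theta>" "w \<in> \<Theta> - {x}" using two_points by (metis Diff_iff singletonD)
  have a0: "a n \<ge> 0" "a 0 = 0" for n
    using kprob_nonneg[of Y "\<Theta> - {x}" n x w] hit[OF xw, of n] hit[OF xw, of 0] xw(2) by auto
  have "complex_of_real (suminf a) * of_nat (\<theta> - 1) = 1"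
    using assms(2) suminf_of_real[OF assms(1), where 'a = complex] by (simp add: hit_gf_def mult.commute)
  then have s1: "suminf a * real (\<theta> - 1) = 1" by (metis of_real_1 of_real_eq_iff of_real_mult of_real_of_nat_eq)
  have bnd: "norm (of_real (a n) * z ^ n) \<le> a n * norm z" for n
  proof (cases n)
    case (Suc m)
    have "norm z ^ Suc m \<le> norm z" using assms(3) power_decreasing[of 1 "Suc m" "norm z"] by simp
    then show ?thesis using Suc a0(1)[of n] by (simp add: norm_mult norm_power mult_left_mono)
  qed (simp add: a0)
  have "norm (\<Sum>n. of_real (a n) * z ^ n) \<le> (\<Sum>n. a n * norm z)"
    by (rule norm_suminf_le[OF bnd summable_mult2[OF assms(1)]])
  also have "\<dots> = suminf a * norm z" by (rule suminf_mult2[OF assms(1), symmetric])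
  finally have "norm (hit_gf \<theta> a z) \<le> real (\<theta> - 1) * (suminf a * norm z)"
    by (simp add: hit_gf_def norm_mult mult_left_mono)
  also have "\<dots> = (suminf a * real (\<theta> - 1)) * norm z" by (simp only: mult_ac)
  also have "\<dots> = norm z" unfolding s1 by simp
  finally show ?thesis using assms(3) by linarith
qed

text \<open>\<open>T\<close> generates the visits before absorption on
  \<open>\<Theta> - {x}\<close>; its value at 1 is the expected absorption time, and the
  factorisation shows that this is the derivative of \<open>d\<close> at 1.\<close>

lemma transition_data:
  assumes x: "x \<in> \<Theta>"
  obtains r T where "r > 1" "\<And>z. norm z < r \<Longrightarrow> killed_net.conv Y (\<Theta> - {x}) z"
    "T holomorphic_on ball 0 r" "\<And>z. norm z < r \<Longrightarrow> 1 - hit_gf \<theta> a z = (1 - z) * T z"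
    "T = (\<lambda>z. \<Sum>y\<in>verts Y - (\<Theta> - {x}). kgf Y (\<Theta> - {x}) z x y)"
proof -
  let ?B = "\<Theta> - {x}"
  interpret K: killed_net Y ?B by (rule killed[OF x])
  have xV: "x \<in> verts Y" using x \<Theta>_sub by blast
  obtain r where r: "r > 1" "\<And>x y z. x \<in> verts Y \<Longrightarrow> norm z < r \<Longrightarrow> summable (\<lambda>n. of_real (kprob Y ?B n x y) * z ^ n :: complex)"
    using K.convergence_radius by metis
  have c: "K.conv z" if "norm z < r" for z using r(2) that by (simp add: K.conv_def)
  define T where "T = (\<lambda>z. \<Sum>y\<in>verts Y - ?B. kgf Y ?B z x y)"
  show ?thesis
  proof (rule that[OF r(1) c _ _ T_def])
    show "T holomorphic_on ball 0 r" unfolding T_def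
      by (intro holomorphic_on_sum K.kgf_holomorphic c xV)
    show "1 - hit_gf \<theta> a z = (1 - z) * T z" if "norm z < r" for z
      using K.first_hit_const[OF c[OF that] xV] sum_kgf_hit[OF x, of z] unfolding T_def by (simp only: diff_eq_eq)
  qed
qed

text \<open>The relation between \<open>\<tau>\<close> and \<open>f1\<close> evaluates in two ways
  the total source of an auxiliary function \<open>\<phi>\<close> that equals the constant
  \<open>f z\<close> on \<open>\<Theta>\<close> and has no source elsewhere. Its source at each
  point of \<open>\<Theta>\<close> is \<open>1 - d z\<close>; by stationarity of the degrees, the
  weighted sum of the sources is also \<open>1 - z\<close> times the weighted sum of
  \<open>\<phi>\<close>. Division by \<open>1 - z\<close> and passage to 1, where
  \<open>\<phi>\<close> becomes the constant \<open>f1\<close>, give the relation.\<close>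

lemma transition_at_1:
  obtains r \<tau> f1 where "r > 1" "\<tau> \<ge> 2" "f1 > 0" "summable a"
    "hit_gf \<theta> a holomorphic_on ball 0 r" "return_gf b holomorphic_on ball 0 r"
    "hit_gf \<theta> a 1 = 1" "(hit_gf \<theta> a has_field_derivative of_real \<tau>) (at 1)"
    "return_gf b 1 = of_real f1" "real \<theta> * real \<delta>0 * \<tau> = f1 * (\<Sum>y\<in>verts Y. real (degree Y y))"
    "\<forall>z\<in>ball 0 r. hit_gf \<theta> a (cnj z) = cnj (hit_gf \<theta> a z)"
proof -
  obtain x w0 where xw0: "x \<in> \<Theta>" "w0 \<in> \<Theta> - {x}" using two_points by (metis Diff_iff singletonD)
  note x = xw0(1)
  let ?B = "\<Theta> - {x}"
  interpret K: killed_net Y ?B by (rule killed[OF x])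
  have xV: "x \<in> verts Y" using x \<Theta>_sub by blast
  obtain r T where r: "r > 1" "\<And>z. norm z < r \<Longrightarrow> K.conv z"
    "T holomorphic_on ball 0 r" "\<And>z. norm z < r \<Longrightarrow> 1 - hit_gf \<theta> a z = (1 - z) * T z"
    "T = (\<lambda>z. \<Sum>y\<in>verts Y - ?B. kgf Y ?B z x y)"
    by (rule transition_data[OF x]) blast
  let ?d = "hit_gf \<theta> a" and ?f = "return_gf b"
  have d_hol: "?d holomorphic_on ball 0 r"
  proof -
    have "(\<lambda>z. \<Sum>w\<in>?B. kgf Y ?B z x w) holomorphic_on ball 0 r"
      by (intro holomorphic_on_sum K.kgf_holomorphic r(2) xV)
    then show ?thesis unfolding sum_kgf_hit[OF x] .
  qed
  have f_hol: "?f holomorphic_on ball 0 r"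
    using K.kgf_holomorphic[OF r(2) xV, of r x] unfolding kgf_ret[OF x] .
  have one: "norm (1::complex) < r" "(1::complex) \<in> ball 0 r" using r(1) by auto
  have d1: "?d 1 = 1" using r(4)[OF one(1)] by simp
  define t where "t = (\<lambda>y. \<Sum>n. kprob Y ?B n x y)"
  have sm: "summable (\<lambda>n. kprob Y ?B n x y)" for y
  proof -
    have "summable (\<lambda>n. of_real (kprob Y ?B n x y) * 1 ^ n :: complex)"
      using r(2)[OF one(1)] xV unfolding K.conv_def by blast
    then show ?thesis by (simp add: summable_of_real_iff)
  qed
  have t: "kgf Y ?B 1 x y = of_real (t y)" for y
    unfolding kgf_def t_def by (simp add: suminf_of_real[OF sm])
  define \<tau> where "\<tau> = (\<Sum>y\<in>verts Y - ?B. t y)"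
  have T1: "T 1 = of_real \<tau>" by (simp add: r(5) t \<tau>_def)
  have deriv: "(?d has_field_derivative of_real \<tau>) (at 1)"
  proof (rule has_field_derivative_transform_within_open[of "\<lambda>z. 1 - (1 - z) * T z" _ _ "ball 0 r"])
    obtain T' where "(T has_field_derivative T') (at 1)"
      using holomorphic_derivI[OF r(3) open_ball one(2)] by blast
    then show "((\<lambda>z. 1 - (1 - z) * T z) has_field_derivative of_real \<tau>) (at 1)"
      by (auto intro!: derivative_eq_intros simp: T1)
    show "1 - (1 - z) * T z = ?d z" if "z \<in> ball 0 r" for z using r(4)[of z] that by (simp add: algebra_simps)
  qed (use one in auto)
  \<comment> \<open>Boundary points are pairwise non-adjacent, so the walk cannot be absorbed before
    time 2: the terms for \<open>n = 0\<close> and \<open>n = 1\<close> each contribute 1.\<close>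
  have "2 \<le> \<tau>"
  proof -
    have two: "kprob Y ?B 0 x y + kprob Y ?B (Suc 0) x y \<le> t y" for y
    proof -
      have "(\<Sum>n<2. kprob Y ?B n x y) \<le> t y"
        unfolding t_def by (rule sum_le_suminf[OF sm]) (auto simp: kprob_nonneg)
      then show ?thesis by (simp add: numeral_2_eq_2 del: kprob.simps)
    qed
    have fD: "finite (verts Y - ?B)" using fin by simp
    have "(\<Sum>y\<in>verts Y - ?B. kprob Y ?B 0 x y) = 1"
    proof -
      have "(\<Sum>y\<in>verts Y - ?B. kprob Y ?B 0 x y) = (\<Sum>y\<in>verts Y - ?B. if y = x then 1 else 0)"
        by (rule sum.cong) auto
      then show ?thesis using fD xV by simp
    qed
    moreover have "(\<Sum>y\<in>verts Y - ?B. kprob Y ?B (Suc 0) x y) = 1"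
    proof -
      have nb: "neighbours Y x \<subseteq> verts Y - ?B" using K.neighbours_sub[of x] indep[OF x] by (auto simp: neighbours_def)
      have "(\<Sum>y\<in>verts Y - ?B. kprob Y ?B (Suc 0) x y) = (\<Sum>y\<in>verts Y - ?B. if y \<in> neighbours Y x then 1 / real (degree Y x) else 0)"
        unfolding K.kprob_Suc_0 by (rule sum.cong) (auto simp: neighbours_def)
      also have "\<dots> = real (card (neighbours Y x)) * (1 / real (degree Y x))"
        using fD nb by (simp add: sum.If_cases Int_absorb1)
      finally show ?thesis using K.degree_pos[OF xV] by (simp add: degree_def)
    qed
    ultimately have "2 = (\<Sum>y\<in>verts Y - ?B. kprob Y ?B 0 x y + kprob Y ?B (Suc 0) x y)" by (simp only: sum.distrib)
    also have "\<dots> \<le> \<tau>" unfolding \<tau>_def by (rule sum_mono) (rule two)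
    finally show ?thesis .
  qed
  have f1: "?f 1 = of_real (t x)" using kgf_ret[OF x, of 1] t by simp
  have b_nonneg: "b n \<ge> 0" and b0: "b 0 = 1" for n
    using kprob_nonneg[of Y ?B n x x] ret[OF x, of n] ret[OF x, of 0] by auto
  have tx: "t x \<ge> 1"
  proof -
    have "(\<Sum>n<1. kprob Y ?B n x x) \<le> t x"
      unfolding t_def by (rule sum_le_suminf[OF sm]) (auto simp: kprob_nonneg)
    then show ?thesis by simp
  qed
  \<comment> \<open>The coefficients are nonnegative and \<open>b 0 = 1\<close>; this allows
    \<open>f\<close> to be cancelled in \<open>src\<close>.\<close>
  have f_ne: "?f (of_real s) \<noteq> 0" if s: "0 < s" "s < 1" for s :: real
  proof -
    have 1: "summable (\<lambda>n. b n * s ^ n)"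
    proof -
      have "summable (\<lambda>n. of_real (kprob Y ?B n x x) * (of_real s) ^ n :: complex)" using s by (intro kgf_summable) simp
      then show ?thesis unfolding ret[OF x] by (simp flip: of_real_power of_real_mult add: summable_of_real_iff)
    qed
    have "(\<Sum>n<1. b n * s ^ n) \<le> (\<Sum>n. b n * s ^ n)"
      by (rule sum_le_suminf[OF 1]) (use s b_nonneg in auto)
    moreover have "?f (of_real s) = of_real (\<Sum>n. b n * s ^ n)"
      unfolding return_gf_def by (simp flip: of_real_power of_real_mult add: suminf_of_real[OF 1])
    ultimately show ?thesis using b0 by auto
  qed
  \<comment> \<open>The weights make the value at \<open>x\<close> agree with the value
    \<open>f\<close> on \<open>\<Theta> - {x}\<close>: there it is
    \<open>f * (1 - d) + f * d\<close>.\<close>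
  define \<phi> where "\<phi> = (\<lambda>z y. kgf Y ?B z y x * (1 - ?d z) + ?f z * (\<Sum>w\<in>?B. kgf Y ?B z y w))"
  define P where "P = (\<lambda>z. of_nat \<theta> * of_nat \<delta>0 * T z)"
  define Q where "Q = (\<lambda>z. \<Sum>y\<in>verts Y. of_nat (degree Y y) * \<phi> z y)"
  have balance: "P (of_real s) = Q (of_real s)" if s: "0 < s" "s < 1" for s
  proof -
    let ?z = "complex_of_real s"
    have z: "norm ?z < 1" "norm ?z < r" using s r(1) by auto
    let ?\<phi> = "\<phi> ?z"
    have step: "kgf Y ?B ?z v y = of_bool (v = y) + (if v \<in> ?B then 0 else ?z * avg Y (\<lambda>w. kgf Y ?B ?z w y) v)" for v y
      by (rule kgf_step[OF z(1)])
    have on_B: "?\<phi> y = ?f ?z" if y: "y \<in> ?B" for y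
    proof -
      have k: "kgf Y ?B ?z y v = of_bool (y = v)" for v using step[of y v] y by simp
      have "(\<Sum>w\<in>?B. kgf Y ?B ?z y w) = (\<Sum>w\<in>?B. if w = y then 1 else 0)" unfolding k by (rule sum.cong) auto
      also have "\<dots> = 1" using y finite_\<Theta> by simp
      finally show ?thesis using k[of x] y by (simp add: \<phi>_def)
    qed
    have on_x: "?\<phi> x = ?f ?z"
      unfolding \<phi>_def kgf_ret[OF x] sum_kgf_hit[OF x] by (simp add: algebra_simps)
    have on_\<Theta>: "?\<phi> y = ?f ?z" if "y \<in> \<Theta>" for y using on_B on_x that by (cases "y = x") auto
    have harm: "?\<phi> y = ?z * avg Y ?\<phi> y" if y: "y \<in> verts Y - \<Theta>" for y
    proof -
      have k: "kgf Y ?B ?z y v = ?z * avg Y (\<lambda>w. kgf Y ?B ?z w v) y" if "v \<in> \<Theta>" for v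
        using step[of y v] y that by auto
      have gen: "?z * (p * c + f * (\<Sum>v\<in>?B. g v)) = ?z * p * c + f * (\<Sum>v\<in>?B. ?z * g v)" for p c f g
        by (simp add: sum_distrib_left distrib_left mult_ac)
      have "avg Y ?\<phi> y = avg Y (\<lambda>w. kgf Y ?B ?z w x) y * (1 - ?d ?z) + ?f ?z * (\<Sum>v\<in>?B. avg Y (\<lambda>w. kgf Y ?B ?z w v) y)"
        unfolding \<phi>_def by (simp add: avg_add avg_mult avg_sum mult.commute[of _ "1 - ?d ?z"])
      then have "?z * avg Y ?\<phi> y = ?z * avg Y (\<lambda>w. kgf Y ?B ?z w x) y * (1 - ?d ?z) + ?f ?z * (\<Sum>v\<in>?B. ?z * avg Y (\<lambda>w. kgf Y ?B ?z w v) y)"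
        by (simp only: gen)
      also have "(\<Sum>v\<in>?B. ?z * avg Y (\<lambda>w. kgf Y ?B ?z w v) y) = (\<Sum>v\<in>?B. kgf Y ?B ?z y v)"
        by (rule sum.cong) (use k in auto)
      also have "?z * avg Y (\<lambda>w. kgf Y ?B ?z w x) y = kgf Y ?B ?z y x" using k[OF x] by simp
      finally show ?thesis by (simp add: \<phi>_def)
    qed
    \<comment> \<open>The first-hit decomposition at \<open>w\<close> reads
      \<open>f = f * (source at w) + d * f\<close>.\<close>
    have src: "?\<phi> w - ?z * avg Y ?\<phi> w = 1 - ?d ?z" if w: "w \<in> \<Theta>" for w
    proof -
      have "(\<Sum>v\<in>\<Theta> - {w}. ?\<phi> v) = of_nat (\<theta> - 1) * ?f ?z"
        using sum.cong[OF refl, of "\<Theta> - {w}" ?\<phi> "\<lambda>_. ?f ?z"] on_\<Theta> card_remove[OF w] by simp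
      then have "?f ?z = ?f ?z * (?\<phi> w - ?z * avg Y ?\<phi> w) + ?d ?z * ?f ?z"
        using first_hit_\<Theta>[OF w z(1), of ?\<phi>] harm on_\<Theta>[OF w] \<theta>_1 by simp
      then have "?f ?z * (?\<phi> w - ?z * avg Y ?\<phi> w) = ?f ?z * (1 - ?d ?z)" by (simp add: algebra_simps)
      then show ?thesis using f_ne[OF s] by simp
    qed
    have "(\<Sum>y\<in>verts Y. of_nat (degree Y y) * (?\<phi> y - ?z * avg Y ?\<phi> y))
      = (\<Sum>y\<in>verts Y - \<Theta>. of_nat (degree Y y) * (?\<phi> y - ?z * avg Y ?\<phi> y)) + (\<Sum>y\<in>\<Theta>. of_nat (degree Y y) * (?\<phi> y - ?z * avg Y ?\<phi> y))"
      by (rule sum.subset_diff[OF \<Theta>_sub fin])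
    also have "(\<Sum>y\<in>verts Y - \<Theta>. of_nat (degree Y y) * (?\<phi> y - ?z * avg Y ?\<phi> y)) = 0"
      by (rule sum.neutral) (use harm in auto)
    also have "(\<Sum>y\<in>\<Theta>. of_nat (degree Y y) * (?\<phi> y - ?z * avg Y ?\<phi> y)) = (\<Sum>y\<in>\<Theta>. of_nat \<delta>0 * (1 - ?d ?z))"
      by (rule sum.cong) (use src deg_\<Theta> in auto)
    finally have "(\<Sum>y\<in>verts Y. of_nat (degree Y y) * (?\<phi> y - ?z * avg Y ?\<phi> y)) = of_nat \<theta> * of_nat \<delta>0 * (1 - ?d ?z)"
      using card_\<Theta> by simp
    moreover have "(\<Sum>y\<in>verts Y. of_nat (degree Y y) * (?\<phi> y - ?z * avg Y ?\<phi> y)) = (1 - ?z) * Q ?z"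
    proof -
      have "(\<Sum>y\<in>verts Y. of_nat (degree Y y) * (?\<phi> y - ?z * avg Y ?\<phi> y))
         = Q ?z - ?z * (\<Sum>y\<in>verts Y. of_nat (degree Y y) * avg Y ?\<phi> y)"
        by (simp add: Q_def algebra_simps sum_subtractf sum_distrib_left)
      then show ?thesis unfolding sum_degree_avg by (simp add: Q_def algebra_simps)
    qed
    ultimately have "(1 - ?z) * Q ?z = of_nat \<theta> * of_nat \<delta>0 * ((1 - ?z) * T ?z)" using r(4)[OF z(2)] by simp
    then have "(1 - ?z) * Q ?z = (1 - ?z) * P ?z" by (simp add: P_def mult_ac)
    moreover have "1 - ?z \<noteq> 0" using s by (metis of_real_1 of_real_eq_iff less_irrefl right_minus_eq)
    ultimately show ?thesis by simp
  qed
  have P_hol: "P holomorphic_on ball 0 r" unfolding P_def by (intro holomorphic_intros r(3))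
  have Q_hol: "Q holomorphic_on ball 0 r" unfolding Q_def \<phi>_def
    by (intro holomorphic_intros d_hol f_hol K.kgf_holomorphic r(2)) auto
  \<comment> \<open>The balance holds along the interval from 0 to 1, where \<open>f\<close> is
    nonzero; both sides are holomorphic near 1, so it passes to the limit.\<close>
  have PQ: "P 1 = Q 1"
  proof -
    define s where "s = (\<lambda>n. 1 - 1 / real (n + 2))"
    have s: "0 < s n" "s n < 1" for n by (auto simp: s_def field_simps)
    have "(\<lambda>n. 1 - 1 / real (n + 2)) \<longlonglongrightarrow> 1 - 0"
      by (intro tendsto_intros LIMSEQ_ignore_initial_segment[where f = "\<lambda>n. 1 / real n"] lim_1_over_n)
    then have "s \<longlonglongrightarrow> 1" by (simp add: s_def)
    then have lim: "(\<lambda>n. complex_of_real (s n)) \<longlonglongrightarrow> 1"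
      using tendsto_of_real[of s "1::real" sequentially, where 'a = complex] by simp
    have "continuous (at 1) P" "continuous (at 1) Q"
      using holomorphic_on_imp_continuous_on[OF P_hol] holomorphic_on_imp_continuous_on[OF Q_hol] one(2)
      by (simp_all add: continuous_on_eq_continuous_at)
    then have "(\<lambda>n. P (of_real (s n))) \<longlonglongrightarrow> P 1" "(\<lambda>n. Q (of_real (s n))) \<longlonglongrightarrow> Q 1"
      using lim by (auto intro: continuous_at_sequentiallyI isCont_tendsto_compose)
    moreover have "P (of_real (s n)) = Q (of_real (s n))" for n using balance s by blast
    ultimately show ?thesis using LIMSEQ_unique by simp
  qed
  \<comment> \<open>At 1 the first term of \<open>\<phi>\<close> disappears because
    \<open>d 1 = 1\<close>, and absorption is certain.\<close>
  have \<phi>1: "\<phi> 1 y = of_real (t x)" if y: "y \<in> verts Y" for y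
    using K.first_hit_const[OF r(2)[OF one(1)] y] by (simp add: \<phi>_def d1 f1)
  have "complex_of_real (real \<theta> * real \<delta>0 * \<tau>) = of_real (t x * (\<Sum>y\<in>verts Y. real (degree Y y)))"
    using PQ by (simp add: P_def T1 Q_def \<phi>1 sum_distrib_left mult.commute)
  then have main: "real \<theta> * real \<delta>0 * \<tau> = t x * (\<Sum>y\<in>verts Y. real (degree Y y))"
    by (simp only: of_real_eq_iff)
  have sa: "summable a" using sm[of w0] hit[OF xw0] by simp
  have cnj: "?d (cnj z) = cnj (?d z)" if z: "z \<in> ball 0 r" for z
  proof -
    have "K.conv z" using r(2) z by simp
    then have "summable (\<lambda>n. of_real (kprob Y ?B n x w0) * z ^ n :: complex)" using xV unfolding K.conv_def by blast
    then have "cnj (\<Sum>n. of_real (a n) * z ^ n) = (\<Sum>n. cnj (of_real (a n) * z ^ n))"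
      unfolding hit[OF xw0] by (rule bounded_linear.suminf[OF bounded_linear_cnj])
    then show ?thesis by (simp add: hit_gf_def)
  qed
  show ?thesis
    by (rule that[OF r(1) \<open>2 \<le> \<tau>\<close> _ sa d_hol f_hol d1 deriv f1 main]) (use tx cnj in auto)
qed

end

section \<open>Cells of self-similar graphs\<close>

lemma adj_induced_subgraph: "adj (induced_subgraph X A) x y \<longleftrightarrow> adj X x y \<and> x \<in> A \<and> y \<in> A"
  by (auto simp: adj_def induced_subgraph_def)

lemma verts_induced_subgraph [simp]: "verts (induced_subgraph X A) = A"
  by (simp add: induced_subgraph_def)

lemma simple_induced_subgraph: "simple_graph X \<Longrightarrow> simple_graph (induced_subgraph X A)"
  by (auto simp: simple_graph_def induced_subgraph_def)

lemma equiv_linked: "equiv (verts X) (linked X)"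
proof (rule equivI)
  show "linked X \<subseteq> verts X \<times> verts X" by (auto simp: linked_def)
  show "refl_on (verts X) (linked X)" by (auto simp: linked_def refl_on_def)
  have "symp (adj X)\<^sup>*\<^sup>*" by (rule symp_rtranclp) (auto simp: symp_def adj_sym)
  then show "sym (linked X)" by (auto simp: linked_def sym_def symp_def)
  show "trans (linked X)" by (auto simp: linked_def trans_def)
qed

lemma hat_graph_verts: "verts (hat_graph X C) = C \<union> boundary X C"
  by (simp add: hat_graph_def)

lemma hat_graph_adj: "adj (hat_graph X C) x y \<longleftrightarrow> adj X x y \<and> x \<in> C \<union> boundary X C \<and> y \<in> C \<union> boundary X C"
  by (simp add: hat_graph_def adj_induced_subgraph)

lemma adj_reduced_graph:
  "adj (reduced_graph X F) x y \<longleftrightarrow> x \<in> F \<and> y \<in> F \<and> x \<noteq> y \<and> (\<exists>C\<in>cells X F. x \<in> boundary X C \<and> y \<in> boundary X C)"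
  by (auto simp: adj_def reduced_graph_def doubleton_eq_iff)

lemma verts_reduced_graph [simp]: "verts (reduced_graph X F) = F"
  by (simp add: reduced_graph_def)

lemma graph_iso_trans:
  assumes "graph_iso X Y f" "graph_iso Y Z g" shows "graph_iso X Z (g \<circ> f)"
proof -
  have b: "bij_betw f (verts X) (verts Y)" "bij_betw g (verts Y) (verts Z)"
    using assms by (simp_all add: graph_iso_def)
  have "f x \<in> verts Y" if "x \<in> verts X" for x using b(1) that by (auto simp: bij_betw_def)
  then show ?thesis using assms bij_betw_trans[OF b] by (simp add: graph_iso_def)
qed

locale graph_cells = lf_graph X for X :: "'a ugraph" +
  fixes F :: "'a set"
  assumes F_sub: "F \<subseteq> verts X"
begin

lemma cell_nonempty: "C \<in> cells X F \<Longrightarrow> C \<noteq> {}"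
  unfolding cells_def conn_components_def
  using in_quotient_imp_non_empty[OF equiv_linked] by blast

lemma cell_sub: "C \<in> cells X F \<Longrightarrow> C \<subseteq> verts X - F"
  unfolding cells_def conn_components_def
  using in_quotient_imp_subset[OF equiv_linked, of C "induced_subgraph X (verts X - F)"] by simp

lemma cell_disjoint: "C \<in> cells X F \<Longrightarrow> D \<in> cells X F \<Longrightarrow> x \<in> C \<Longrightarrow> x \<in> D \<Longrightarrow> C = D"
  unfolding cells_def conn_components_def
  using quotient_disj[OF equiv_linked, of C "induced_subgraph X (verts X - F)" D] by blast

lemma in_some_cell:
  assumes "x \<in> verts X" "x \<notin> F"
  obtains C where "C \<in> cells X F" "x \<in> C"
proof -
  let ?H = "induced_subgraph X (verts X - F)"
  have "linked ?H `` {x} \<in> cells X F"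
    unfolding cells_def conn_components_def by (rule quotientI) (use assms in simp)
  moreover have "x \<in> linked ?H `` {x}" using assms by (auto simp: linked_def)
  ultimately show ?thesis by (rule that)
qed

lemma cell_linked:
  assumes "C \<in> cells X F" "x \<in> C" "y \<in> verts X - F"
  shows "y \<in> C \<longleftrightarrow> (adj (induced_subgraph X (verts X - F)))\<^sup>*\<^sup>* x y"
proof -
  let ?H = "induced_subgraph X (verts X - F)"
  have x: "x \<in> verts X - F" using cell_sub assms by blast
  have C: "C = linked ?H `` {x}"
    using assms(1,2) unfolding cells_def conn_components_def
    by (metis Image_singleton_iff equiv_class_eq equiv_linked quotientE)
  show ?thesis unfolding C using x assms(3) by (auto simp: linked_def)
qed

lemma cell_closed:
  assumes "C \<in> cells X F" "x \<in> C" "adj X x y" "y \<notin> F"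
  shows "y \<in> C"
proof -
  have y: "y \<in> verts X - F" using adj_vertsD assms by blast
  have "x \<in> verts X - F" using cell_sub assms by blast
  then have "adj (induced_subgraph X (verts X - F)) x y" using assms y by (simp add: adj_induced_subgraph)
  then show ?thesis using cell_linked[OF assms(1,2) y] by blast
qed

lemma boundary_iff:
  assumes "C \<in> cells X F"
  shows "x \<in> boundary X C \<longleftrightarrow> x \<in> F \<and> (\<exists>y\<in>C. adj X x y)"
proof
  assume x: "x \<in> boundary X C"
  then obtain y where y: "y \<in> C" "adj X x y" by (auto simp: boundary_def)
  have "x \<notin> C" using x by (auto simp: boundary_def)
  then have "x \<in> F" using cell_closed[OF assms y(1), of x] y(2) adj_sym[of X] by blast
  then show "x \<in> F \<and> (\<exists>y\<in>C. adj X x y)" using y by blast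
next
  assume "x \<in> F \<and> (\<exists>y\<in>C. adj X x y)"
  then show "x \<in> boundary X C" using cell_sub[OF assms] F_sub by (auto simp: boundary_def)
qed

lemma boundary_sub: "C \<in> cells X F \<Longrightarrow> boundary X C \<subseteq> F"
  using boundary_iff by blast

lemma finite_boundary:
  assumes "C \<in> cells X F" "finite C" shows "finite (boundary X C)"
proof (rule finite_subset)
  show "boundary X C \<subseteq> (\<Union>y\<in>C. neighbours X y)" by (auto simp: boundary_def neighbours_def adj_sym)
qed (use assms finite_neighbours in blast)

lemma hat_lf: "lf_graph (hat_graph X C)"
proof
  show "simple_graph (hat_graph X C)" unfolding hat_graph_def by (rule simple_induced_subgraph[OF simple])
  show "locally_finite_graph (hat_graph X C)" unfolding locally_finite_graph_def
  proof
    fix x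
    have "neighbours (hat_graph X C) x \<subseteq> neighbours X x" by (auto simp: neighbours_def hat_graph_adj)
    then show "finite (neighbours (hat_graph X C) x)" using finite_neighbours finite_subset by blast
  qed
qed

lemma hat_neighbours_inner:
  assumes "C \<in> cells X F" "y \<in> C"
  shows "neighbours (hat_graph X C) y = neighbours X y"
proof (intro equalityI subsetI)
  fix w assume w: "w \<in> neighbours X y"
  then have "w \<in> C \<or> w \<in> boundary X C"
    using cell_closed[OF assms] boundary_iff[OF assms(1)] assms(2) by (auto simp: neighbours_def adj_sym)
  then show "w \<in> neighbours (hat_graph X C) y" using w assms by (auto simp: neighbours_def hat_graph_adj)
qed (auto simp: neighbours_def hat_graph_adj)

lemma hat_connected:
  assumes C: "C \<in> cells X F"
  shows "connected_graph (hat_graph X C)"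
proof -
  let ?Y = "hat_graph X C"
  obtain c where c: "c \<in> C" using cell_nonempty[OF C] by blast
  have inner: "(adj ?Y)\<^sup>*\<^sup>* c y" if "y \<in> C" for y
  proof -
    have "(adj (induced_subgraph X (verts X - F)))\<^sup>*\<^sup>* c y"
      using cell_linked[OF C c] that cell_sub[OF C] by blast
    then have "(adj ?Y)\<^sup>*\<^sup>* c y \<and> y \<in> C"
    proof (induction rule: rtranclp_induct)
      case (step u v)
      then have a: "adj X u v" "v \<notin> F" by (auto simp: adj_induced_subgraph)
      then have "v \<in> C" using cell_closed[OF C _ a] step by blast
      then have "adj ?Y u v" using a step by (auto simp: hat_graph_adj)
      then show ?case using step \<open>v \<in> C\<close> by (meson rtranclp.rtrancl_into_rtrancl)
    qed (use c in simp)
    then show ?thesis by blast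
  qed
  have reach: "(adj ?Y)\<^sup>*\<^sup>* c y" if y: "y \<in> verts ?Y" for y
  proof (cases "y \<in> C")
    case False
    then have yb: "y \<in> boundary X C" using y by (simp add: hat_graph_verts)
    then obtain w where w: "w \<in> C" "adj X y w" by (auto simp: boundary_def)
    then have "adj ?Y w y" using yb by (auto simp: hat_graph_adj adj_sym)
    then show ?thesis using inner[OF w(1)] by (meson rtranclp.rtrancl_into_rtrancl)
  qed (rule inner)
  have "symp (adj ?Y)\<^sup>*\<^sup>*" by (rule symp_rtranclp) (auto simp: symp_def adj_sym)
  then have "(adj ?Y)\<^sup>*\<^sup>* x y" if "x \<in> verts ?Y" "y \<in> verts ?Y" for x y
    using reach[OF that(1)] reach[OF that(2)] by (meson rtranclp_trans sympD)
  then show ?thesis by (simp add: connected_graph_def linked_def)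
qed

end

section \<open>Local structure of a symmetrically self-similar graph\<close>

locale self_similar_origin = graph_cells X F for X :: "'a ugraph" and F :: "'a set" +
  fixes \<psi> :: "'a \<Rightarrow> 'a" and v0 :: 'a
  assumes symm: "symmetrically_self_similar X F \<psi>" and origin: "origin_vertex X \<psi> v0"
begin

lemma F_indep: "x \<in> F \<Longrightarrow> y \<in> F \<Longrightarrow> \<not> adj X x y"
  using symm by (auto simp: symmetrically_self_similar_def self_similar_def)

lemma boundary_inter:
  "C \<in> cells X F \<Longrightarrow> D \<in> cells X F \<Longrightarrow> x \<in> boundary X C \<Longrightarrow> x \<in> boundary X D \<Longrightarrow>
   y \<in> boundary X C \<Longrightarrow> y \<in> boundary X D \<Longrightarrow> x \<noteq> y \<Longrightarrow> C = D"
  using symm unfolding symmetrically_self_similar_def self_similar_def by blast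

lemma \<psi>_iso: "graph_iso X (reduced_graph X F) \<psi>"
  using symm by (auto simp: symmetrically_self_similar_def self_similar_def)

lemma \<psi>_bij: "bij_betw \<psi> (verts X) F"
  using \<psi>_iso by (simp add: graph_iso_def)

lemma \<psi>_in_F: "x \<in> verts X \<Longrightarrow> \<psi> x \<in> F"
  using \<psi>_bij by (auto simp: bij_betw_def)

lemma \<psi>_inj: "x \<in> verts X \<Longrightarrow> y \<in> verts X \<Longrightarrow> \<psi> x = \<psi> y \<Longrightarrow> x = y"
  using \<psi>_bij by (auto simp: bij_betw_def inj_on_def)

lemma \<psi>_surj: assumes "p \<in> F" obtains x where "x \<in> verts X" "\<psi> x = p"
  using \<psi>_bij assms by (auto simp: bij_betw_def)

lemma \<psi>_adj: "x \<in> verts X \<Longrightarrow> y \<in> verts X \<Longrightarrow>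
    adj X x y \<longleftrightarrow> x \<noteq> y \<and> (\<exists>C\<in>cells X F. \<psi> x \<in> boundary X C \<and> \<psi> y \<in> boundary X C)"
  using \<psi>_iso \<psi>_in_F \<psi>_inj by (auto simp: graph_iso_def adj_reduced_graph not_adj_self)

lemma v0_in: "v0 \<in> verts X" "v0 \<in> F" "\<psi> v0 = v0"
  using origin \<psi>_in_F[of v0] by (auto simp: origin_vertex_def)

lemma X_conn: "connected_graph X" and X_inf: "infinite (verts X)"
  using symm by (auto simp: symmetrically_self_similar_def self_similar_def)

lemma degree_pos: assumes "x \<in> verts X" shows "degree X x > 0"
proof -
  obtain y where y: "y \<in> verts X" "y \<noteq> x" using X_inf by (metis assms finite.simps finite_insert subsetI finite_subset insertCI singletonI)
  then have "(adj X)\<^sup>*\<^sup>* x y" using X_conn assms by (auto simp: connected_graph_def linked_def)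
  then obtain w where "adj X x w" using y(2) by (metis converse_rtranclpE)
  then show ?thesis using finite_neighbours[of x] by (auto simp: degree_def card_gt_0_iff neighbours_def)
qed

lemma cell_finite: "C \<in> cells X F \<Longrightarrow> finite C"
  using symm by (auto simp: symmetrically_self_similar_def)

lemma S1: assumes "C \<in> cells X F" "D \<in> cells X F"
  obtains \<alpha> where "graph_iso (hat_graph X C) (hat_graph X D) \<alpha>" "\<alpha> ` boundary X C = boundary X D"
proof -
  have "\<forall>C\<in>cells X F. \<forall>D\<in>cells X F. \<exists>\<alpha>.
        graph_iso (hat_graph X C) (hat_graph X D) \<alpha> \<and> \<alpha> ` boundary X C = boundary X D"
    using symm unfolding symmetrically_self_similar_def by (elim conjE)
  then show ?thesis using assms that by blast
qed

lemma S2: assumes "C \<in> cells X F" "x \<in> boundary X C" "y \<in> boundary X C" "x \<noteq> y"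
    "x' \<in> boundary X C" "y' \<in> boundary X C" "x' \<noteq> y'"
  obtains g where "graph_iso (hat_graph X C) (hat_graph X C) g" "g x = x'" "g y = y'"
proof -
  have "\<forall>C\<in>cells X F. \<forall>x\<in>boundary X C. \<forall>y\<in>boundary X C. \<forall>x'\<in>boundary X C. \<forall>y'\<in>boundary X C.
          x \<noteq> y \<longrightarrow> x' \<noteq> y' \<longrightarrow> (\<exists>g. graph_iso (hat_graph X C) (hat_graph X C) g \<and> g x = x' \<and> g y = y')"
    using symm unfolding symmetrically_self_similar_def by (elim conjE)
  then have "\<exists>g. graph_iso (hat_graph X C) (hat_graph X C) g \<and> g x = x' \<and> g y = y'" using assms by simp
  then show ?thesis using that by blast
qed

lemma boundary_card_eq:
  assumes "C \<in> cells X F" "D \<in> cells X F" shows "card (boundary X C) = card (boundary X D)"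
proof -
  obtain \<alpha> where \<alpha>: "graph_iso (hat_graph X C) (hat_graph X D) \<alpha>" "\<alpha> ` boundary X C = boundary X D"
    using S1[OF assms] by blast
  have "inj_on \<alpha> (C \<union> boundary X C)" using \<alpha>(1) by (simp add: graph_iso_def bij_betw_def hat_graph_verts)
  then have "inj_on \<alpha> (boundary X C)" by (rule inj_on_subset) simp
  from card_image[OF this] show ?thesis unfolding \<alpha>(2) by simp
qed

lemma iso_pairs:
  assumes C: "C \<in> cells X F" "x \<in> boundary X C" "y \<in> boundary X C" "x \<noteq> y"
    and D: "D \<in> cells X F" "x' \<in> boundary X D" "y' \<in> boundary X D" "x' \<noteq> y'"
  obtains \<phi> where "graph_iso (hat_graph X C) (hat_graph X D) \<phi>" "\<phi> x = x'" "\<phi> y = y'"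
proof -
  obtain \<alpha> where \<alpha>: "graph_iso (hat_graph X C) (hat_graph X D) \<alpha>" "\<alpha> ` boundary X C = boundary X D"
    using S1[OF C(1) D(1)] by blast
  have "inj_on \<alpha> (C \<union> boundary X C)" using \<alpha>(1) by (simp add: graph_iso_def bij_betw_def hat_graph_verts)
  then have ne: "\<alpha> x \<noteq> \<alpha> y" using C by (auto dest: inj_onD)
  have "\<alpha> x \<in> boundary X D" "\<alpha> y \<in> boundary X D" using \<alpha>(2) C by blast+
  then obtain g where "graph_iso (hat_graph X D) (hat_graph X D) g" "g (\<alpha> x) = x'" "g (\<alpha> y) = y'"
    using S2[OF D(1) _ _ ne D(2-4)] by blast
  then show ?thesis using that[OF graph_iso_trans[OF \<alpha>(1)]] by simp
qed

text \<open>The origin has a neighbour, and \<open>\<psi>\<close> maps these two vertices to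
  boundary points of a common cell.\<close>

lemma reference_cell:
  obtains C x y where "C \<in> cells X F" "x \<in> boundary X C" "y \<in> boundary X C" "x \<noteq> y"
proof -
  have "neighbours X v0 \<noteq> {}" using degree_pos[OF v0_in(1)] by (auto simp: degree_def)
  then obtain w where w: "adj X v0 w" by (auto simp: neighbours_def)
  then have "w \<in> verts X" "v0 \<noteq> w" using adj_vertsD not_adj_self by auto
  then show ?thesis using \<psi>_adj[OF v0_in(1)] w that \<psi>_inj[OF v0_in(1)] by metis
qed

definition \<theta> :: nat where "\<theta> = card (boundary X (SOME C. C \<in> cells X F))"

lemma card_boundary: "C \<in> cells X F \<Longrightarrow> card (boundary X C) = \<theta>"
  unfolding \<theta>_def by (rule boundary_card_eq) (auto intro: someI)

lemma boundary_finite: "C \<in> cells X F \<Longrightarrow> finite (boundary X C)"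
  using finite_boundary cell_finite by blast

lemma \<theta>_ge: "\<theta> \<ge> 2"
proof -
  obtain C x y where C: "C \<in> cells X F" "x \<in> boundary X C" "y \<in> boundary X C" "x \<noteq> y" by (rule reference_cell)
  have "card {x, y} \<le> card (boundary X C)" using C by (intro card_mono boundary_finite) auto
  then show ?thesis using C card_boundary by simp
qed

lemma other_boundary_point:
  assumes "C \<in> cells X F" obtains y where "y \<in> boundary X C" "y \<noteq> x"
proof -
  have "\<not> boundary X C \<subseteq> {x}"
  proof
    assume "boundary X C \<subseteq> {x}"
    then have "card (boundary X C) \<le> card {x}" by (rule card_mono[rotated]) simp
    then show False using card_boundary[OF assms] \<theta>_ge by simp
  qed
  then show ?thesis using that by blast
qed

text \<open>A cell with \<open>x\<close> on its boundary contains a neighbour of \<open>x\<close>,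
  and distinct cells are disjoint.\<close>

lemma cells_at_point: "finite {C \<in> cells X F. x \<in> boundary X C}"
proof -
  have "{C \<in> cells X F. x \<in> boundary X C} \<subseteq> (\<lambda>w. THE C. C \<in> cells X F \<and> w \<in> C) ` neighbours X x"
  proof
    fix C assume C: "C \<in> {C \<in> cells X F. x \<in> boundary X C}"
    then obtain w where w: "w \<in> C" "adj X x w" by (auto simp: boundary_def)
    have "(THE C. C \<in> cells X F \<and> w \<in> C) = C" using C w cell_disjoint by (intro the_equality) auto
    then show "C \<in> (\<lambda>w. THE C. C \<in> cells X F \<and> w \<in> C) ` neighbours X x" using w by (auto simp: neighbours_def)
  qed
  then show ?thesis using finite_neighbours finite_surj by blast
qed

definition cell_count :: "'a \<Rightarrow> nat" where "cell_count x = card {C \<in> cells X F. x \<in> boundary X C}"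

text \<open>Vertices of \<open>F\<close> are pairwise non-adjacent, so each neighbour of
  \<open>x\<close> lies in exactly one cell, and that cell has \<open>x\<close> on its
  boundary.\<close>

lemma sum_neighbours_cells:
  fixes u :: "'a \<Rightarrow> 'b::comm_monoid_add"
  assumes x: "x \<in> F"
  shows "(\<Sum>w\<in>neighbours X x. u w) = (\<Sum>C | C \<in> cells X F \<and> x \<in> boundary X C. \<Sum>w\<in>neighbours (hat_graph X C) x. u w)"
proof -
  let ?K = "{C \<in> cells X F. x \<in> boundary X C}"
  have nb: "neighbours (hat_graph X C) x = neighbours X x \<inter> C" if "C \<in> ?K" for C
    using that x F_indep boundary_sub by (fastforce simp: neighbours_def hat_graph_adj)
  have "neighbours X x = (\<Union>C\<in>?K. neighbours (hat_graph X C) x)"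
  proof (intro equalityI subsetI)
    fix w assume w: "w \<in> neighbours X x"
    then have a: "adj X x w" by (simp add: neighbours_def)
    then obtain C where C: "C \<in> cells X F" "w \<in> C" using in_some_cell[of w] adj_vertsD F_indep x by metis
    then have "C \<in> ?K" using boundary_iff a x by blast
    then show "w \<in> (\<Union>C\<in>?K. neighbours (hat_graph X C) x)" using nb C w by blast
  qed (use nb in blast)
  also have "sum u \<dots> = (\<Sum>C\<in>?K. \<Sum>w\<in>neighbours (hat_graph X C) x. u w)"
  proof (rule sum.UNION_disjoint[OF cells_at_point])
    show "\<forall>C\<in>?K. finite (neighbours (hat_graph X C) x)" using nb finite_neighbours by auto
    show "\<forall>C\<in>?K. \<forall>D\<in>?K. C \<noteq> D \<longrightarrow> neighbours (hat_graph X C) x \<inter> neighbours (hat_graph X D) x = {}"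
      using nb cell_disjoint by blast
  qed
  finally show ?thesis .
qed

text \<open>By (F2), two cells with \<open>x\<close> on their boundaries share no other boundary
  point, so the neighbours in the reduced graph split disjointly.\<close>

lemma sum_neighbours_reduced:
  fixes u :: "'a \<Rightarrow> 'b::comm_monoid_add"
  assumes x: "x \<in> F"
  shows "(\<Sum>w\<in>neighbours (reduced_graph X F) x. u w) = (\<Sum>C | C \<in> cells X F \<and> x \<in> boundary X C. \<Sum>w\<in>boundary X C - {x}. u w)"
proof -
  let ?K = "{C \<in> cells X F. x \<in> boundary X C}"
  have "neighbours (reduced_graph X F) x = (\<Union>C\<in>?K. boundary X C - {x})"
    using boundary_sub by (fastforce simp: neighbours_def adj_reduced_graph)
  also have "sum u \<dots> = (\<Sum>C\<in>?K. \<Sum>w\<in>boundary X C - {x}. u w)"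
  proof (rule sum.UNION_disjoint[OF cells_at_point])
    show "\<forall>C\<in>?K. finite (boundary X C - {x})" using boundary_finite by auto
    show "\<forall>C\<in>?K. \<forall>D\<in>?K. C \<noteq> D \<longrightarrow> (boundary X C - {x}) \<inter> (boundary X D - {x}) = {}"
      using boundary_inter by blast
  qed
  finally show ?thesis .
qed

lemma reduced_lf: "lf_graph (reduced_graph X F)"
proof
  show "simple_graph (reduced_graph X F)" by (auto simp: simple_graph_def reduced_graph_def)
  show "locally_finite_graph (reduced_graph X F)" unfolding locally_finite_graph_def
  proof
    fix x assume "x \<in> verts (reduced_graph X F)"
    have "neighbours (reduced_graph X F) x \<subseteq> (\<Union>C\<in>{C \<in> cells X F. x \<in> boundary X C}. boundary X C)"
      by (auto simp: neighbours_def adj_reduced_graph)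
    moreover have "finite (\<Union>C\<in>{C \<in> cells X F. x \<in> boundary X C}. boundary X C)"
      using cells_at_point boundary_finite by blast
    ultimately show "finite (neighbours (reduced_graph X F) x)" by (rule finite_subset)
  qed
qed

end

section \<open>A reference cell and the renewal equation on the graph\<close>

context self_similar_origin
begin

text \<open>A cell with an ordered pair of distinct boundary points; the coefficient sequences are
  read off here and shown to be the same everywhere.\<close>

definition ref :: "'a set \<times> 'a \<times> 'a" where
  "ref = (SOME (C, x, y). C \<in> cells X F \<and> x \<in> boundary X C \<and> y \<in> boundary X C \<and> x \<noteq> y)"

definition C0 where "C0 = fst ref"
definition x0 where "x0 = fst (snd ref)"
definition y0 where "y0 = snd (snd ref)"

lemma ref: "C0 \<in> cells X F" "x0 \<in> boundary X C0" "y0 \<in> boundary X C0" "x0 \<noteq> y0"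
proof -
  have "\<exists>p. case p of (C, x, y) \<Rightarrow> C \<in> cells X F \<and> x \<in> boundary X C \<and> y \<in> boundary X C \<and> x \<noteq> y"
  proof -
    obtain C x y where "C \<in> cells X F" "x \<in> boundary X C" "y \<in> boundary X C" "x \<noteq> y" by (rule reference_cell)
    then show ?thesis by (intro exI[of _ "(C, x, y)"]) simp
  qed
  then have "case ref of (C, x, y) \<Rightarrow> C \<in> cells X F \<and> x \<in> boundary X C \<and> y \<in> boundary X C \<and> x \<noteq> y"
    unfolding ref_def by (rule someI_ex)
  then show "C0 \<in> cells X F" "x0 \<in> boundary X C0" "y0 \<in> boundary X C0" "x0 \<noteq> y0"
    by (auto simp: C0_def x0_def y0_def split: prod.splits)
qed

definition \<gamma>0 :: "nat \<Rightarrow> real" where "\<gamma>0 n = kprob (hat_graph X C0) {} n x0 x0"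
definition \<gamma>1 :: "nat \<Rightarrow> real" where "\<gamma>1 n = kprob (hat_graph X C0) {} n x0 y0"
definition hit_coeff :: "nat \<Rightarrow> real" where "hit_coeff n = kprob (hat_graph X C0) (boundary X C0 - {x0}) n x0 y0"
definition ret_coeff :: "nat \<Rightarrow> real" where "ret_coeff n = kprob (hat_graph X C0) (boundary X C0 - {x0}) n x0 x0"
definition \<delta>0 :: nat where "\<delta>0 = degree (hat_graph X C0) x0"
definition vol :: nat where "vol = (\<Sum>y\<in>verts (hat_graph X C0). degree (hat_graph X C0) y)"

lemma to_reference:
  assumes "C \<in> cells X F" "x \<in> boundary X C" "y \<in> boundary X C" "x \<noteq> y"
  obtains \<phi> where "graph_iso (hat_graph X C) (hat_graph X C0) \<phi>" "\<phi> x = x0" "\<phi> y = y0"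
  using iso_pairs[OF assms ref] by blast

lemma boundary_in_hat: "x \<in> boundary X C \<Longrightarrow> x \<in> verts (hat_graph X C)"
  by (simp add: hat_graph_verts)

text \<open>Only kernels without absorption are transported, because the isomorphisms match the
  chosen points but perhaps not the whole boundaries.\<close>

lemma hat_sym_net:
  assumes C: "C \<in> cells X F"
  shows "sym_net (hat_graph X C) (boundary X C) \<theta> \<gamma>0 \<gamma>1"
proof -
  interpret Y: lf_graph "hat_graph X C" by (rule hat_lf)
  show ?thesis
  proof
    show "finite (verts (hat_graph X C))" using cell_finite[OF C] boundary_finite[OF C] by (simp add: hat_graph_verts)
    show "connected_graph (hat_graph X C)" by (rule hat_connected[OF C])
    show "boundary X C \<subseteq> verts (hat_graph X C)" by (simp add: hat_graph_verts)
    show "card (boundary X C) = \<theta>" by (rule card_boundary[OF C])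
    show "2 \<le> \<theta>" by (rule \<theta>_ge)
    show "kprob (hat_graph X C) {} n x x = \<gamma>0 n" if x: "x \<in> boundary X C" for n x
    proof -
      obtain y where y: "y \<in> boundary X C" "y \<noteq> x" using other_boundary_point[OF C] by blast
      obtain \<phi> where \<phi>: "graph_iso (hat_graph X C) (hat_graph X C0) \<phi>" "\<phi> x = x0"
        using to_reference[OF C x y(1)] y(2) by blast
      show ?thesis using graph_iso_kprob[OF hat_lf hat_lf \<phi>(1) boundary_in_hat[OF x] boundary_in_hat[OF x], of n] \<phi>(2)
        by (simp add: \<gamma>0_def)
    qed
    show "kprob (hat_graph X C) {} n x y = \<gamma>1 n" if xy: "x \<in> boundary X C" "y \<in> boundary X C" "x \<noteq> y" for n x y
    proof -
      obtain \<phi> where \<phi>: "graph_iso (hat_graph X C) (hat_graph X C0) \<phi>" "\<phi> x = x0" "\<phi> y = y0"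
        using to_reference[OF C xy] by blast
      show ?thesis using graph_iso_kprob[OF hat_lf hat_lf \<phi>(1) boundary_in_hat[OF xy(1)] boundary_in_hat[OF xy(2)], of n] \<phi>(2,3)
        by (simp add: \<gamma>1_def)
    qed
  qed
qed

lemma hat_degree_boundary:
  assumes C: "C \<in> cells X F" and x: "x \<in> boundary X C"
  shows "degree (hat_graph X C) x = \<delta>0"
proof -
  obtain y where y: "y \<in> boundary X C" "y \<noteq> x" using other_boundary_point[OF C] by blast
  obtain \<phi> where \<phi>: "graph_iso (hat_graph X C) (hat_graph X C0) \<phi>" "\<phi> x = x0"
    using to_reference[OF C x y(1)] y(2) by blast
  show ?thesis using graph_iso_neighbours(3)[OF hat_lf hat_lf \<phi>(1) boundary_in_hat[OF x]] \<phi>(2) by (simp add: \<delta>0_def)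
qed

lemma hat_volume:
  assumes C: "C \<in> cells X F"
  shows "(\<Sum>y\<in>verts (hat_graph X C). degree (hat_graph X C) y) = vol"
proof -
  obtain \<alpha> where \<alpha>: "graph_iso (hat_graph X C) (hat_graph X C0) \<alpha>" "\<alpha> ` boundary X C = boundary X C0"
    by (rule S1[OF C ref(1)])
  note \<alpha> = \<alpha>(1)
  from \<alpha> have "bij_betw \<alpha> (verts (hat_graph X C)) (verts (hat_graph X C0))" by (simp add: graph_iso_def)
  then have "vol = (\<Sum>y\<in>verts (hat_graph X C). degree (hat_graph X C0) (\<alpha> y))"
    unfolding vol_def by (rule sum.reindex_bij_betw[symmetric])
  also have "\<dots> = (\<Sum>y\<in>verts (hat_graph X C). degree (hat_graph X C) y)"
    by (rule sum.cong[OF refl]) (rule graph_iso_neighbours(3)[OF hat_lf hat_lf \<alpha>])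
  finally show ?thesis by simp
qed

lemma hat_hitting_net:
  assumes C: "C \<in> cells X F"
  shows "hitting_net (hat_graph X C) (boundary X C) \<theta> \<gamma>0 \<gamma>1 hit_coeff ret_coeff \<delta>0"
proof -
  interpret sym_net "hat_graph X C" "boundary X C" \<theta> \<gamma>0 \<gamma>1 by (rule hat_sym_net[OF C])
  have y0: "y0 \<in> boundary X C0 - {x0}" using ref by auto
  show ?thesis
  proof
    show "\<not> adj (hat_graph X C) x y" if "x \<in> boundary X C" "y \<in> boundary X C" for x y
      using that boundary_sub[OF C] F_indep by (auto simp: hat_graph_adj)
    show "degree (hat_graph X C) x = \<delta>0" if "x \<in> boundary X C" for x by (rule hat_degree_boundary[OF C that])
    show "kprob (hat_graph X C) (boundary X C - {x}) n x w = hit_coeff n"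
      if "x \<in> boundary X C" "w \<in> boundary X C - {x}" for x w n
      unfolding hit_coeff_def by (rule sym_net_killed_eq(1)[OF hat_sym_net[OF C] hat_sym_net[OF ref(1)] that ref(2) y0])
    show "kprob (hat_graph X C) (boundary X C - {x}) n x x = ret_coeff n" if x: "x \<in> boundary X C" for x n
    proof -
      obtain y where y: "y \<in> boundary X C - {x}" using other_boundary_point[OF C] by blast
      show ?thesis unfolding ret_coeff_def
        by (rule sym_net_killed_eq(2)[OF hat_sym_net[OF C] hat_sym_net[OF ref(1)] x y ref(2) y0])
    qed
  qed
qed

lemma degree_F: assumes "x \<in> F" shows "degree X x = cell_count x * \<delta>0"
proof -
  have "degree X x = (\<Sum>w\<in>neighbours X x. 1)" by (simp add: degree_def)
  also have "\<dots> = (\<Sum>C | C \<in> cells X F \<and> x \<in> boundary X C. degree (hat_graph X C) x)"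
    unfolding sum_neighbours_cells[OF assms] by (simp add: degree_def)
  also have "\<dots> = (\<Sum>C | C \<in> cells X F \<and> x \<in> boundary X C. \<delta>0)"
    by (rule sum.cong) (use hat_degree_boundary in auto)
  finally show ?thesis by (simp add: cell_count_def)
qed

lemma degree_reduced: assumes "x \<in> F" shows "degree (reduced_graph X F) x = cell_count x * (\<theta> - 1)"
proof -
  have "degree (reduced_graph X F) x = (\<Sum>w\<in>neighbours (reduced_graph X F) x. 1)" by (simp add: degree_def)
  also have "\<dots> = (\<Sum>C | C \<in> cells X F \<and> x \<in> boundary X C. card (boundary X C - {x}))"
    unfolding sum_neighbours_reduced[OF assms] by simp
  also have "\<dots> = (\<Sum>C | C \<in> cells X F \<and> x \<in> boundary X C. \<theta> - 1)"
    by (rule sum.cong) (use card_boundary boundary_finite in auto)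
  finally show ?thesis by (simp add: cell_count_def)
qed

lemma cell_count_pos: assumes "x \<in> F" shows "cell_count x > 0" and "\<delta>0 > 0"
proof -
  have "x \<in> verts X" using assms F_sub by blast
  then show "cell_count x > 0" "\<delta>0 > 0" using degree_pos[of x] degree_F[OF assms] by auto
qed

text \<open>The fixed point \<open>v0\<close> has the same degree in \<open>X\<close> and in the reduced graph.\<close>

lemma \<delta>0_eq: "\<delta>0 = \<theta> - 1"
proof -
  have "degree (reduced_graph X F) (\<psi> v0) = degree X v0"
    by (rule graph_iso_neighbours(3)[OF _ reduced_lf \<psi>_iso v0_in(1)]) unfold_locales
  then have "cell_count v0 * \<delta>0 = cell_count v0 * (\<theta> - 1)"
    using degree_F[OF v0_in(2)] degree_reduced[OF v0_in(2)] v0_in(3) by (simp only:)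
  then show ?thesis using cell_count_pos(1)[OF v0_in(2)] by simp
qed

text \<open>Every cell at \<open>x\<close> contributes the same number \<open>\<delta>0\<close> of
  edges at \<open>x\<close>, so the averages over the cell graphs combine to the average over
  \<open>X\<close>.\<close>

lemma avg_hat_sum:
  fixes u :: "'a \<Rightarrow> complex"
  assumes x: "x \<in> F"
  shows "(\<Sum>C | C \<in> cells X F \<and> x \<in> boundary X C. avg (hat_graph X C) u x) = of_nat (cell_count x) * avg X u x"
proof -
  have "(\<Sum>C | C \<in> cells X F \<and> x \<in> boundary X C. avg (hat_graph X C) u x)
    = (\<Sum>C | C \<in> cells X F \<and> x \<in> boundary X C. (\<Sum>w\<in>neighbours (hat_graph X C) x. u w) / of_nat \<delta>0)"
    by (rule sum.cong) (auto simp: avg_def hat_degree_boundary)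
  also have "\<dots> = (\<Sum>w\<in>neighbours X x. u w) / of_nat \<delta>0"
    by (simp add: sum_neighbours_cells[OF x] sum_divide_distrib)
  also have "\<dots> = of_nat (cell_count x) * avg X u x"
    using cell_count_pos[OF x] by (simp add: avg_def degree_F[OF x])
  finally show ?thesis .
qed

text \<open>The column \<open>u\<close> of the Green function, restricted to \<open>F\<close>,
  solves the resolvent equation of the reduced graph at \<open>d z\<close>, with source
  \<open>f z\<close> at \<open>v0\<close>. Pulled back by \<open>\<psi>\<close>, which fixes
  \<open>v0\<close>, it is by uniqueness \<open>f z\<close> times the column of the Green function
  of \<open>X\<close> at \<open>d z\<close>.\<close>

lemma functional_equation:
  assumes z: "norm z < 1" and dz: "norm (hit_gf \<theta> hit_coeff z) < 1"
  shows "kgf X {} z v0 v0 = return_gf ret_coeff z * kgf X {} (hit_gf \<theta> hit_coeff z) v0 v0"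
proof -
  let ?d = "hit_gf \<theta> hit_coeff z" and ?f = "return_gf ret_coeff z"
  define u where "u = (\<lambda>x. kgf X {} z x v0)"
  have u: "u x = of_bool (x = v0) + z * avg X u x" for x
    unfolding u_def using kgf_step[OF z, of X "{}" x v0] by simp
  have on_F: "u x = ?f * of_bool (x = v0) + ?d * avg (reduced_graph X F) u x" if x: "x \<in> F" for x
  proof -
    let ?K = "{C. C \<in> cells X F \<and> x \<in> boundary X C}"
    \<comment> \<open>First-hit decomposition inside a single cell; \<open>v0\<close> belongs to
      \<open>F\<close>, so \<open>u\<close> has no source in the cell.\<close>
    have 1: "u x = ?f * (u x - z * avg (hat_graph X C) u x) + ?d / of_nat (\<theta> - 1) * (\<Sum>w\<in>boundary X C - {x}. u w)"
      if "C \<in> ?K" for C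
    proof -
      have C: "C \<in> cells X F" "x \<in> boundary X C" using that by auto
      interpret hitting_net "hat_graph X C" "boundary X C" \<theta> \<gamma>0 \<gamma>1 hit_coeff ret_coeff \<delta>0 by (rule hat_hitting_net[OF C(1)])
      show ?thesis
      proof (rule first_hit_\<Theta>[OF C(2) z])
        fix y assume "y \<in> verts (hat_graph X C) - boundary X C"
        then have y: "y \<in> C" by (auto simp: hat_graph_verts)
        then have "y \<noteq> v0" using cell_sub[OF C(1)] v0_in(2) by blast
        moreover have "avg (hat_graph X C) u y = avg X u y"
          by (simp add: avg_def degree_def hat_neighbours_inner[OF C(1) y])
        ultimately show "u y = z * avg (hat_graph X C) u y" using u[of y] by simp
      qed
    qed
    \<comment> \<open>Adding the equations of all cells at \<open>x\<close>: the cell averages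
      combine to \<open>avg X\<close>, and the boundary sums to a sum over the neighbours in the
      reduced graph.\<close>
    have "of_nat (cell_count x) * u x = (\<Sum>C\<in>?K. u x)" by (simp add: cell_count_def)
    also have "\<dots> = (\<Sum>C\<in>?K. ?f * (u x - z * avg (hat_graph X C) u x) + ?d / of_nat (\<theta> - 1) * (\<Sum>w\<in>boundary X C - {x}. u w))"
      by (rule sum.cong[OF refl 1])
    also have "\<dots> = ?f * (of_nat (cell_count x) * u x - z * (\<Sum>C\<in>?K. avg (hat_graph X C) u x))
        + ?d / of_nat (\<theta> - 1) * (\<Sum>C\<in>?K. \<Sum>w\<in>boundary X C - {x}. u w)"
      by (simp add: sum.distrib sum_subtractf sum_distrib_left[symmetric] sum_divide_distrib[symmetric] cell_count_def)
    also have "(\<Sum>C\<in>?K. avg (hat_graph X C) u x) = of_nat (cell_count x) * avg X u x" by (rule avg_hat_sum[OF x])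
    also have "(\<Sum>C\<in>?K. \<Sum>w\<in>boundary X C - {x}. u w) = (\<Sum>w\<in>neighbours (reduced_graph X F) x. u w)"
      by (rule sum_neighbours_reduced[OF x, symmetric])
    also have "\<dots> = of_nat (cell_count x) * of_nat (\<theta> - 1) * avg (reduced_graph X F) u x"
      using cell_count_pos(1)[OF x] \<theta>_ge by (simp add: avg_def degree_reduced[OF x])
    also have "?f * (of_nat (cell_count x) * u x - z * (of_nat (cell_count x) * avg X u x)) = of_nat (cell_count x) * (?f * (u x - z * avg X u x))"
      by (simp add: algebra_simps)
    also have "u x - z * avg X u x = of_bool (x = v0)" by (subst u) simp
    finally have "of_nat (cell_count x) * u x = of_nat (cell_count x) * (?f * of_bool (x = v0) + ?d * avg (reduced_graph X F) u x)"
      using \<theta>_ge by (simp add: distrib_left)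
    then show ?thesis using cell_count_pos(1)[OF x] by (simp only: mult_cancel_left) simp
  qed
  have "u (\<psi> v0) = ?f * kgf X {} ?d v0 v0"
  proof (rule bounded_solution_unique[where u = "\<lambda>y. u (\<psi> y)" and v = "\<lambda>y. ?f * kgf X {} ?d y v0"
        and b = "\<lambda>y. ?f * of_bool (y = v0)" and X = X and V = "verts X" and z = ?d])
    show "norm ?d < 1" by (rule dz)
    show "norm (u (\<psi> y)) \<le> 1 / (1 - norm z)" for y unfolding u_def by (rule norm_kgf_le[OF z])
    show "norm (?f * kgf X {} ?d y v0) \<le> norm ?f * (1 / (1 - norm ?d))" for y
      unfolding norm_mult by (rule mult_left_mono[OF norm_kgf_le[OF dz]]) simp
    show "u (\<psi> y) = ?f * of_bool (y = v0) + ?d * avg X (\<lambda>y. u (\<psi> y)) y" if y: "y \<in> verts X" for y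
    proof -
      have "avg (reduced_graph X F) u (\<psi> y) = avg X (\<lambda>y. u (\<psi> y)) y"
        by (rule graph_iso_avg[OF _ reduced_lf \<psi>_iso y]) unfold_locales
      moreover have "\<psi> y = v0 \<longleftrightarrow> y = v0" using \<psi>_inj[OF y v0_in(1)] v0_in(3) by auto
      ultimately show ?thesis using on_F[OF \<psi>_in_F[OF y]] by simp
    qed
    show "?f * kgf X {} ?d y v0 = ?f * of_bool (y = v0) + ?d * avg X (\<lambda>y. ?f * kgf X {} ?d y v0) y" for y
    proof -
      have "kgf X {} ?d y v0 = of_bool (y = v0) + ?d * avg X (\<lambda>y. kgf X {} ?d y v0) y"
        using kgf_step[OF dz, of X "{}" y v0] by simp
      then show ?thesis unfolding avg_mult by (metis (no_types, lifting) distrib_left mult.left_commute)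
    qed
    show "neighbours X y \<subseteq> verts X" for y using adj_vertsD by (auto simp: neighbours_def)
  qed (rule v0_in)
  then show ?thesis by (simp add: u_def v0_in)
qed

text \<open>The agreement is needed on a disc of radius above 1, because derivatives at 1 are to be
  compared.\<close>

lemma transition_function_eq:
  assumes C: "C \<in> cells X F" and v: "v \<in> boundary X C"
  shows "\<exists>r>1. \<forall>z\<in>ball 0 r. transition_function X C v z = hit_gf \<theta> hit_coeff z"
proof -
  let ?Y = "hat_graph X C" and ?B = "boundary X C - {v}"
  interpret N: hitting_net ?Y "boundary X C" \<theta> \<gamma>0 \<gamma>1 hit_coeff ret_coeff \<delta>0 by (rule hat_hitting_net[OF C])
  interpret K: killed_net ?Y ?B by (rule N.killed[OF v])
  obtain r T where r: "r > 1" "\<And>z. norm z < r \<Longrightarrow> K.conv z"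
    by (rule N.transition_data[OF v]) blast
  have Q: "Q_matrix X C ?B x y = of_real (kprob ?Y ?B (Suc 0) x y)" for x y
    unfolding Q_matrix_def K.kprob_Suc_0 using N.adj_vertsD by auto
  have "transition_function X C v z = hit_gf \<theta> hit_coeff z" if z: "z \<in> ball 0 r" for z
  proof -
    have "K.conv z" using r(2) z by simp
    from K.inverse_matrix[OF this]
    have "Q_star X C ?B z = (\<lambda>x y. if x \<in> verts ?Y \<and> y \<in> verts ?Y then kgf ?Y ?B z x y else 0)"
      unfolding Q_star_def Q .
    then have "transition_function X C v z = (\<Sum>w\<in>?B. kgf ?Y ?B z v w)"
      unfolding transition_function_def using v by (auto simp: hat_graph_verts intro: sum.cong)
    then show ?thesis using N.sum_kgf_hit[OF v] by simp
  qed
  then show ?thesis using r(1) by blast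
qed

lemma time_scaling_eq:
  assumes "(hit_gf \<theta> hit_coeff has_field_derivative of_real \<tau>) (at 1)"
  shows "time_scaling X F = \<tau>"
proof -
  have der: "(transition_function X C v has_field_derivative of_real \<tau>) (at 1)"
    if Cv: "C \<in> cells X F" "v \<in> boundary X C" for C v
  proof -
    obtain r where r: "r > 1" "\<And>z. z \<in> ball 0 r \<Longrightarrow> transition_function X C v z = hit_gf \<theta> hit_coeff z"
      using transition_function_eq[OF Cv] by blast
    show ?thesis
      by (rule has_field_derivative_transform_within_open[OF assms open_ball[of 0 r]]) (use r in auto)
  qed
  show ?thesis unfolding time_scaling_def
  proof (rule the_equality)
    show "\<forall>C\<in>cells X F. \<forall>v\<in>boundary X C. (transition_function X C v has_field_derivative of_real \<tau>) (at 1)"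
      using der by blast
    fix t assume "\<forall>C\<in>cells X F. \<forall>v\<in>boundary X C. (transition_function X C v has_field_derivative of_real t) (at 1)"
    then have "(transition_function X C0 x0 has_field_derivative of_real t) (at 1)" using ref by blast
    then have "complex_of_real t = of_real \<tau>" using der[OF ref(1,2)] by (rule DERIV_unique)
    then show "t = \<tau>" by simp
  qed
qed

end

section \<open>2-cells and the mass scaling factor\<close>

context self_similar_origin
begin

lemma \<psi>F_graph_cells: "graph_cells X (\<psi> ` F)"
  by unfold_locales (use \<psi>_in_F F_sub in blast)

sublocale two: graph_cells X "\<psi> ` F" by (rule \<psi>F_graph_cells)

lemma \<psi>_image_iff: "x \<in> verts X \<Longrightarrow> \<psi> x \<in> \<psi> ` F \<longleftrightarrow> x \<in> F"
  using \<psi>_inj F_sub by blast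

lemma \<psi>F_sub: "\<psi> ` F \<subseteq> F"
  using \<psi>_in_F F_sub by blast

text \<open>Two boundary points of a cell are adjacent in the reduced graph, hence images of
  adjacent vertices of \<open>X\<close>. These are not both in \<open>F\<close>, so at least one of
  the boundary points is outside the image of \<open>F\<close>.\<close>

lemma boundary_pairs:
  assumes "E \<in> cells X F" "p \<in> boundary X E" "q \<in> boundary X E" "p \<noteq> q"
  obtains x y where "x \<in> verts X" "y \<in> verts X" "p = \<psi> x" "q = \<psi> y" "adj X x y" "p \<notin> \<psi> ` F \<or> q \<notin> \<psi> ` F"
proof -
  have "p \<in> F" "q \<in> F" using boundary_sub assms by auto
  then obtain x y where xy: "x \<in> verts X" "\<psi> x = p" "y \<in> verts X" "\<psi> y = q" using \<psi>_surj by metis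
  then have "adj X x y" using \<psi>_adj[OF xy(1,3)] assms by auto
  moreover from this have "x \<notin> F \<or> y \<notin> F" using F_indep by blast
  ultimately show ?thesis using that[OF xy(1,3)] xy \<psi>_image_iff by auto
qed

lemma free_boundary_point:
  assumes "E \<in> cells X F" obtains p where "p \<in> boundary X E" "p \<notin> \<psi> ` F"
proof -
  obtain p where p: "p \<in> boundary X E" using other_boundary_point[OF assms] by blast
  obtain q where q: "q \<in> boundary X E" "q \<noteq> p" using other_boundary_point[OF assms] by blast
  show ?thesis by (rule boundary_pairs[OF assms p q(1)]) (use q p that in blast)+
qed

lemma cell_in_two_cell:
  assumes E: "E \<in> cells X F" and D: "D \<in> cells X (\<psi> ` F)" and y: "y \<in> E" "y \<in> D"
  shows "E \<subseteq> D"
proof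
  fix w assume "w \<in> E"
  then have "(adj (induced_subgraph X (verts X - F)))\<^sup>*\<^sup>* y w"
    using cell_linked[OF E y(1)] cell_sub[OF E] by blast
  then show "w \<in> D"
  proof (induction rule: rtranclp_induct)
    case (step u v)
    then show ?case using two.cell_closed[OF D step(3), of v] \<psi>F_sub by (auto simp: adj_induced_subgraph)
  qed (rule y(2))
qed

text \<open>An edge joins \<open>p\<close> to the cell, and none of its ends is removed in forming
  the 2-cells.\<close>

lemma boundary_in_two_cell:
  assumes E: "E \<in> cells X F" and D: "D \<in> cells X (\<psi> ` F)" and p: "p \<in> boundary X E" "p \<notin> \<psi> ` F"
  shows "E \<subseteq> D \<longleftrightarrow> p \<in> D"
proof
  obtain w where w: "w \<in> E" "adj X p w" using boundary_iff[OF E] p(1) by blast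
  show "p \<in> D" if "E \<subseteq> D" using two.cell_closed[OF D _ _ p(2), of w] that w adj_sym[of X] by blast
  show "E \<subseteq> D" if "p \<in> D"
  proof -
    have "w \<notin> F" using w cell_sub[OF E] by blast
    then have "w \<in> D" using two.cell_closed[OF D that w(2)] \<psi>F_sub by blast
    then show ?thesis using cell_in_two_cell[OF E D w(1)] by blast
  qed
qed

text \<open>Up to \<open>\<psi>\<close>, a 2-cell cuts out of \<open>F\<close> a 1-cell. In one
  direction a path in \<open>C\<close> is followed through 1-cells contained in \<open>D\<close>; in
  the other, a path in \<open>D\<close> is followed while recording which vertices of
  \<open>F\<close> border on it.\<close>

lemma two_cell_preimage:
  assumes D: "D \<in> cells X (\<psi> ` F)"
  obtains C where "C \<in> cells X F" "\<forall>x\<in>verts X. x \<in> C \<longleftrightarrow> \<psi> x \<in> D"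
proof -
  have "\<exists>p. p \<in> D \<and> p \<in> F"
  proof -
    obtain y where y: "y \<in> D" using two.cell_nonempty[OF D] by blast
    show ?thesis
    proof (cases "y \<in> F")
      case False
      then obtain E where E: "E \<in> cells X F" "y \<in> E" using in_some_cell[of y] two.cell_sub[OF D] y by blast
      obtain p where p: "p \<in> boundary X E" "p \<notin> \<psi> ` F" by (rule free_boundary_point[OF E(1)])
      have "p \<in> D" using boundary_in_two_cell[OF E(1) D p] cell_in_two_cell[OF E(1) D E(2) y] by blast
      then show ?thesis using p boundary_sub[OF E(1)] by blast
    qed (use y in blast)
  qed
  then obtain s where s: "s \<in> verts X" "\<psi> s \<in> D" using \<psi>_surj by metis
  have sF: "s \<notin> F" using s \<psi>_image_iff two.cell_sub[OF D] by blast
  obtain C where C: "C \<in> cells X F" "s \<in> C" by (rule in_some_cell[OF s(1) sF])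
  have adjC: "y \<in> C" if "x \<in> C" "y \<in> verts X" "E \<in> cells X F" "\<psi> x \<in> boundary X E" "\<psi> y \<in> boundary X E" "\<psi> y \<notin> \<psi> ` F" for x y E
  proof (cases "x = y")
    case False
    have "x \<in> verts X" using that(1) cell_sub[OF C(1)] by blast
    then have "adj X x y" using \<psi>_adj[of x y] that False by blast
    moreover have "y \<notin> F" using that by blast
    ultimately show ?thesis using cell_closed[OF C(1) that(1)] by blast
  qed (use that in simp)
  have fwd: "\<psi> x \<in> D" if x: "x \<in> C" for x
  proof -
    have "(adj (induced_subgraph X (verts X - F)))\<^sup>*\<^sup>* s x"
      using cell_linked[OF C] x cell_sub[OF C(1)] by blast
    then show ?thesis
    proof (induction rule: rtranclp_induct)
      case (step u v)
      then have uv: "adj X u v" "u \<in> verts X" "v \<in> verts X" "v \<notin> F" by (auto simp: adj_induced_subgraph)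
      then obtain E where E: "E \<in> cells X F" "\<psi> u \<in> boundary X E" "\<psi> v \<in> boundary X E"
        using \<psi>_adj[OF uv(2,3)] by blast
      have "\<psi> u \<notin> \<psi> ` F" using step(3) two.cell_sub[OF D] by blast
      moreover have "\<psi> v \<notin> \<psi> ` F" using uv \<psi>_image_iff by blast
      ultimately show ?case using boundary_in_two_cell[OF E(1) D] E step(3) by blast
    qed (rule s(2))
  qed
  \<comment> \<open>The invariant along a path: at a vertex of \<open>F\<close> its preimage is in
    \<open>C\<close>; inside a 1-cell \<open>E\<close> the preimages of all boundary points of
    \<open>E\<close> outside the image of \<open>F\<close> are in \<open>C\<close>. The second
    clause carries the information through the interior of \<open>E\<close>.\<close>
  define inv where "inv = (\<lambda>p. (p \<in> F \<longrightarrow> (\<forall>x\<in>verts X. \<psi> x = p \<longrightarrow> x \<in> C)) \<and>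
    (p \<notin> F \<longrightarrow> (\<forall>E\<in>cells X F. p \<in> E \<longrightarrow> (\<forall>x\<in>verts X. \<psi> x \<in> boundary X E \<longrightarrow> \<psi> x \<notin> \<psi> ` F \<longrightarrow> x \<in> C))))"
  have inv: "inv p" if p: "p \<in> D" for p
  proof -
    have "(adj (induced_subgraph X (verts X - \<psi> ` F)))\<^sup>*\<^sup>* (\<psi> s) p"
      using two.cell_linked[OF D s(2)] p two.cell_sub[OF D] by blast
    then show ?thesis
    proof (induction rule: rtranclp_induct)
      case base
      then show ?case using s C \<psi>_inj \<psi>_in_F unfolding inv_def by blast
    next
      case (step p q)
      then have pq: "adj X p q" "p \<in> verts X" "q \<in> verts X" "p \<notin> \<psi> ` F" "q \<notin> \<psi> ` F"
        by (auto simp: adj_induced_subgraph)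
      have qp: "adj X q p" using pq adj_sym[of X] by blast
      consider "p \<in> F" "q \<notin> F" | "p \<notin> F" "q \<in> F" | "p \<notin> F" "q \<notin> F" using pq F_indep by blast
      then show ?case
      proof cases
        case 1
        obtain x where x: "x \<in> verts X" "\<psi> x = p" using 1 \<psi>_surj by blast
        then have xC: "x \<in> C" using step(3) 1 unfolding inv_def by blast
        have "y \<in> C" if "E \<in> cells X F" "q \<in> E" "y \<in> verts X" "\<psi> y \<in> boundary X E" "\<psi> y \<notin> \<psi> ` F" for E y
        proof -
          have "\<psi> x \<in> boundary X E" using boundary_iff[OF that(1)] 1 pq(1) that(2) x by blast
          then show ?thesis using adjC[OF xC that(3,1)] that by blast
        qed
        then show ?thesis using 1 unfolding inv_def by blast
      next
        case 2
        obtain E where E: "E \<in> cells X F" "p \<in> E" using in_some_cell[OF pq(2)] 2 by blast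
        then have "q \<in> boundary X E" using boundary_iff[OF E(1)] 2 qp by blast
        then show ?thesis using step(3) 2 E pq(5) unfolding inv_def by blast
      next
        case 3
        have "p \<in> E" if "E \<in> cells X F" "q \<in> E" for E using cell_closed[OF that qp 3(1)] .
        then show ?thesis using step(3) 3 unfolding inv_def by blast
      qed
    qed
  qed
  show ?thesis
  proof (rule that[OF C(1)])
    have "x \<in> C \<longleftrightarrow> \<psi> x \<in> D" if "x \<in> verts X" for x
      using fwd inv[of "\<psi> x"] \<psi>_in_F[OF that] that unfolding inv_def by blast
    then show "\<forall>x\<in>verts X. x \<in> C \<longleftrightarrow> \<psi> x \<in> D" by blast
  qed
qed

lemma card_ordered_pairs: "finite A \<Longrightarrow> card {(p, q). p \<in> A \<and> q \<in> A \<and> p \<noteq> q} = card A * (card A - 1)"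
proof -
  assume A: "finite A"
  have "{(p, q). p \<in> A \<and> q \<in> A \<and> p \<noteq> q} = (SIGMA p:A. A - {p})" by auto
  then have "card {(p, q). p \<in> A \<and> q \<in> A \<and> p \<noteq> q} = (\<Sum>p\<in>A. card (A - {p}))" using A by simp
  also have "\<dots> = (\<Sum>p\<in>A. card A - 1)" using A by (intro sum.cong) auto
  finally show ?thesis by simp
qed

text \<open>Double counting: \<open>\<psi>\<close> maps the ordered edges of the cell graph of
  \<open>C\<close> bijectively to the ordered pairs of distinct boundary points of 1-cells inside
  \<open>D\<close>. There are \<open>vol\<close> such edges; each 1-cell contributes
  \<open>\<theta> * (\<theta> - 1)\<close> pairs, and by (F2) no pair belongs to two cells.\<close>

lemma cells_in_two_cell:
  assumes D: "D \<in> cells X (\<psi> ` F)"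
  shows "card {E \<in> cells X F. E \<subseteq> D} * (\<theta> * (\<theta> - 1)) = vol"
proof -
  obtain C where C: "C \<in> cells X F" "\<forall>x\<in>verts X. x \<in> C \<longleftrightarrow> \<psi> x \<in> D"
    by (rule two_cell_preimage[OF D])
  let ?Y = "hat_graph X C" and ?S = "{E \<in> cells X F. E \<subseteq> D}"
  interpret Y: lf_graph ?Y by (rule hat_lf)
  define pairs where "pairs = (\<lambda>E. {(p, q). p \<in> boundary X E \<and> q \<in> boundary X E \<and> p \<noteq> q})"
  have Vsub: "verts ?Y \<subseteq> verts X" using cell_sub[OF C(1)] boundary_sub[OF C(1)] F_sub by (auto simp: hat_graph_verts)
  have finV: "finite (verts ?Y)" using cell_finite[OF C(1)] boundary_finite[OF C(1)] by (simp add: hat_graph_verts)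
  \<comment> \<open>Boundary points are not joined to each other, so the edges of the cell graph are
    the edges of \<open>X\<close> with an end in \<open>C\<close>.\<close>
  have Yadj: "adj ?Y x y \<longleftrightarrow> adj X x y \<and> (x \<in> C \<or> y \<in> C)" for x y
  proof
    assume "adj ?Y x y"
    then show "adj X x y \<and> (x \<in> C \<or> y \<in> C)"
      using boundary_sub[OF C(1)] F_indep by (auto simp: hat_graph_adj)
  next
    assume h: "adj X x y \<and> (x \<in> C \<or> y \<in> C)"
    have side: "v \<in> C \<union> boundary X C" if "adj X u v" "u \<in> C" for u v
      using cell_closed[OF C(1) that(2,1)] boundary_iff[OF C(1)] that adj_sym[of X] by blast
    show "adj ?Y x y" using h side[of x y] side[of y x] adj_sym[of X x y] by (auto simp: hat_graph_adj)
  qed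
  define A where "A = {(x, y). adj ?Y x y}"
  have "A = (SIGMA x:verts ?Y. neighbours ?Y x)" using Y.adj_vertsD by (auto simp: A_def neighbours_def)
  then have cardA: "card A = vol" and finA: "finite A"
    using finV Y.finite_neighbours hat_volume[OF C(1)] by (auto simp: degree_def)
  have img: "map_prod \<psi> \<psi> ` A = (\<Union>E\<in>?S. pairs E)"
  proof (intro equalityI subsetI)
    fix pq assume "pq \<in> map_prod \<psi> \<psi> ` A"
    then obtain x y where xy: "pq = (\<psi> x, \<psi> y)" "adj X x y" "x \<in> C \<or> y \<in> C" using Yadj by (auto simp: A_def)
    have V: "x \<in> verts X" "y \<in> verts X" using adj_vertsD xy(2) by auto
    obtain E where E: "E \<in> cells X F" "\<psi> x \<in> boundary X E" "\<psi> y \<in> boundary X E" and ne: "x \<noteq> y"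
      using \<psi>_adj[OF V] xy(2) by blast
    have "\<exists>p. p \<in> boundary X E \<and> p \<in> D" using xy(3) C(2) V E by blast
    then have "E \<subseteq> D" using boundary_in_two_cell[OF E(1) D] two.cell_sub[OF D] by blast
    then show "pq \<in> (\<Union>E\<in>?S. pairs E)" using E xy(1) ne \<psi>_inj[OF V] by (auto simp: pairs_def)
  next
    fix pq assume "pq \<in> (\<Union>E\<in>?S. pairs E)"
    then obtain E p q where E: "E \<in> cells X F" "E \<subseteq> D" "pq = (p, q)" "p \<in> boundary X E" "q \<in> boundary X E" "p \<noteq> q"
      by (auto simp: pairs_def)
    obtain x y where xy: "x \<in> verts X" "y \<in> verts X" "p = \<psi> x" "q = \<psi> y" "adj X x y" "p \<notin> \<psi> ` F \<or> q \<notin> \<psi> ` F"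
      by (rule boundary_pairs[OF E(1,4,5,6)])
    have "p \<in> D \<or> q \<in> D" using xy(6) boundary_in_two_cell[OF E(1) D] E by blast
    then have "x \<in> C \<or> y \<in> C" using C(2) xy by blast
    then have "(x, y) \<in> A" using xy(5) Yadj by (simp add: A_def)
    then show "pq \<in> map_prod \<psi> \<psi> ` A" using E(3) xy(3,4) by force
  qed
  have "inj_on (map_prod \<psi> \<psi>) A"
  proof (rule inj_onI)
    fix s t assume "s \<in> A" "t \<in> A" "map_prod \<psi> \<psi> s = map_prod \<psi> \<psi> t"
    then show "s = t" using \<psi>_inj Yadj adj_vertsD unfolding A_def by (cases s, cases t) auto
  qed
  from card_image[OF this] have card1: "card (\<Union>E\<in>?S. pairs E) = vol" unfolding cardA img .
  have fin1: "finite (\<Union>E\<in>?S. pairs E)" using finite_imageI[OF finA] unfolding img[symmetric] .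
  have finp: "finite (pairs E)" and cardp: "card (pairs E) = \<theta> * (\<theta> - 1)" if "E \<in> ?S" for E
  proof -
    have E: "E \<in> cells X F" using that by simp
    show "card (pairs E) = \<theta> * (\<theta> - 1)"
      unfolding pairs_def using card_ordered_pairs[OF boundary_finite[OF E]] card_boundary[OF E] by simp
    have "pairs E \<subseteq> boundary X E \<times> boundary X E" by (auto simp: pairs_def)
    then show "finite (pairs E)" using boundary_finite[OF E] finite_subset by blast
  qed
  have disj: "pairs E \<inter> pairs E' = {}" if "E \<in> ?S" "E' \<in> ?S" "E \<noteq> E'" for E E'
    using that boundary_inter[of E E'] by (auto simp: pairs_def)
  have ne: "pairs E \<noteq> {}" if "E \<in> ?S" for E
    using cardp[OF that] \<theta>_ge by auto
  have inj: "inj_on pairs ?S"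
  proof (rule inj_onI, rule ccontr)
    fix E E' assume E: "E \<in> ?S" "E' \<in> ?S" "pairs E = pairs E'" "E \<noteq> E'"
    then show False using disj[OF E(1,2,4)] ne[OF E(1)] by simp
  qed
  have "finite (pairs ` ?S)" using fin1 by (rule finite_UnionD)
  then have finS: "finite ?S" using inj by (rule finite_imageD)
  have "card (\<Union>E\<in>?S. pairs E) = (\<Sum>E\<in>?S. card (pairs E))"
    by (rule card_UN_disjoint[OF finS]) (use finp disj in auto)
  also have "\<dots> = card ?S * (\<theta> * (\<theta> - 1))" using cardp by simp
  finally show ?thesis using card1 by simp
qed

lemma two_cell_exists: "\<exists>D. D \<in> cells X (\<psi> ` F)"
proof -
  obtain s where "s \<in> C0" using cell_nonempty[OF ref(1)] by blast
  then have s: "s \<in> verts X" "s \<notin> F" using cell_sub[OF ref(1)] by auto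
  have "\<psi> s \<in> verts X" using \<psi>_in_F[OF s(1)] F_sub by blast
  moreover have "\<psi> s \<notin> \<psi> ` F" using s \<psi>_image_iff by blast
  ultimately show ?thesis using two.in_some_cell by blast
qed

lemma mass_scaling_eq: "real (mass_scaling X F \<psi>) * (real \<theta> * real (\<theta> - 1)) = real vol"
proof -
  obtain D where D: "D \<in> cells X (\<psi> ` F)" using two_cell_exists by blast
  let ?m = "card {E \<in> cells X F. E \<subseteq> D}"
  have pos: "\<theta> * (\<theta> - 1) > 0" using \<theta>_ge by simp
  have "mass_scaling X F \<psi> = ?m" unfolding mass_scaling_def
  proof (rule the_equality)
    show "\<forall>D'\<in>cells X (\<psi> ` F). card {C \<in> cells X F. C \<subseteq> D'} = ?m"
    proof
      fix D' assume "D' \<in> cells X (\<psi> ` F)"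
      then have "card {E \<in> cells X F. E \<subseteq> D'} * (\<theta> * (\<theta> - 1)) = ?m * (\<theta> * (\<theta> - 1))"
        using cells_in_two_cell[OF D] cells_in_two_cell by simp
      then show "card {C \<in> cells X F. C \<subseteq> D'} = ?m" using pos by simp
    qed
    show "m = ?m" if "\<forall>D'\<in>cells X (\<psi> ` F). card {C \<in> cells X F. C \<subseteq> D'} = m" for m
      using bspec[OF that D] by (rule sym)
  qed
  then have "mass_scaling X F \<psi> * (\<theta> * (\<theta> - 1)) = vol" using cells_in_two_cell[OF D] by simp
  then show ?thesis by (metis of_nat_mult)
qed

text \<open>With \<open>\<delta>0 = \<theta> - 1\<close> and
  \<open>vol = \<mu> * \<theta> * (\<theta> - 1)\<close>, the balance in
  \<open>transition_at_1\<close> becomes \<open>\<tau> = f1 * \<mu>\<close>, which is the value of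
  \<open>f\<close> at 1 that \<open>singular_renewal\<close> demands.\<close>

lemma green_expansion:
  "\<exists>(\<omega> :: complex \<Rightarrow> complex) (r :: real).
    \<omega> holomorphic_on strip (time_scaling X F) \<and>
    (\<forall>s\<in>strip (time_scaling X F). \<omega> (s + 1) = \<omega> s) \<and>
    r > 0 \<and>
    (\<forall>\<delta>::real. 0 < \<delta> \<and> \<delta> < pi \<longrightarrow>
      (\<exists>(R :: complex \<Rightarrow> complex) (K :: real).
        (\<forall>z\<in>U_region \<delta> 1 r. norm (R z) \<le> K * norm (z - 1)) \<and>
        (\<forall>z\<in>U_region \<delta> 1 r.
          green_function X v0 z =
            (1 - z) powr of_real (spectral_dim X F \<psi> / 2 - 1) *
            (\<omega> (Ln (1 - z) / of_real (ln (time_scaling X F))) + R z))))"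
proof -
  interpret N: hitting_net "hat_graph X C0" "boundary X C0" \<theta> \<gamma>0 \<gamma>1 hit_coeff ret_coeff \<delta>0 by (rule hat_hitting_net[OF ref(1)])
  obtain r \<tau> f1 where T: "r > 1" "\<tau> \<ge> 2" "f1 > 0" "summable hit_coeff"
    "hit_gf \<theta> hit_coeff holomorphic_on ball 0 r" "return_gf ret_coeff holomorphic_on ball 0 r"
    "hit_gf \<theta> hit_coeff 1 = 1" "(hit_gf \<theta> hit_coeff has_field_derivative of_real \<tau>) (at 1)"
    "return_gf ret_coeff 1 = of_real f1" "real \<theta> * real \<delta>0 * \<tau> = f1 * (\<Sum>y\<in>verts (hat_graph X C0). real (degree (hat_graph X C0) y))"
    "\<forall>z\<in>ball 0 r. hit_gf \<theta> hit_coeff (cnj z) = cnj (hit_gf \<theta> hit_coeff z)"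
    by (rule N.transition_at_1)
  define \<mu> where "\<mu> = real (mass_scaling X F \<psi>)"
  have "real \<theta> * real (\<theta> - 1) * \<tau> = f1 * (\<mu> * (real \<theta> * real (\<theta> - 1)))"
    using T(10) mass_scaling_eq by (simp add: \<delta>0_eq \<mu>_def vol_def)
  then have "(real \<theta> * real (\<theta> - 1)) * \<tau> = (real \<theta> * real (\<theta> - 1)) * (f1 * \<mu>)" by (simp only: mult_ac)
  then have \<tau>: "\<tau> = f1 * \<mu>" using \<theta>_ge by simp
  have \<mu>_pos: "\<mu> > 0" using T(2,3) \<tau> by (metis \<mu>_def less_le mult_zero_right not_numeral_le_zero of_nat_0_le_iff)
  have ts: "time_scaling X F = \<tau>" by (rule time_scaling_eq[OF T(8)])
  note gf = green_function_props[OF v0_in(1) degree_pos[OF v0_in(1)]]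
  \<comment> \<open>The functions are holomorphic on the disc of radius \<open>r\<close> about 0,
    hence on the disc of radius \<open>r - 1\<close> about 1.\<close>
  have sub: "ball (1::complex) (r - 1) \<subseteq> ball 0 r"
    by (simp add: ball_subset_ball_iff dist_norm)
  interpret S: singular_renewal "green_function X v0" "hit_gf \<theta> hit_coeff" "return_gf ret_coeff" \<tau> \<mu> "r - 1"
  proof
    show "green_function X v0 holomorphic_on green_domain" by (rule gf(1))
    show "hit_gf \<theta> hit_coeff holomorphic_on ball 1 (r - 1)" "return_gf ret_coeff holomorphic_on ball 1 (r - 1)"
      using T(5,6) sub by (auto intro: holomorphic_on_subset)
    show "return_gf ret_coeff 1 = of_real (\<tau> / \<mu>)" using T(9) \<tau> \<mu>_pos by simp
    show "hit_gf \<theta> hit_coeff (cnj z) = cnj (hit_gf \<theta> hit_coeff z)" if "z \<in> ball 1 (r - 1)" for z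
      using T(11) sub that by blast
    show "norm (hit_gf \<theta> hit_coeff z) < 1 \<and> green_function X v0 z = return_gf ret_coeff z * green_function X v0 (hit_gf \<theta> hit_coeff z)"
      if "norm z < 1" for z
    proof -
      have dz: "norm (hit_gf \<theta> hit_coeff z) < 1" by (rule N.norm_hit_gf_less_1[OF T(4,7) that])
      then show ?thesis using functional_equation[OF that dz] gf(2)[OF that] gf(2)[OF dz] by simp
    qed
  qed (use T \<mu>_pos in auto)
  have \<alpha>: "spectral_dim X F \<psi> / 2 - 1 = S.\<alpha>" 
    unfolding S.\<alpha>_def by (simp add: spectral_dim_def ts \<mu>_def)
  obtain \<omega> where \<omega>: "\<omega> holomorphic_on strip \<tau>" "\<forall>s\<in>strip \<tau>. \<omega> (s + 1) = \<omega> s"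
    "\<forall>\<delta>. 0 < \<delta> \<and> \<delta> < pi \<longrightarrow> (\<exists>R K. (\<forall>z\<in>U_region \<delta> 1 1. norm (R z) \<le> K * norm (z - 1)) \<and>
       (\<forall>z\<in>U_region \<delta> 1 1. green_function X v0 z = (1 - z) powr of_real S.\<alpha> * (\<omega> (Ln (1 - z) / of_real (ln \<tau>)) + R z)))"
    by (rule S.singular_expansion)
  show ?thesis unfolding ts \<alpha> by (intro exI[of _ \<omega>] exI[of _ 1] conjI \<omega>) simp
qed

end

theorem theorem5:
  fixes X :: "'a ugraph" and F :: "'a set" and \<psi> :: "'a \<Rightarrow> 'a" and orig :: 'a
  assumes "symmetrically_self_similar X F \<psi>"
    and "bounded_geometry X"
    and "origin_vertex X \<psi> orig"
  shows "\<exists>(\<omega> :: complex \<Rightarrow> complex) (r :: real).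
    \<omega> holomorphic_on strip (time_scaling X F) \<and>
    (\<forall>s\<in>strip (time_scaling X F). \<omega> (s + 1) = \<omega> s) \<and>
    r > 0 \<and>
    (\<forall>\<delta>::real. 0 < \<delta> \<and> \<delta> < pi \<longrightarrow>
      (\<exists>(R :: complex \<Rightarrow> complex) (K :: real).
        (\<forall>z\<in>U_region \<delta> 1 r. norm (R z) \<le> K * norm (z - 1)) \<and>
        (\<forall>z\<in>U_region \<delta> 1 r.
          green_function X orig z =
            (1 - z) powr of_real (spectral_dim X F \<psi> / 2 - 1) *
            (\<omega> (Ln (1 - z) / of_real (ln (time_scaling X F))) + R z))))"
proof -
  interpret self_similar_origin X F \<psi> orig
    by unfold_locales (use assms in \<open>auto simp: symmetrically_self_similar_def self_similar_def\<close>)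
  show ?thesis by (rule green_expansion)
qed

end
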